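(* Let $h,\lambda\in(0,\frac12]$, $\varrho\in[1,\infty)$ and $m\in[2,\infty)$. Then $$\min_{A^{vKD}_{\lambda,\varrho,m}}E^{vKD}_h-\mathcal{E}^{vKD}_b(\varrho)\ \sim_m\ \min\left\{\lambda^2,\ \max\left\{(\varrho-1)^{4/7}h^{6/7}\lambda^{5/7},\ (\varrho-1)^{2/3}h^{2/3}\lambda\right\}\right\}$$ whenever $\varrho-1\ge c_0(\lambda,h,m)$, where $c_0(\lambda,h,m)=\min\{\lambda^{1/2}h^{1/4},\,m^{1/2}h^{1/2}\}$. In the case $m=\infty$ (with $h,\lambda\in(0,\frac12]$, $\varrho\in[1,\infty)$), $$\min_{A^{vKD}_{\lambda,\varrho,\infty}}E^{vKD}_h-\mathcal{E}^{vKD}_b(\varrho)\ \sim\ \min\left\{\lambda^2,\ (\varrho-1)^{4/7}h^{6/7}\lambda^{5/7}\right\}$$ whenever $\varrho-1\ge c_0(\lambda,h,\infty)=\lambda^{1/2}h^{1/4}$.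
   Context: Let $I_\theta=[0,2\pi]$, $I_z=[-\frac12,\frac12]$, $\Omega=I_\theta\times I_z$ with coordinates $(\theta,z)$; $|\Omega|=2\pi$ is its area. $H^k_{\mathrm{per}}(\Omega)$ is the space of ($\Omega$-)periodic $L^2$-based Sobolev functions of order $k$ on $\Omega$. For a displacement $\phi=(\phi_\rho,\phi_\theta,\phi_z):\Omega\to\mathbb{R}^3$ (cylindrical components), the von Kármán–Donnell strain $\epsilon$ is the symmetric $2\times2$ matrix with entries $\epsilon_{\theta\theta}=\partial_\theta\phi_\theta+\frac12(\partial_\theta\phi_\rho)^2+\phi_\rho$, $\epsilon_{zz}=\partial_z\phi_z+\frac12(\partial_z\phi_\rho)^2$, $\epsilon_{\theta z}=\frac12(\partial_\theta\phi_z+\partial_z\phi_\theta)+\frac12\partial_\theta\phi_\rho\,\partial_z\phi_\rho$. The energy is $E^{vKD}_h(\phi)=\int_\Omega |\epsilon|^2+h^2|D^2\phi_\rho|^2\,d\theta\,dz$ (Euclidean matrix norms). The admissible set $A^{vKD}_{\lambda,\varrho,m}$ consists of all $\phi:\Omega\to\mathbb{R}^3$ with $\phi_\rho\in H^2_{\mathrm{per}}(\Omega)$, $\phi_\theta\in H^1_{\mathrm{per}}(\Omega)$, $\phi_z+\lambda z\in H^1_{\mathrm{per}}(\Omega)$, $\phi_\rho\ge\varrho-1$, and $\max_{i\in\{\theta,z\},\,j\in\{\rho,\theta,z\}}\|\partial_i\phi_j\|_{L^\infty(\Omega)}\le m$ (no constraint if $m=\infty$). The bulk energy is $\mathcal{E}^{vKD}_b(\varrho)=|\Omega|(\varrho-1)^2$.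 $\min_A E$ denotes the minimum energy value, i.e. the infimum of $E$ over $A$. $X\lesssim Y$ (resp. $X\lesssim_a Y$) means $X\le CY$ with $C>0$ a numerical constant (resp. depending only on $a$); $X\sim Y$ (resp. $X\sim_a Y$) means both $X\lesssim Y$ and $Y\lesssim X$ (resp. with $\lesssim_a$). *)

theory Defs
  imports "HOL-Analysis.Analysis" "HOL-Probability.Essential_Supremum"
begin

section \<open>Weak derivatives and local Sobolev spaces\<close>

primrec Ck :: "nat \<Rightarrow> ('a::euclidean_space \<Rightarrow> real) \<Rightarrow> bool" where
  "Ck 0 f = continuous_on UNIV f"
| "Ck (Suc k) f = ((\<forall>x. f differentiable (at x)) \<and>
     (\<forall>e\<in>Basis. Ck k (\<lambda>x. frechet_derivative f (at x) e)))"

definition test_function :: "'a::euclidean_space set \<Rightarrow> ('a \<Rightarrow> real) \<Rightarrow> bool" where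
  "test_function U \<psi> \<longleftrightarrow> (\<forall>k. Ck k \<psi>) \<and>
     compact (closure {x. \<psi> x \<noteq> 0}) \<and> closure {x. \<psi> x \<noteq> 0} \<subseteq> U"

definition locally_integrable :: "'a::euclidean_space set \<Rightarrow> ('a \<Rightarrow> real) \<Rightarrow> bool" where
  "locally_integrable U f \<longleftrightarrow> (\<forall>K. compact K \<and> K \<subseteq> U \<longrightarrow> set_integrable lebesgue K f)"

definition locally_L2 :: "'a::euclidean_space set \<Rightarrow> ('a \<Rightarrow> real) \<Rightarrow> bool" where
  "locally_L2 U f \<longleftrightarrow> (\<forall>K. compact K \<and> K \<subseteq> U \<longrightarrow>
     set_borel_measurable lebesgue K f \<and> set_integrable lebesgue K (\<lambda>x. (f x)\<^sup>2))"

definition has_weak_pderiv ::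
    "'a::euclidean_space set \<Rightarrow> 'a \<Rightarrow> ('a \<Rightarrow> real) \<Rightarrow> ('a \<Rightarrow> real) \<Rightarrow> bool" where
  "has_weak_pderiv U e f g \<longleftrightarrow> locally_integrable U f \<and> locally_integrable U g \<and>
     (\<forall>\<psi>. test_function U \<psi> \<longrightarrow>
        set_lebesgue_integral lebesgue U (\<lambda>x. f x * frechet_derivative \<psi> (at x) e) =
        - set_lebesgue_integral lebesgue U (\<lambda>x. g x * \<psi> x))"

text \<open>For open \<open>U\<close> the weak derivative is unique up to a null subset of \<open>U\<close>;
  everything below depends only on its almost-everywhere class.\<close>

definition weak_pderiv :: "'a::euclidean_space set \<Rightarrow> 'a \<Rightarrow> ('a \<Rightarrow> real) \<Rightarrow> 'a \<Rightarrow> real" where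
  "weak_pderiv U e f = (SOME g. has_weak_pderiv U e f g)"

primrec H_loc :: "nat \<Rightarrow> 'a::euclidean_space set \<Rightarrow> ('a \<Rightarrow> real) \<Rightarrow> bool" where
  "H_loc 0 U f = locally_L2 U f"
| "H_loc (Suc k) U f = (locally_L2 U f \<and>
     (\<forall>e\<in>Basis. \<exists>g. has_weak_pderiv U e f g \<and> H_loc k U g))"

section \<open>The cylinder\<close>

text \<open>Points of the plane are pairs \<open>(\<theta>, z)\<close>. Functions on \<open>Omega\<close> are total functions on
  the plane, but no notion below depends on their values outside \<open>Omega\<close> (or on a null set).\<close>

definition Omega :: "(real \<times> real) set" where
  "Omega = {0..2*pi} \<times> {-1/2..1/2}"

abbreviation e\<theta> :: "real \<times> real" where "e\<theta> \<equiv> (1, 0)"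
abbreviation ez :: "real \<times> real" where "ez \<equiv> (0, 1)"

definition periodic_extension :: "(real \<times> real \<Rightarrow> real) \<Rightarrow> real \<times> real \<Rightarrow> real" where
  "periodic_extension f = (\<lambda>(\<theta>, z).
     f (\<theta> - 2 * pi * of_int \<lfloor>\<theta> / (2 * pi)\<rfloor>, z - of_int \<lfloor>z + 1/2\<rfloor>))"

text \<open>Working with the extension on the whole plane rules out jumps of \<open>f\<close> (and of its
  derivatives of order below \<open>k\<close>) across the identified sides of \<open>Omega\<close>.\<close>

definition H_per :: "nat \<Rightarrow> (real \<times> real \<Rightarrow> real) set" where
  "H_per k = {f. H_loc k UNIV (periodic_extension f)}"

text \<open>Derivatives of displacements are taken inside \<open>Omega\<close>, because the axial component is
  periodic only after adding \<open>lam z\<close>.\<close>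

abbreviation pd :: "real \<times> real \<Rightarrow> (real \<times> real \<Rightarrow> real) \<Rightarrow> real \<times> real \<Rightarrow> real" where
  "pd \<equiv> weak_pderiv (interior Omega)"

definition Linf_norm :: "(real \<times> real \<Rightarrow> real) \<Rightarrow> ereal" where
  "Linf_norm f = esssup (lebesgue_on Omega) (\<lambda>x. ereal \<bar>f x\<bar>)"

section \<open>The von Karman--Donnell energy\<close>

text \<open>The components of a displacement are ordered as \<open>(\<rho>, \<theta>, z)\<close>.\<close>

type_synonym displacement = "real \<times> real \<Rightarrow> real \<times> real \<times> real"

definition comp_\<rho> :: "displacement \<Rightarrow> real \<times> real \<Rightarrow> real" where
  "comp_\<rho> \<phi> = (\<lambda>x. fst (\<phi> x))"

definition comp_\<theta> :: "displacement \<Rightarrow> real \<times> real \<Rightarrow> real" where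
  "comp_\<theta> \<phi> = (\<lambda>x. fst (snd (\<phi> x)))"

definition comp_z :: "displacement \<Rightarrow> real \<times> real \<Rightarrow> real" where
  "comp_z \<phi> = (\<lambda>x. snd (snd (\<phi> x)))"

definition strain :: "displacement \<Rightarrow> real \<times> real \<Rightarrow> real^2^2" where
  "strain \<phi> x =
    (let s\<theta>\<theta> = pd e\<theta> (comp_\<theta> \<phi>) x + 1/2 * (pd e\<theta> (comp_\<rho> \<phi>) x)\<^sup>2 + comp_\<rho> \<phi> x;
         szz = pd ez (comp_z \<phi>) x + 1/2 * (pd ez (comp_\<rho> \<phi>) x)\<^sup>2;
         s\<theta>z = 1/2 * (pd e\<theta> (comp_z \<phi>) x + pd ez (comp_\<theta> \<phi>) x)
               + 1/2 * pd e\<theta> (comp_\<rho> \<phi>) x * pd ez (comp_\<rho> \<phi>) x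
     in vector [vector [s\<theta>\<theta>, s\<theta>z], vector [s\<theta>z, szz]])"

definition hessian :: "(real \<times> real \<Rightarrow> real) \<Rightarrow> real \<times> real \<Rightarrow> real^2^2" where
  "hessian f x = vector [vector [pd e\<theta> (pd e\<theta> f) x, pd e\<theta> (pd ez f) x],
                         vector [pd ez (pd e\<theta> f) x, pd ez (pd ez f) x]]"

text \<open>The library norm of \<^typ>\<open>real^2^2\<close> is the Euclidean (Frobenius) norm. The integral is
  the extended nonnegative one, so a divergent energy is infinite rather than \<open>0\<close>.\<close>

definition E_vKD :: "real \<Rightarrow> displacement \<Rightarrow> ereal" where
  "E_vKD h \<phi> = enn2ereal (\<integral>\<^sup>+ x. ennreal ((norm (strain \<phi> x))\<^sup>2
       + h\<^sup>2 * (norm (hessian (comp_\<rho> \<phi>) x))\<^sup>2) \<partial>lebesgue_on Omega)"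

definition A_vKD :: "real \<Rightarrow> real \<Rightarrow> ereal \<Rightarrow> displacement set" where
  "A_vKD lam rho m = {\<phi>.
     comp_\<rho> \<phi> \<in> H_per 2 \<and>
     comp_\<theta> \<phi> \<in> H_per 1 \<and>
     (\<lambda>x. comp_z \<phi> x + lam * snd x) \<in> H_per 1 \<and>
     (AE x in lebesgue_on Omega. comp_\<rho> \<phi> x \<ge> rho - 1) \<and>
     (\<forall>e\<in>{e\<theta>, ez}. \<forall>f\<in>{comp_\<rho> \<phi>, comp_\<theta> \<phi>, comp_z \<phi>}. Linf_norm (pd e f) \<le> m)}"

definition min_E_vKD :: "real \<Rightarrow> real \<Rightarrow> real \<Rightarrow> ereal \<Rightarrow> ereal" where
  "min_E_vKD h lam rho m = (INF \<phi>\<in>A_vKD lam rho m. E_vKD h \<phi>)"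

definition E_bulk :: "real \<Rightarrow> real" where
  "E_bulk rho = measure lebesgue Omega * (rho - 1)\<^sup>2"

definition excess_energy :: "real \<Rightarrow> real \<Rightarrow> real \<Rightarrow> ereal \<Rightarrow> ereal" where
  "excess_energy h lam rho m = min_E_vKD h lam rho m - ereal (E_bulk rho)"

end

theory Submission
  imports Defs
begin

text \<open>Write \<open>r = rho - 1\<close>, and let \<open>w = \<phi>\<^sub>\<rho> - r \<ge> 0\<close> be the distance to the mandrel.

\<^bold>\<open>Lower bound.\<close> The inequality \<open>x\<^sup>2 \<ge> 2 r x - r\<^sup>2\<close>, applied to the hoop strain, uses
that \<open>\<partial>\<^sub>\<theta> \<phi>\<^sub>\<theta>\<close> has mean zero and bounds the energy above the bulk value below by the integral over
\<open>\<theta>\<close> of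
\<open>\<integral> 2 r w + \<epsilon>\<^sub>z\<^sub>z\<^sup>2 + h\<^sup>2 (\<partial>\<^sub>z\<^sup>2 \<phi>\<^sub>\<rho>)\<^sup>2 dz\<close>, so that only one-dimensional axial slices matter.
The axial displacement loses \<open>lam\<close> over one period, hence \<open>\<integral> \<epsilon>\<^sub>z\<^sub>z dz = D/2 - lam\<close> with
\<open>D = \<integral> (\<partial>\<^sub>z \<phi>\<^sub>\<rho>)\<^sup>2 dz\<close>. If \<open>D < lam\<close>, the slice pays \<open>lam\<^sup>2/4\<close>. Otherwise the slice has to
buckle, and a nonnegative periodic profile with slope energy \<open>D\<close> pays through interpolation
between \<open>A = \<integral> w\<close> and \<open>B = \<integral> w''\<^sup>2\<close>: in general \<open>D\<^sup>5 \<le> 4 A\<^sup>4 B\<^sup>3\<close>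
(\<open>profile_interpolation\<close>), and for slopes at most \<open>m\<close> also
\<open>D \<le> 2 \<tau> sqrt (A B) + m\<^sup>2 A / \<tau>\<^sup>2\<close> for every \<open>\<tau>\<close> (\<open>profile_interpolation_bounded_slope\<close>).
Minimising \<open>r A + h\<^sup>2 B\<close> under these constraints with \<open>D \<ge> lam\<close> produces exactly the two
powers of the theorem.

To work with slices of Sobolev functions one needs that weak derivatives restrict to almost
every line: \<open>absolutely_continuous_slices\<close>. It rests on the fundamental lemma of the calculus
of variations (\<open>fundamental_lemma\<close>), for which explicit smooth bump functions are built first.

\<^bold>\<open>Upper bound.\<close> Axisymmetric displacements suffice. Given a profile \<open>w\<close> of the axial variable
alone with \<open>\<integral> w'\<^sup>2 = 2 lam\<close>, one chooses \<open>\<phi>\<^sub>z\<close> such that \<open>\<epsilon>\<^sub>z\<^sub>z = 0\<close> and pays only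
\<open>2 pi \<integral> 2 r w + w\<^sup>2 + h\<^sup>2 w''\<^sup>2\<close> (\<open>axisymmetric_upper_bound\<close>). Taking \<open>n\<close> folds per period,
each occupying a length \<open>s/n\<close>, this costs
\<open>r sqrt (lam s\<^sup>3) / n + lam s\<^sup>2 / n\<^sup>2 + h\<^sup>2 lam n\<^sup>2 / s\<^sup>2\<close> with slope of order \<open>sqrt (lam/s)\<close>
(\<open>localized_upper_bound\<close>). One fold of optimal length gives the first power; it is admissible
for bounded slopes as long as \<open>r lam\<^sup>3 \<le> h\<^sup>2\<close>. Beyond that one takes as many folds as the
slope bound demands and obtains the second power. The threshold on \<open>rho - 1\<close> is what lets the
bending term absorb the middle term, which is quadratic in \<open>w\<close>.\<close>

section \<open>Smooth functions of one variable and product test functions\<close>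

text \<open>The requirement is an iterated existence of derivatives rather than a statement about \<open>deriv\<close>, so
that closure properties follow by induction on the order with the derivative given explicitly.\<close>

primrec times_differentiable :: "nat \<Rightarrow> (real \<Rightarrow> real) \<Rightarrow> bool" where
  "times_differentiable 0 f = True"
| "times_differentiable (Suc k) f =
     (\<exists>f'. (\<forall>x. (f has_real_derivative f' x) (at x)) \<and> times_differentiable k f')"

definition smooth :: "(real \<Rightarrow> real) \<Rightarrow> bool" where
  "smooth f \<longleftrightarrow> (\<forall>k. times_differentiable k f)"

lemma times_differentiable_mono:
  "times_differentiable (Suc k) f \<Longrightarrow> times_differentiable k f"
  by (induction k arbitrary: f) auto

lemma smooth_obtain_deriv:
  assumes "smooth f"
  obtains f' where "\<And>x. (f has_real_derivative f' x) (at x)" "smooth f'"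
proof -
  have "times_differentiable 1 f" using assms by (simp add: smooth_def)
  then obtain f' where f': "\<And>x. (f has_real_derivative f' x) (at x)" by auto
  have "times_differentiable k f'" for k
  proof -
    have "times_differentiable (Suc k) f" using assms unfolding smooth_def by blast
    then obtain f2 where f2: "\<And>x. (f has_real_derivative f2 x) (at x)" "times_differentiable k f2" by auto
    have "f2 = f'" using f2(1) f' DERIV_unique by blast
    then show ?thesis using f2 by simp
  qed
  then show ?thesis using that f' by (auto simp: smooth_def)
qed

lemma smoothI:
  assumes "\<And>x. (f has_real_derivative f' x) (at x)" "smooth f'"
  shows "smooth f"
  unfolding smooth_def
proof
  fix k show "times_differentiable k f"
    using assms by (cases k) (auto simp: smooth_def)
qed

lemma smooth_isCont: "smooth f \<Longrightarrow> isCont f x"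
  by (metis smooth_obtain_deriv DERIV_isCont)

lemma smooth_continuous_on: "smooth f \<Longrightarrow> continuous_on S f"
  by (simp add: continuous_at_imp_continuous_on smooth_isCont)

lemma times_differentiable_add:
  "times_differentiable k f \<Longrightarrow> times_differentiable k g \<Longrightarrow> times_differentiable k (\<lambda>x. f x + g x)"
proof (induction k arbitrary: f g)
  case (Suc k)
  then obtain f' g' where "\<And>x. (f has_real_derivative f' x) (at x)" "times_differentiable k f'"
    "\<And>x. (g has_real_derivative g' x) (at x)" "times_differentiable k g'" by auto
  then show ?case using Suc.IH[of f' g'] by (auto intro!: exI[of _ "\<lambda>x. f' x + g' x"] DERIV_add)
qed simp

lemma times_differentiable_mult:
  "times_differentiable k f \<Longrightarrow> times_differentiable k g \<Longrightarrow> times_differentiable k (\<lambda>x. f x * g x)"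
proof (induction k arbitrary: f g)
  case (Suc k)
  then obtain f' g' where d: "\<And>x. (f has_real_derivative f' x) (at x)" "times_differentiable k f'"
    "\<And>x. (g has_real_derivative g' x) (at x)" "times_differentiable k g'" by auto
  have "times_differentiable k (\<lambda>x. f' x * g x)" "times_differentiable k (\<lambda>x. g' x * f x)"
    using d Suc.IH Suc.prems by (blast intro: times_differentiable_mono)+
  then have "times_differentiable k (\<lambda>x. f' x * g x + g' x * f x)" by (rule times_differentiable_add)
  then show ?case using d by (auto intro!: exI[of _ "\<lambda>x. f' x * g x + g' x * f x"] DERIV_mult)
qed simp

lemma smooth_add: "smooth f \<Longrightarrow> smooth g \<Longrightarrow> smooth (\<lambda>x. f x + g x)"
  and smooth_mult: "smooth f \<Longrightarrow> smooth g \<Longrightarrow> smooth (\<lambda>x. f x * g x)"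
  by (simp_all add: smooth_def times_differentiable_add times_differentiable_mult)

lemma smooth_const: "smooth (\<lambda>_. c)"
proof -
  have "times_differentiable k (\<lambda>_. c)" for k and c :: real
    by (induction k arbitrary: c) (auto intro!: exI[of _ "\<lambda>_. 0"])
  then show ?thesis by (simp add: smooth_def)
qed

lemma smooth_affine:
  assumes "smooth f" shows "smooth (\<lambda>x. f (a * x + b))"
proof -
  have "times_differentiable k f \<Longrightarrow> times_differentiable k (\<lambda>x. c * f (a * x + b))" for k c and f :: "real \<Rightarrow> real"
  proof (induction k arbitrary: f c)
    case (Suc k)
    then obtain f' where d: "\<And>x. (f has_real_derivative f' x) (at x)" "times_differentiable k f'" by auto
    have "((\<lambda>x. c * f (a * x + b)) has_real_derivative (c * a) * f' (a * x + b)) (at x)" for x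
      by (rule derivative_eq_intros DERIV_chain'[OF _ d(1)] refl | simp)+
    then show ?case using Suc.IH[OF d(2), of "c * a"]
      by (auto intro!: exI[of _ "\<lambda>x. c * a * f' (a * x + b)"])
  qed auto
  from this[of _ f 1] show ?thesis using assms by (simp add: smooth_def)
qed

text \<open>The standard smooth function that vanishes to infinite order at the origin.\<close>

definition flat_exp :: "real \<Rightarrow> real" where
  "flat_exp x = (if 0 < x then exp (- 1 / x) else 0)"

lemma poly_times_exp_minus_tendsto_0:
  "((\<lambda>y. poly p y * exp (- y)) \<longlongrightarrow> (0::real)) at_top"
proof -
  have "((\<lambda>y. \<Sum>i\<le>degree p. coeff p i * (y ^ i / exp y)) \<longlongrightarrow> (\<Sum>i\<le>degree p. coeff p i * 0)) at_top"
    by (intro tendsto_intros tendsto_power_div_exp_0)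
  then show ?thesis
    by (simp add: poly_altdef sum_distrib_right exp_minus divide_inverse mult.assoc)
qed

text \<open>The functions \<open>exp (-1/x) p (1/x)\<close>, extended by zero, are closed under differentiation, because
\<open>(exp (-y) p y)' = exp (-y) (p' - p) y\<close> and \<open>y = 1/x\<close> has derivative \<open>- y\<^sup>2\<close>. At the origin the
difference quotient is \<open>exp (-y) y p y\<close>, which tends to zero.\<close>

lemma flat_exp_poly_DERIV:
  fixes p :: "real poly"
  defines "F \<equiv> \<lambda>q x. if 0 < x then exp (- 1 / x) * poly q (1 / x) else 0"
  shows "(F p has_real_derivative F (monom 1 2 * (p - pderiv p)) x) (at x)"
proof -
  consider "x > 0" | "x < 0" | "x = 0" by linarith
  then show ?thesis
  proof cases
    case 1
    have "((\<lambda>x. exp (- 1 / x) * poly p (1 / x)) has_real_derivative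
        exp (- 1 / x) * (1 / x\<^sup>2) * poly p (1 / x) + exp (- 1 / x) * (poly (pderiv p) (1 / x) * (- 1 / x\<^sup>2))) (at x)"
      using 1 by (auto intro!: derivative_eq_intros DERIV_chain'[OF _ poly_DERIV] simp: power2_eq_square field_simps)
    also have "exp (- 1 / x) * (1 / x\<^sup>2) * poly p (1 / x) + exp (- 1 / x) * (poly (pderiv p) (1 / x) * (- 1 / x\<^sup>2))
        = F (monom 1 2 * (p - pderiv p)) x"
      using 1 by (simp add: F_def poly_monom field_simps)
    finally show ?thesis
      by (rule has_field_derivative_transform_within_open[where S="{0<..}"]) (use 1 in \<open>auto simp: F_def\<close>)
  next
    case 2
    have "((\<lambda>x. 0) has_real_derivative 0) (at x)" by simp
    then have "(F p has_real_derivative 0) (at x)"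
      by (rule has_field_derivative_transform_within_open[where S="{..<0}"]) (use 2 in \<open>auto simp: F_def\<close>)
    then show ?thesis using 2 by (simp add: F_def)
  next
    case 3
    have "((\<lambda>h. F p h / h) \<longlongrightarrow> 0) (at_right 0)"
    proof -
      have "((\<lambda>y. poly (pCons 0 p) y * exp (- y)) \<longlongrightarrow> (0::real)) at_top"
        by (rule poly_times_exp_minus_tendsto_0)
      then have "((\<lambda>h. poly (pCons 0 p) (inverse h) * exp (- inverse h)) \<longlongrightarrow> (0::real)) (at_right 0)"
        using filterlim_inverse_at_top_right filterlim_compose by blast
      then show ?thesis
        by (rule Lim_transform_eventually)
          (auto simp: F_def eventually_at_filter field_simps intro!: always_eventually)
    qed
    moreover have "((\<lambda>h. F p h / h) \<longlongrightarrow> 0) (at_left 0)"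
      by (rule Lim_transform_eventually[OF tendsto_const])
        (auto simp: F_def eventually_at_filter)
    ultimately have "((\<lambda>h. F p h / h) \<longlongrightarrow> 0) (at 0)"
      using filterlim_split_at by blast
    then have "(F p has_real_derivative 0) (at 0)"
      unfolding DERIV_def by (simp add: F_def)
    then show ?thesis using 3 by (simp add: F_def)
  qed
qed

lemma smooth_flat_exp: "smooth flat_exp"
proof -
  have "times_differentiable k (\<lambda>x. if 0 < x then exp (- 1 / x) * poly p (1 / x) else 0)" for k p
    by (induction k arbitrary: p) (auto intro!: exI flat_exp_poly_DERIV)
  from this[of _ 1] show ?thesis by (simp add: smooth_def flat_exp_def[abs_def] cong: if_cong)
qed

text \<open>A positive bump on the interval between \<open>a\<close> and \<open>b\<close>. As \<open>n\<close> grows it increases to the indicator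
function, which avoids any normalisation or mollification.\<close>

definition bump :: "real \<Rightarrow> real \<Rightarrow> nat \<Rightarrow> real \<Rightarrow> real" where
  "bump a b n x = flat_exp (real (Suc n) * (x - a)) * flat_exp (real (Suc n) * (b - x))"

lemma smooth_bump: "smooth (bump a b n)"
proof -
  have "smooth (\<lambda>x. flat_exp (real (Suc n) * x + (- real (Suc n) * a)) * flat_exp ((- real (Suc n)) * x + real (Suc n) * b))"
    by (intro smooth_mult smooth_affine smooth_flat_exp)
  moreover have "(\<lambda>x. flat_exp (real (Suc n) * x + (- real (Suc n) * a)) * flat_exp ((- real (Suc n)) * x + real (Suc n) * b)) = bump a b n"
    by (auto simp: bump_def algebra_simps intro!: ext)
  ultimately show ?thesis by simp
qed

lemma bump_nonneg: "0 \<le> bump a b n x"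
  and bump_le_1: "bump a b n x \<le> 1"
  by (auto simp: bump_def flat_exp_def intro!: mult_le_one)

lemma bump_outside: "x \<notin> {a<..<b} \<Longrightarrow> bump a b n x = 0"
  by (auto simp: bump_def flat_exp_def zero_less_mult_iff)

lemma bump_pos: "x \<in> {a<..<b} \<Longrightarrow> 0 < bump a b n x"
  by (auto simp: bump_def flat_exp_def zero_less_mult_iff)

lemma bump_tendsto_indicator: "(\<lambda>n. bump a b n x) \<longlonglongrightarrow> indicator {a<..<b} x"
proof (cases "x \<in> {a<..<b}")
  case True
  have "(\<lambda>n. exp (- (1 / (x - a)) * inverse (real (Suc n))) * exp (- (1 / (b - x)) * inverse (real (Suc n))))
      \<longlonglongrightarrow> exp (- (1 / (x - a)) * 0) * exp (- (1 / (b - x)) * 0)"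
    by (intro tendsto_intros LIMSEQ_inverse_real_of_nat)
  moreover have "exp (- (1 / (x - a)) * inverse (real (Suc n))) * exp (- (1 / (b - x)) * inverse (real (Suc n))) = bump a b n x" for n
  proof -
    have "0 < real (Suc n) * (x - a)" "0 < real (Suc n) * (b - x)" using True by auto
    then show ?thesis using True by (simp only: bump_def flat_exp_def if_True) (simp add: divide_inverse mult.commute)
  qed
  ultimately show ?thesis using True by simp
qed (auto simp: bump_outside)

lemma prod_Basis: "(Basis :: (real \<times> real) set) = {e\<theta>, ez}"
  by (auto simp: Basis_prod_def)

lemma prod_has_derivative:
  assumes "\<And>x. (f has_real_derivative f' x) (at x)" "\<And>x. (g has_real_derivative g' x) (at x)"
  shows "((\<lambda>x. f (fst x) * g (snd x)) has_derivative
     (\<lambda>h. f' (fst x) * fst h * g (snd x) + f (fst x) * (g' (snd x) * snd h))) (at x)"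
proof -
  have "((\<lambda>x. f (fst x)) has_derivative (\<lambda>h. f' (fst x) * fst h)) (at x)"
    using has_derivative_compose[OF has_derivative_fst[OF has_derivative_ident[of "at x"]] assms(1)[unfolded has_field_derivative_def]]
    by simp
  moreover have "((\<lambda>x. g (snd x)) has_derivative (\<lambda>h. g' (snd x) * snd h)) (at x)"
    using has_derivative_compose[OF has_derivative_snd[OF has_derivative_ident[of "at x"]] assms(2)[unfolded has_field_derivative_def]]
    by simp
  ultimately show ?thesis
    by (auto intro!: derivative_eq_intros)
qed

lemma frechet_derivative_prod:
  assumes "\<And>x. (f has_real_derivative f' x) (at x)" "\<And>x. (g has_real_derivative g' x) (at x)"
  shows "frechet_derivative (\<lambda>x. f (fst x) * g (snd x)) (at x) e\<theta> = f' (fst x) * g (snd x)"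
    and "frechet_derivative (\<lambda>x. f (fst x) * g (snd x)) (at x) ez = f (fst x) * g' (snd x)"
  using frechet_derivative_at[OF prod_has_derivative[OF assms], symmetric] by auto

lemma Ck_prod:
  assumes "smooth f" "smooth g"
  shows "Ck k (\<lambda>x. f (fst x) * g (snd x))"
  using assms
proof (induction k arbitrary: f g)
  case 0
  then show ?case
    using continuous_on_compose2[OF smooth_continuous_on[OF 0(1), of UNIV] continuous_on_fst[OF continuous_on_id, of UNIV]]
      continuous_on_compose2[OF smooth_continuous_on[OF 0(2), of UNIV] continuous_on_snd[OF continuous_on_id, of UNIV]]
    by (auto intro: continuous_on_mult)
next
  case (Suc k)
  obtain f' where f': "\<And>x. (f has_real_derivative f' x) (at x)" "smooth f'"
    using Suc.prems smooth_obtain_deriv by blast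
  obtain g' where g': "\<And>x. (g has_real_derivative g' x) (at x)" "smooth g'"
    using Suc.prems smooth_obtain_deriv by blast
  show ?case
    using prod_has_derivative[OF f'(1) g'(1)] Suc.IH[OF f'(2) Suc.prems(2)] Suc.IH[OF Suc.prems(1) g'(2)]
    by (auto simp: prod_Basis frechet_derivative_prod[OF f'(1) g'(1)] differentiable_def)
qed

lemma test_function_prod:
  assumes "smooth f" "smooth g"
    and "\<And>x. x \<notin> {a..b} \<Longrightarrow> f x = 0" "\<And>x. x \<notin> {c..d} \<Longrightarrow> g x = 0"
    and "{a..b} \<times> {c..d} \<subseteq> U"
  shows "test_function U (\<lambda>x. f (fst x) * g (snd x))"
proof -
  have "{x. f (fst x) * g (snd x) \<noteq> 0} \<subseteq> {a..b} \<times> {c..d}"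
    using assms(3,4) by fastforce
  then have *: "closure {x. f (fst x) * g (snd x) \<noteq> 0} \<subseteq> {a..b} \<times> {c..d}"
    by (rule closure_minimal) (auto intro!: closed_Times)
  have "compact ({a..b} \<times> {c..d})" by (intro compact_Times compact_Icc)
  then have c: "compact (closure {x. f (fst x) * g (snd x) \<noteq> 0})"
    using bounded_subset[OF compact_imp_bounded *] by (simp add: compact_eq_bounded_closed)
  have "closure {x. f (fst x) * g (snd x) \<noteq> 0} \<subseteq> U"
    using * assms(5) by (rule subset_trans)
  moreover have "\<forall>k. Ck k (\<lambda>x. f (fst x) * g (snd x))"
    using Ck_prod[OF assms(1,2)] by (rule allI)
  ultimately show ?thesis
    unfolding test_function_def using c by (intro conjI)
qed

lemma antiderivative_exists:
  fixes f :: "real \<Rightarrow> real"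
  assumes "continuous_on UNIV f"
  obtains F where "\<And>y. (F has_real_derivative f y) (at y)"
proof -
  have "\<exists>F. \<forall>x :: real. (-\<infinity>) < ereal x \<longrightarrow> ereal x < \<infinity> \<longrightarrow> (F has_vector_derivative f x) (at x)"
    using einterval_antiderivative[of "-\<infinity>" "\<infinity>" f] assms by (auto simp: continuous_on_eq_continuous_at)
  then show ?thesis using that by (auto simp: has_real_derivative_iff_has_vector_derivative)
qed

text \<open>A compactly supported function of mean zero has a compactly supported antiderivative. Such
antiderivatives are what a weak derivative can be tested with.\<close>

lemma smooth_antiderivative:
  assumes "smooth g" "\<And>x. x \<notin> {a..b} \<Longrightarrow> g x = 0" "integral {a..b} g = 0" "a \<le> b"
  obtains G where "\<And>x. (G has_real_derivative g x) (at x)" "smooth G" "\<And>x. x \<notin> {a..b} \<Longrightarrow> G x = 0"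
proof -
  obtain F where F: "\<And>x. (F has_real_derivative g x) (at x)"
    using antiderivative_exists[OF smooth_continuous_on[OF assms(1)]] by blast
  define G where "G x = F x - F a" for x
  have G: "(G has_real_derivative g x) (at x)" for x
    unfolding G_def using F by (auto intro!: derivative_eq_intros)
  have "G x = 0" if "x \<notin> {a..b}" for x
  proof (cases "x < a")
    case True
    have "\<exists>z>x. z < a \<and> G a - G x = (a - x) * g z"
      using MVT2[OF True, of G g] G by blast
    then show ?thesis using assms(2) by (auto simp: G_def)
  next
    case False
    then have xb: "b < x" using that by auto
    then have "\<exists>z>b. z < x \<and> G x - G b = (x - b) * g z"
      using MVT2[OF xb, of G g] G by blast
    then have "G x = G b" using assms(2) by auto
    moreover have "(g has_integral (G b - G a)) {a..b}"
      using assms(4) G by (intro fundamental_theorem_of_calculus)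
        (auto simp: has_real_derivative_iff_has_vector_derivative[symmetric] intro: has_field_derivative_at_within)
    then have "G b - G a = 0" using assms(3) by (simp add: integral_unique)
    ultimately show ?thesis by (simp add: G_def)
  qed
  then show ?thesis using that G smoothI[OF G assms(1)] by blast
qed

section \<open>The fundamental lemma of the calculus of variations\<close>

lemma sets_borel_open_rectangles:
  "sets (borel :: (real \<times> real) measure) = sigma_sets UNIV {{a<..<b} \<times> {c<..<d} | a b c d. True}"
proof -
  have "range (\<lambda>(a, b). box a b :: (real \<times> real) set) = {{a<..<b} \<times> {c<..<d} | a b c d. True}"
  proof -
    have *: "box (a, c) (b, d) = {a<..<b} \<times> {c<..<d}" for a b c d :: real
      by (auto simp: box_def Basis_prod_def)
    show ?thesis
      by (auto simp: *[symmetric] image_iff simp del: box_real)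
  qed
  then show ?thesis
    by (simp add: borel_eq_box)
qed

text \<open>Rectangles form an intersection-stable generator of the Borel sets, so the integral over every Borel
set vanishes.\<close>

lemma AE_zero_if_rectangle_integrals_zero:
  fixes h :: "real \<times> real \<Rightarrow> real"
  assumes int: "integrable lborel h"
    and zero: "\<And>a b c d. (LINT x:{a<..<b} \<times> {c<..<d}|lborel. h x) = 0"
  shows "AE x in lborel. h x = 0"
proof (rule density_unique_real[OF int])
  have si: "set_integrable lborel A h" if "A \<in> sets borel" for A
    using integrable_mult_indicator[OF _ int, of A] that by (simp add: set_integrable_def)
  have UNIV: "(LINT x|lborel. h x) = 0"
  proof -
    let ?B = "\<lambda>n. {- real n<..<real n} \<times> {- real n<..<real n}"
    have "(\<lambda>n. LINT x|lborel. indicator (?B n) x *\<^sub>R h x) \<longlonglongrightarrow> (LINT x|lborel. h x)"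
    proof (rule integral_dominated_convergence[where w = "\<lambda>x. norm (h x)"])
      show "AE x in lborel. (\<lambda>n. indicator (?B n) x *\<^sub>R h x) \<longlonglongrightarrow> h x"
      proof (rule AE_I2)
        fix x :: "real \<times> real"
        obtain N where N: "max \<bar>fst x\<bar> \<bar>snd x\<bar> < real N" using reals_Archimedean2 by blast
        have "\<forall>\<^sub>F n in sequentially. h x = indicator (?B n) x *\<^sub>R h x"
          using eventually_ge_at_top[of N]
        proof eventually_elim
          case (elim n)
          then have "x \<in> ?B n" using N by (cases x) auto
          then show ?case by simp
        qed
        then show "(\<lambda>n. indicator (?B n) x *\<^sub>R h x) \<longlonglongrightarrow> h x"
          by (rule Lim_transform_eventually[OF tendsto_const])
      qed
      show "(\<lambda>x. indicator (?B n) x *\<^sub>R h x) \<in> borel_measurable lborel" for n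
        using si[of "?B n"] by (auto simp: set_integrable_def borel_open open_Times dest: borel_measurable_integrable)
    qed (use int in \<open>auto simp: indicator_def\<close>)
    moreover have "(LINT x|lborel. indicator (?B n) x *\<^sub>R h x) = 0" for n
      using zero[of "- real n" "real n" "- real n" "real n"] by (simp add: set_lebesgue_integral_def)
    ultimately show ?thesis by (simp add: LIMSEQ_const_iff)
  qed
  fix A :: "(real \<times> real) set" assume "A \<in> sets lborel"
  then have A: "A \<in> sigma_sets UNIV {{a<..<b} \<times> {c<..<d} | a b c d. True}"
    by (simp add: sets_borel_open_rectangles)
  have "(LINT x:A|lborel. h x) = 0"
  proof (rule sigma_sets_induct_disjoint[OF _ _ A, where P = "\<lambda>A. (LINT x:A|lborel. h x) = 0"])
    show "Int_stable {{a<..<b} \<times> {c<..<d} | (a::real) b c (d::real). True}"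
    proof (rule Int_stableI)
      fix A B :: "(real \<times> real) set"
      assume "A \<in> {{a<..<b} \<times> {c<..<d} | a b c d. True}" "B \<in> {{a<..<b} \<times> {c<..<d} | a b c d. True}"
      then obtain a b c d a' b' c' d' where "A = {a<..<b} \<times> {c<..<d}" "B = {a'<..<b'} \<times> {c'<..<d'}" by auto
      then have "A \<inter> B = {max a a'<..<min b b'} \<times> {max c c'<..<min d d'}" by auto
      then show "A \<inter> B \<in> {{a<..<b} \<times> {c<..<d} | a b c d. True}" by blast
    qed
  next
    fix A :: "(real \<times> real) set" assume A: "A \<in> sigma_sets UNIV {{a<..<b} \<times> {c<..<d} | a b c d. True}"
      and z: "(LINT x:A|lborel. h x) = 0"
    then have [measurable]: "A \<in> sets borel" by (simp add: sets_borel_open_rectangles)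
    have "(LINT x|lborel. h x) = (LINT x:A|lborel. h x) + (LINT x:(UNIV - A)|lborel. h x)"
      using set_integral_Un[of A "UNIV - A" lborel h] si by (simp add: set_lebesgue_integral_def)
    then show "(LINT x:(UNIV - A)|lborel. h x) = 0" using z UNIV by simp
  next
    fix A :: "nat \<Rightarrow> (real \<times> real) set"
    assume d: "disjoint_family A" and r: "range A \<subseteq> sigma_sets UNIV {{a<..<b} \<times> {c<..<d} | a b c d. True}"
      and z: "\<And>i. (LINT x:A i|lborel. h x) = 0"
    have m: "A i \<in> sets borel" for i using r by (auto simp: sets_borel_open_rectangles)
    have "(LINT x:(\<Union>i. A i)|lborel. h x) = (\<Sum>i. (LINT x:A i|lborel. h x))"
      by (rule lebesgue_integral_countable_add) (use m d si in \<open>auto simp: disjoint_family_on_def\<close>)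
    then show "(LINT x:(\<Union>i. A i)|lborel. h x) = 0" using z by simp
  qed (use zero in \<open>auto simp: set_lebesgue_integral_def\<close>)
  then show "(LINT x:A|lborel. h x) = (LINT x:A|lborel. 0)" by (simp add: set_lebesgue_integral_def)
qed simp

lemma continuous_bump_prod:
  "continuous_on S (\<lambda>x. bump a b n (fst x) * bump c d n (snd x))"
  by (auto intro!: continuous_on_mult continuous_on_compose2[OF smooth_continuous_on[OF smooth_bump, of UNIV]]
      continuous_on_fst continuous_on_snd continuous_on_id)

lemma borel_measurable_bump [measurable]: "bump a b n \<in> borel_measurable borel"
  by (intro borel_measurable_continuous_onI smooth_continuous_on smooth_bump)

text \<open>Products of bumps converge boundedly to the indicator of a rectangle, so all integrals over
sub-rectangles vanish.\<close>

lemma fundamental_lemma_rectangle: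
  fixes h :: "real \<times> real \<Rightarrow> real"
  assumes int: "integrable lborel h"
    and zero: "\<And>a b c d n. {a..b} \<times> {c..d} \<subseteq> {A..B} \<times> {C..D} \<Longrightarrow>
       (LINT x|lborel. h x * (bump a b n (fst x) * bump c d n (snd x))) = 0"
  shows "AE x in lborel. x \<in> {A<..<B} \<times> {C<..<D} \<longrightarrow> h x = 0"
proof -
  define h1 where "h1 x = indicator ({A<..<B} \<times> {C<..<D}) x * h x" for x
  have si': "set_integrable lborel ({a<..<b} \<times> {c<..<d}) h" for a b c d :: real
    using integrable_mult_indicator[OF _ int, of "{a<..<b} \<times> {c<..<d}"]
    by (simp add: set_integrable_def borel_open open_Times)
  have h1: "integrable lborel h1"
    using si'[of A B C D] unfolding h1_def set_integrable_def by simp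
  have "AE x in lborel. h1 x = 0"
  proof (rule AE_zero_if_rectangle_integrals_zero[OF h1])
    fix a b c d :: real
    define a' b' c' d' where "a' = max a A" and "b' = min b B" and "c' = max c C" and "d' = min d D"
    note defs = a'_def b'_def c'_def d'_def
    have "(\<lambda>n. LINT x|lborel. h x * (bump a' b' n (fst x) * bump c' d' n (snd x)))
      \<longlonglongrightarrow> (LINT x|lborel. indicator ({a'<..<b'} \<times> {c'<..<d'}) x * h x)"
    proof (rule integral_dominated_convergence[where w = "\<lambda>x. norm (h1 x)"])
      have *: "h x * (bump a' b' n (fst x) * bump c' d' n (snd x))
        = h1 x * (bump a' b' n (fst x) * bump c' d' n (snd x))" for n x
        using bump_outside[of "fst x" a' b' n] bump_outside[of "snd x" c' d' n]
        by (cases x) (auto simp: h1_def defs indicator_def)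
      show "(\<lambda>x. h x * (bump a' b' n (fst x) * bump c' d' n (snd x))) \<in> borel_measurable lborel" for n
        unfolding * using borel_measurable_integrable[OF h1]
          borel_measurable_continuous_onI[OF continuous_bump_prod[of UNIV a' b' n c' d']]
        by (intro borel_measurable_times[of h1]) auto
      show "AE x in lborel. norm (h x * (bump a' b' n (fst x) * bump c' d' n (snd x))) \<le> norm (h1 x)" for n
        unfolding * by (intro AE_I2) (auto simp: abs_mult bump_nonneg bump_le_1 intro!: mult_left_le mult_le_one)
      show "AE x in lborel. (\<lambda>n. h x * (bump a' b' n (fst x) * bump c' d' n (snd x)))
        \<longlonglongrightarrow> indicator ({a'<..<b'} \<times> {c'<..<d'}) x * h x"
      proof (intro AE_I2)
        fix x :: "real \<times> real"
        have "(\<lambda>n. h x * (bump a' b' n (fst x) * bump c' d' n (snd x))) \<longlonglongrightarrow>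
          h x * (indicator {a'<..<b'} (fst x) * indicator {c'<..<d'} (snd x))"
          by (intro tendsto_intros bump_tendsto_indicator)
        then show "(\<lambda>n. h x * (bump a' b' n (fst x) * bump c' d' n (snd x)))
          \<longlonglongrightarrow> indicator ({a'<..<b'} \<times> {c'<..<d'}) x * h x"
          by (cases x) (simp add: indicator_times mult.commute)
      qed
      show "(\<lambda>x. indicator ({a'<..<b'} \<times> {c'<..<d'}) x * h x) \<in> borel_measurable lborel"
        using si'[of a' b' c' d'] unfolding set_integrable_def by (auto dest: borel_measurable_integrable)
    qed (use h1 in auto)
    moreover have "{a'..b'} \<times> {c'..d'} \<subseteq> {A..B} \<times> {C..D}"
      by (auto simp: defs)
    ultimately have "(LINT x|lborel. indicator ({a'<..<b'} \<times> {c'<..<d'}) x * h x) = 0"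
      using zero by (simp add: LIMSEQ_const_iff)
    moreover have "indicator ({a'<..<b'} \<times> {c'<..<d'}) x * h x = indicator ({a<..<b} \<times> {c<..<d}) x *\<^sub>R h1 x" for x
      by (cases x) (auto simp: h1_def defs indicator_def)
    ultimately show "(LINT x:{a<..<b} \<times> {c<..<d}|lborel. h1 x) = 0"
      by (simp add: set_lebesgue_integral_def)
  qed
  then show ?thesis by eventually_elim (auto simp: h1_def)
qed

text \<open>Fubini arguments need a Borel function on the product space; weak derivatives are only
Lebesgue measurable.\<close>

lemma lborel_representative:
  assumes "f \<in> borel_measurable lebesgue"
  obtains f' where "f' \<in> borel_measurable borel" "AE x in lebesgue. f x = (f' x :: real)"
  using completion_ex_borel_measurable_real[OF assms] by (auto simp: AE_completion_iff)

lemma fundamental_lemma: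
  fixes h :: "real \<times> real \<Rightarrow> real"
  assumes "open U" and h: "locally_integrable U h"
    and zero: "\<And>a b c d n. {a..b} \<times> {c..d} \<subseteq> U \<Longrightarrow>
       (LINT x|lebesgue. h x * (bump a b n (fst x) * bump c d n (snd x))) = 0"
  shows "AE x in lebesgue. x \<in> U \<longrightarrow> h x = 0"
proof -
  have rect: "AE x in lborel. x \<in> {A<..<B} \<times> {C<..<D} \<longrightarrow> h x = 0"
    if sub: "{A..B} \<times> {C..D} \<subseteq> U" for A B C D
  proof -
    let ?K = "{A..B} \<times> {C..D}"
    have K: "compact ?K" by (intro compact_Times compact_Icc)
    then have int: "integrable lebesgue (\<lambda>x. indicator ?K x * h x)"
      using h sub by (simp add: locally_integrable_def set_integrable_def)
    obtain h' where h': "h' \<in> borel_measurable borel" "AE x in lebesgue. indicator ?K x * h x = h' x"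
      using lborel_representative[OF borel_measurable_integrable[OF int]] by blast
    have m': "h' \<in> borel_measurable lebesgue" using h'(1) by (auto intro: measurable_completion)
    have int': "integrable lborel h'"
      using integrable_cong_AE_imp[OF int m'] h' integrable_completion[of h' lborel]
      by auto
    have "AE x in lborel. x \<in> {A<..<B} \<times> {C<..<D} \<longrightarrow> h' x = 0"
    proof (rule fundamental_lemma_rectangle[OF int'])
      fix a b c d n assume s: "{a..b} \<times> {c..d} \<subseteq> ?K"
      let ?b = "\<lambda>x. bump a b n (fst x) * bump c d n (snd x)"
      have b: "?b \<in> borel_measurable borel"
        by (rule borel_measurable_continuous_onI[OF continuous_bump_prod])
      have b': "?b \<in> borel_measurable lebesgue" using b by (auto intro: measurable_completion)
      have "(LINT x|lborel. h' x * ?b x) = (LINT x|lebesgue. h' x * ?b x)"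
        using integral_completion[of "\<lambda>x. h' x * ?b x" lborel] borel_measurable_times[OF h'(1) b] by simp
      also have "\<dots> = (LINT x|lebesgue. indicator ?K x * h x * ?b x)"
        using h'(2) by (intro integral_cong_AE borel_measurable_times m' b' borel_measurable_integrable[OF int])
          (auto elim: eventually_mono)
      also have "(\<lambda>x. indicator ?K x * h x * ?b x) = (\<lambda>x. h x * ?b x)"
      proof
        fix x
        show "indicator ?K x * h x * ?b x = h x * ?b x"
        proof (cases "x \<in> {a<..<b} \<times> {c<..<d}")
          case True
          then have "x \<in> {a..b} \<times> {c..d}" by (cases x) auto
          then show ?thesis using s by auto
        next
          case False
          then have "?b x = 0"
            using bump_outside[of "fst x" a b n] bump_outside[of "snd x" c d n] by (cases x) auto
          then show ?thesis by (metis mult_zero_right)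
        qed
      qed
      also have "(LINT x|lebesgue. h x * ?b x) = 0" using zero s sub by auto
      finally show "(LINT x|lborel. h' x * ?b x) = 0" .
    qed
    moreover have "AE x in lborel. indicator ?K x * h x = h' x" using h'(2) by (simp add: AE_completion_iff)
    ultimately show ?thesis
      by eventually_elim (auto simp: less_imp_le indicator_def split: if_splits)
  qed
  obtain \<D> where D: "countable \<D>" "\<D> \<subseteq> Pow U" "\<And>X. X \<in> \<D> \<Longrightarrow> \<exists>a b. X = cbox a b" "\<Union>\<D> = U"
    using open_countable_Union_open_cbox[OF \<open>open U\<close>] by blast
  \<comment> \<open>Each closed box is treated up to its boundary, which is null.\<close>
  have "AE x in lborel. x \<in> X \<longrightarrow> h x = 0" if "X \<in> \<D>" for X
  proof -
    have "\<exists>p q. X = cbox p q" using D(3)[OF that] .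
    then obtain p q where X: "X = cbox p q" by blast
    have "cbox p q = {fst p..fst q} \<times> {snd p..snd q}"
      by (cases p; cases q) (auto simp: cbox_Pair_eq)
    then have sub: "{fst p..fst q} \<times> {snd p..snd q} \<subseteq> U" using that D(2) X by auto
    have bx: "box p q = {fst p<..<fst q} \<times> {snd p<..<snd q}"
      by (cases p; cases q) (auto simp: box_def Basis_prod_def)
    have "AE x in lborel. x \<notin> cbox p q - box p q"
    proof (rule AE_not_in)
      have "negligible (cbox p q - box p q)" by (rule negligible_frontier_interval)
      then have "cbox p q - box p q \<in> null_sets lebesgue" by (simp add: negligible_iff_null_sets)
      then show "cbox p q - box p q \<in> null_sets lborel" by (simp add: null_sets_def)
    qed
    with rect[OF sub] show ?thesis by eventually_elim (auto simp: X bx)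
  qed
  then have "AE x in lborel. \<forall>X\<in>\<D>. x \<in> X \<longrightarrow> h x = 0"
    unfolding AE_ball_countable[OF D(1)] by blast
  then show ?thesis using D(4) by (auto simp: AE_completion_iff elim!: eventually_mono)
qed

section \<open>Basic properties of weak derivatives\<close>

lemma test_function_support:
  assumes "test_function U \<psi>"
  obtains K where "compact K" "K \<subseteq> U" "\<And>x. x \<notin> K \<Longrightarrow> \<psi> x = 0"
    "\<And>x e. x \<notin> K \<Longrightarrow> frechet_derivative \<psi> (at x) e = 0"
proof
  let ?K = "closure {x. \<psi> x \<noteq> 0}"
  show "compact ?K" "?K \<subseteq> U" using assms by (auto simp: test_function_def)
  show z: "\<psi> x = 0" if "x \<notin> ?K" for x
  proof (rule ccontr)
    assume "\<psi> x \<noteq> 0"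
    then have "x \<in> {x. \<psi> x \<noteq> 0}" by simp
    then have "x \<in> ?K" by (rule closure_subset[THEN subsetD])
    with that show False by (rule notE)
  qed
  fix x e assume x: "x \<notin> ?K"
  have "((\<lambda>_. 0) has_derivative (\<lambda>_. 0)) (at x)" by simp
  then have "(\<psi> has_derivative (\<lambda>_. 0)) (at x)"
  proof (rule has_derivative_transform_within_open)
    show "open (- ?K)" by (intro open_Compl closed_closure)
    show "x \<in> - ?K" by (rule ComplI) (rule notE[OF x])
    show "0 = \<psi> y" if "y \<in> - ?K" for y
    proof -
      have "y \<notin> ?K" using that by (rule ComplD)
      then show ?thesis by (rule z[symmetric])
    qed
  qed
  then show "frechet_derivative \<psi> (at x) e = 0"
    by (simp add: frechet_derivative_at[symmetric])
qed

lemma test_function_continuous: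
  assumes "test_function U \<psi>"
  shows "continuous_on S \<psi>" "e \<in> Basis \<Longrightarrow> continuous_on S (\<lambda>x. frechet_derivative \<psi> (at x) e)"
    "\<psi> differentiable (at x)"
proof -
  have "Ck 0 \<psi>" "Ck (Suc 0) \<psi>" using assms by (auto simp only: test_function_def)
  then show "continuous_on S \<psi>" "e \<in> Basis \<Longrightarrow> continuous_on S (\<lambda>x. frechet_derivative \<psi> (at x) e)"
    "\<psi> differentiable (at x)"
    by (auto intro: continuous_on_subset)
qed

lemma set_integrable_mult_continuous:
  fixes f D :: "'a::euclidean_space \<Rightarrow> real"
  assumes "set_integrable lebesgue K f" "compact K" "continuous_on K D"
  shows "set_integrable lebesgue K (\<lambda>x. f x * D x)"
proof -
  have KS: "K \<in> sets lebesgue" using assms(2) by (simp add: borel_compact)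
  have "bounded (D ` K)" using assms by (intro compact_imp_bounded compact_continuous_image)
  then obtain B where B: "\<And>x. x \<in> K \<Longrightarrow> \<bar>D x\<bar> \<le> B" by (auto simp: bounded_iff)
  have mD: "(\<lambda>x. indicator K x * D x) \<in> borel_measurable lebesgue"
  proof -
    have "(\<lambda>x. if x \<in> K then D x else 0) \<in> borel_measurable borel"
      using assms(2,3) by (intro borel_measurable_continuous_on_if) (auto simp: borel_compact)
    then have "(\<lambda>x. if x \<in> K then D x else 0) \<in> borel_measurable lebesgue"
      by (auto intro: measurable_completion)
    moreover have "(\<lambda>x. if x \<in> K then D x else 0) = (\<lambda>x. indicator K x * D x)"
      by (auto simp: indicator_def)
    ultimately show ?thesis by simp
  qed
  have mf: "(\<lambda>x. indicator K x * f x) \<in> borel_measurable lebesgue"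
    using assms(1) by (auto simp: set_integrable_def dest: borel_measurable_integrable)
  have "integrable lebesgue (\<lambda>x. (indicator K x * f x) * (indicator K x * D x))"
  proof (rule Bochner_Integration.integrable_bound[where f = "\<lambda>x. B * (indicator K x * f x)"])
    show "integrable lebesgue (\<lambda>x. B * (indicator K x * f x))"
      using assms(1) by (simp add: set_integrable_def)
    show "AE x in lebesgue. norm (indicator K x * f x * (indicator K x * D x)) \<le> norm (B * (indicator K x * f x))"
    proof (rule AE_I2)
      fix x
      show "norm (indicator K x * f x * (indicator K x * D x)) \<le> norm (B * (indicator K x * f x))"
      proof (cases "x \<in> K")
        case True
        then have "\<bar>D x\<bar> \<le> \<bar>B\<bar>" using B[OF True] by linarith
        then have "\<bar>f x\<bar> * \<bar>D x\<bar> \<le> \<bar>f x\<bar> * \<bar>B\<bar>" by (rule mult_left_mono) simp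
        then show ?thesis using True by (simp add: abs_mult mult.commute)
      qed simp
    qed
  qed (intro borel_measurable_times mf mD)
  moreover have "(\<lambda>x. (indicator K x * f x) * (indicator K x * D x)) = (\<lambda>x. indicator K x *\<^sub>R (f x * D x))"
    by (auto simp: indicator_def)
  ultimately show ?thesis by (simp add: set_integrable_def)
qed

lemma set_integral_restrict:
  fixes f :: "'a \<Rightarrow> real"
  assumes "K \<subseteq> U" "\<And>x. x \<notin> K \<Longrightarrow> f x = 0"
  shows "set_lebesgue_integral M U f = set_lebesgue_integral M K f"
    and "set_integrable M U f = set_integrable M K f"
proof -
  have "(\<lambda>x. indicator U x *\<^sub>R f x) = (\<lambda>x. indicator K x *\<^sub>R f x)"
    using assms by (fastforce simp: indicator_def)
  then show "set_lebesgue_integral M U f = set_lebesgue_integral M K f"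
    and "set_integrable M U f = set_integrable M K f"
    by (simp_all add: set_lebesgue_integral_def set_integrable_def)
qed

lemma locally_integrable_mult_test:
  fixes f :: "'a::euclidean_space \<Rightarrow> real"
  assumes "locally_integrable U f" "test_function U \<psi>"
  shows "set_integrable lebesgue U (\<lambda>x. f x * \<psi> x)"
    and "e \<in> Basis \<Longrightarrow> set_integrable lebesgue U (\<lambda>x. f x * frechet_derivative \<psi> (at x) e)"
proof -
  obtain K where K: "compact K" "K \<subseteq> U" "\<And>x. x \<notin> K \<Longrightarrow> \<psi> x = 0"
    "\<And>x e. x \<notin> K \<Longrightarrow> frechet_derivative \<psi> (at x) e = 0"
    using test_function_support[OF assms(2)] by blast
  have f: "set_integrable lebesgue K f" using assms(1) K by (auto simp: locally_integrable_def)
  show "set_integrable lebesgue U (\<lambda>x. f x * \<psi> x)"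
    using set_integrable_mult_continuous[OF f K(1) test_function_continuous(1)[OF assms(2)]] K(2,3)
    by (subst set_integral_restrict(2)[of K]) auto
  show "set_integrable lebesgue U (\<lambda>x. f x * frechet_derivative \<psi> (at x) e)" if "e \<in> Basis"
    using set_integrable_mult_continuous[OF f K(1) test_function_continuous(2)[OF assms(2) that]] K(2,4)
    by (subst set_integral_restrict(2)[of K]) auto
qed

lemma locally_integrable_diff:
  "locally_integrable U f \<Longrightarrow> locally_integrable U g \<Longrightarrow> locally_integrable U (\<lambda>x. f x - g x)"
  by (auto simp: locally_integrable_def)

lemma test_function_bump:
  assumes "{a..b} \<times> {c..d} \<subseteq> U"
  shows "test_function U (\<lambda>x. bump a b n (fst x) * bump c d n (snd x))"
  by (rule test_function_prod[OF smooth_bump smooth_bump _ _ assms]) (auto simp: bump_outside)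

lemma weak_pderiv_unique:
  fixes U :: "(real \<times> real) set"
  assumes "open U" "has_weak_pderiv U e f g1" "has_weak_pderiv U e f g2"
  shows "AE x in lebesgue. x \<in> U \<longrightarrow> g1 x = g2 x"
proof -
  have li: "locally_integrable U g1" "locally_integrable U g2"
    using assms by (auto simp: has_weak_pderiv_def)
  have "AE x in lebesgue. x \<in> U \<longrightarrow> g1 x - g2 x = 0"
  proof (rule fundamental_lemma[OF assms(1) locally_integrable_diff[OF li]])
    fix a b c d n assume s: "{a..b} \<times> {c..d} \<subseteq> U"
    let ?\<psi> = "\<lambda>x. bump a b n (fst x) * bump c d n (snd x)"
    note t = test_function_bump[OF s, of n]
    have z: "?\<psi> x = 0" if "x \<notin> U" for x
    proof -
      have "\<not> (fst x \<in> {a<..<b} \<and> snd x \<in> {c<..<d})"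
        using that s by (cases x) (auto simp: subset_iff)
      then show ?thesis using bump_outside by (metis mult_zero_left mult_zero_right)
    qed
    have "set_lebesgue_integral lebesgue U (\<lambda>x. g1 x * ?\<psi> x) = set_lebesgue_integral lebesgue U (\<lambda>x. g2 x * ?\<psi> x)"
    proof -
      let ?I = "set_lebesgue_integral lebesgue U (\<lambda>x. f x * frechet_derivative ?\<psi> (at x) e)"
      have "?I = - set_lebesgue_integral lebesgue U (\<lambda>x. g1 x * ?\<psi> x)"
        using assms(2) t by (simp only: has_weak_pderiv_def)
      moreover have "?I = - set_lebesgue_integral lebesgue U (\<lambda>x. g2 x * ?\<psi> x)"
        using assms(3) t by (simp only: has_weak_pderiv_def)
      ultimately show ?thesis by linarith
    qed
    then have "set_lebesgue_integral lebesgue U (\<lambda>x. g1 x * ?\<psi> x - g2 x * ?\<psi> x) = 0"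
      by (subst set_integral_diff(2)[OF locally_integrable_mult_test(1)[OF li(1) t] locally_integrable_mult_test(1)[OF li(2) t]]) simp
    moreover have "(\<lambda>x. indicator U x *\<^sub>R (g1 x * ?\<psi> x - g2 x * ?\<psi> x)) = (\<lambda>x. (g1 x - g2 x) * ?\<psi> x)"
    proof
      fix x show "indicator U x *\<^sub>R (g1 x * ?\<psi> x - g2 x * ?\<psi> x) = (g1 x - g2 x) * ?\<psi> x"
        using z[of x] by (cases "x \<in> U") (auto simp: left_diff_distrib)
    qed
    ultimately show "(LINT x|lebesgue. (g1 x - g2 x) * ?\<psi> x) = 0"
      by (simp add: set_lebesgue_integral_def)
  qed
  then show ?thesis by simp
qed

lemma test_function_mono: "test_function U \<psi> \<Longrightarrow> U \<subseteq> V \<Longrightarrow> test_function V \<psi>"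
  by (auto simp: test_function_def)

lemma locally_integrable_cong:
  assumes "\<And>x. x \<in> U \<Longrightarrow> f x = g x" "locally_integrable U f"
  shows "locally_integrable U g"
  unfolding locally_integrable_def
proof (intro allI impI)
  fix K assume K: "compact K \<and> K \<subseteq> U"
  then have "set_integrable lebesgue K f" using assms by (auto simp: locally_integrable_def)
  moreover have "(\<lambda>x. indicator K x *\<^sub>R f x) = (\<lambda>x. indicator K x *\<^sub>R g x)"
    using K assms(1) by (fastforce simp: indicator_def)
  ultimately show "set_integrable lebesgue K g" by (simp add: set_integrable_def)
qed

lemma has_weak_pderiv_restrict:
  assumes "has_weak_pderiv V e f g" "U \<subseteq> V" "\<And>x. x \<in> U \<Longrightarrow> f x = f' x" "\<And>x. x \<in> U \<Longrightarrow> g x = g' x"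
  shows "has_weak_pderiv U e f' g'"
  unfolding has_weak_pderiv_def
proof (intro conjI allI impI)
  have "locally_integrable U f" "locally_integrable U g"
    using assms(1,2) unfolding has_weak_pderiv_def locally_integrable_def by (meson subset_trans)+
  then show "locally_integrable U f'" "locally_integrable U g'"
    using assms(3,4) locally_integrable_cong by metis+
  fix \<psi> assume t: "test_function U \<psi>"
  obtain K where K: "compact K" "K \<subseteq> U" "\<And>x. x \<notin> K \<Longrightarrow> \<psi> x = 0"
    "\<And>x e. x \<notin> K \<Longrightarrow> frechet_derivative \<psi> (at x) e = 0"
    using test_function_support[OF t] by blast
  have eq: "f x * frechet_derivative \<psi> (at x) e = f' x * frechet_derivative \<psi> (at x) e"
      "g x * \<psi> x = g' x * \<psi> x" for x
    using K(2) K(3)[of x] K(4)[of x e] assms(3)[of x] assms(4)[of x] by (cases "x \<in> K"; force)+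
  have "set_lebesgue_integral lebesgue V (\<lambda>x. f x * frechet_derivative \<psi> (at x) e) =
        - set_lebesgue_integral lebesgue V (\<lambda>x. g x * \<psi> x)"
    using assms(1) test_function_mono[OF t assms(2)] by (simp add: has_weak_pderiv_def)
  then have "set_lebesgue_integral lebesgue V (\<lambda>x. f' x * frechet_derivative \<psi> (at x) e) =
        - set_lebesgue_integral lebesgue V (\<lambda>x. g' x * \<psi> x)"
    unfolding eq .
  then show "set_lebesgue_integral lebesgue U (\<lambda>x. f' x * frechet_derivative \<psi> (at x) e) =
        - set_lebesgue_integral lebesgue U (\<lambda>x. g' x * \<psi> x)"
    using K(2,3,4) assms(2)
    by (subst (asm) (1 2) set_integral_restrict(1)[of U]) auto
qed

lemma has_weak_pderiv_cong_AE:
  fixes f :: "'a::euclidean_space \<Rightarrow> real"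
  assumes w: "has_weak_pderiv U e f g" and ae: "AE x in lebesgue. x \<in> U \<longrightarrow> f x = f' x"
    and li: "locally_integrable U f'" and e: "e \<in> Basis"
  shows "has_weak_pderiv U e f' g"
  unfolding has_weak_pderiv_def
proof (intro conjI allI impI)
  show "locally_integrable U f'" by (rule li)
  show "locally_integrable U g" using w by (simp add: has_weak_pderiv_def)
  have lf: "locally_integrable U f" using w by (simp add: has_weak_pderiv_def)
  fix \<psi> assume t: "test_function U \<psi>"
  have "set_lebesgue_integral lebesgue U (\<lambda>x. f x * frechet_derivative \<psi> (at x) e) =
        set_lebesgue_integral lebesgue U (\<lambda>x. f' x * frechet_derivative \<psi> (at x) e)"
    unfolding set_lebesgue_integral_def
    using locally_integrable_mult_test(2)[OF lf t e] locally_integrable_mult_test(2)[OF li t e] ae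
    by (intro integral_cong_AE)
      (auto simp: set_integrable_def dest: borel_measurable_integrable elim!: eventually_mono simp: indicator_def)
  then show "set_lebesgue_integral lebesgue U (\<lambda>x. f' x * frechet_derivative \<psi> (at x) e) =
        - set_lebesgue_integral lebesgue U (\<lambda>x. g x * \<psi> x)"
    using w t by (simp add: has_weak_pderiv_def)
qed

lemma has_weak_pderiv_diff:
  fixes f1 :: "'a::euclidean_space \<Rightarrow> real"
  assumes "has_weak_pderiv U e f1 g1" "has_weak_pderiv U e f2 g2" and e: "e \<in> Basis"
  shows "has_weak_pderiv U e (\<lambda>x. f1 x - f2 x) (\<lambda>x. g1 x - g2 x)"
proof -
  have li: "locally_integrable U f1" "locally_integrable U f2" "locally_integrable U g1" "locally_integrable U g2"
    using assms by (auto simp: has_weak_pderiv_def)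
  show ?thesis
    unfolding has_weak_pderiv_def
  proof (intro conjI allI impI)
    fix \<psi> assume t: "test_function U \<psi>"
    show "set_lebesgue_integral lebesgue U (\<lambda>x. (f1 x - f2 x) * frechet_derivative \<psi> (at x) e) =
        - set_lebesgue_integral lebesgue U (\<lambda>x. (g1 x - g2 x) * \<psi> x)"
      unfolding left_diff_distrib
      using assms t set_integral_diff(2)[OF locally_integrable_mult_test(2)[OF li(1) t e] locally_integrable_mult_test(2)[OF li(2) t e]]
        set_integral_diff(2)[OF locally_integrable_mult_test(1)[OF li(3) t] locally_integrable_mult_test(1)[OF li(4) t]]
      by (simp add: has_weak_pderiv_def)
  qed (use li locally_integrable_diff in auto)
qed

lemma integral_derivative_compact_support:
  fixes g :: "real \<Rightarrow> real"
  assumes "\<And>x. (g has_real_derivative g' x) (at x)" "continuous_on UNIV g'"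
    and "\<And>x. x \<notin> {- R..R} \<Longrightarrow> g x = 0" "\<And>x. x \<notin> {- R..R} \<Longrightarrow> g' x = 0"
  shows "(LINT x|lborel. g' x) = 0"
proof -
  define S where "S = \<bar>R\<bar> + 1"
  have "(LINT x|lborel. indicator {- S..S} x *\<^sub>R g' x) = g S - g (- S)"
    using assms(1,2) by (intro integral_FTC_Icc) (auto simp: S_def has_real_derivative_iff_has_vector_derivative[symmetric]
      intro: has_field_derivative_at_within continuous_on_subset)
  moreover have "(\<lambda>x. indicator {- S..S} x *\<^sub>R g' x) = g'"
  proof
    fix x show "indicator {- S..S} x *\<^sub>R g' x = g' x"
    proof (cases "x \<in> {- S..S}")
      case False
      then have "x \<notin> {- R..R}" by (auto simp: S_def)
      then show ?thesis using False assms(4) by simp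
    qed simp
  qed
  moreover have "S \<notin> {- R..R}" "- S \<notin> {- R..R}" by (auto simp: S_def)
  then have "g S = 0" "g (- S) = 0" using assms(3) by blast+
  ultimately show ?thesis by simp
qed

lemma continuous_imp_locally_integrable:
  "continuous_on UNIV f \<Longrightarrow> locally_integrable U (f :: 'a::euclidean_space \<Rightarrow> real)"
  unfolding locally_integrable_def
proof (intro allI impI)
  fix K assume f: "continuous_on UNIV f" and "compact K \<and> K \<subseteq> U"
  then have K: "compact K" by simp
  have "set_integrable lebesgue K (\<lambda>x. 1::real)"
    using lmeasurable_compact[OF K] by (simp add: set_integrable_def lmeasurable_iff_integrable)
  from set_integrable_mult_continuous[OF this K continuous_on_subset[OF f]]
  show "set_integrable lebesgue K f" by simp
qed

lemma integrable_continuous_compact_support: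
  fixes H :: "'a::euclidean_space \<Rightarrow> real"
  assumes "continuous_on UNIV H" "compact K" "\<And>x. x \<notin> K \<Longrightarrow> H x = 0"
  shows "integrable lborel H"
proof -
  have "set_integrable lebesgue K H"
    using continuous_imp_locally_integrable[OF assms(1), of UNIV] assms(2) by (simp add: locally_integrable_def)
  then have "integrable lebesgue H"
    using set_integral_restrict(2)[of K UNIV H lebesgue] assms(3) by (simp add: set_integrable_def)
  then show ?thesis
    using integrable_completion[of H lborel] borel_measurable_continuous_onI[OF assms(1)] by simp
qed

lemma has_real_derivative_slices:
  assumes "(\<psi> :: real \<times> real \<Rightarrow> real) differentiable (at (s, t))"
  shows "((\<lambda>s. \<psi> (s, t)) has_real_derivative frechet_derivative \<psi> (at (s, t)) e\<theta>) (at s)"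
    and "((\<lambda>t. \<psi> (s, t)) has_real_derivative frechet_derivative \<psi> (at (s, t)) ez) (at t)"
proof -
  let ?D = "frechet_derivative \<psi> (at (s, t))"
  have D: "(\<psi> has_derivative ?D) (at (s, t))"
    using assms frechet_derivative_works by blast
  have lin: "linear ?D" using D has_derivative_linear by blast
  have "((\<lambda>s. \<psi> (s, t)) has_derivative (\<lambda>h. ?D (h, 0))) (at s)"
    by (rule has_derivative_compose[of "\<lambda>s. (s, t)" "\<lambda>h. (h, 0)" s UNIV \<psi> ?D])
      (use D in \<open>auto intro!: derivative_eq_intros\<close>)
  moreover have "(\<lambda>h. ?D (h, 0)) = (*) (?D e\<theta>)"
  proof
    fix h show "?D (h, 0) = ?D e\<theta> * h"
      using linear_cmul[OF lin, of h e\<theta>] by (simp add: mult.commute)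
  qed
  ultimately show "((\<lambda>s. \<psi> (s, t)) has_real_derivative ?D e\<theta>) (at s)"
    by (simp only: has_field_derivative_def)
  have "((\<lambda>t. \<psi> (s, t)) has_derivative (\<lambda>h. ?D (0, h))) (at t)"
    by (rule has_derivative_compose[of "\<lambda>t. (s, t)" "\<lambda>h. (0, h)" t UNIV \<psi> ?D])
      (use D in \<open>auto intro!: derivative_eq_intros\<close>)
  moreover have "(\<lambda>h. ?D (0, h)) = (*) (?D ez)"
  proof
    fix h show "?D (0, h) = ?D ez * h"
      using linear_cmul[OF lin, of h ez] by (simp add: mult.commute)
  qed
  ultimately show "((\<lambda>t. \<psi> (s, t)) has_real_derivative ?D ez) (at t)"
    by (simp only: has_field_derivative_def)
qed

text \<open>For a continuously differentiable function of \<open>z\<close> alone, the weak derivatives are the classical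
ones: by Fubini, integration by parts takes place on lines, where the product with the test
function is compactly supported.\<close>

lemma has_weak_pderiv_axial:
  fixes f f' :: "real \<Rightarrow> real"
  assumes f: "\<And>z. (f has_real_derivative f' z) (at z)" and f': "continuous_on UNIV f'"
  shows "has_weak_pderiv U ez (\<lambda>x. f (snd x)) (\<lambda>x. f' (snd x))"
    and "has_weak_pderiv U e\<theta> (\<lambda>x. f (snd x)) (\<lambda>x. 0)"
proof -
  have fc: "continuous_on UNIV f" using f by (meson DERIV_isCont continuous_at_imp_continuous_on)
  have c1: "continuous_on UNIV (\<lambda>x::real \<times> real. f (snd x))" and c2: "continuous_on UNIV (\<lambda>x::real \<times> real. f' (snd x))"
    by (auto intro!: continuous_on_compose2[OF fc] continuous_on_compose2[OF f'] continuous_on_snd continuous_on_id)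
  note li = continuous_imp_locally_integrable[OF c1, of U] continuous_imp_locally_integrable[OF c2, of U]
  have b: "e\<theta> \<in> Basis" "ez \<in> Basis" by (auto simp: prod_Basis)
  have key: "set_lebesgue_integral lebesgue U (\<lambda>x. f (snd x) * frechet_derivative \<psi> (at x) ez) =
        - set_lebesgue_integral lebesgue U (\<lambda>x. f' (snd x) * \<psi> x)"
      "set_lebesgue_integral lebesgue U (\<lambda>x. f (snd x) * frechet_derivative \<psi> (at x) e\<theta>) = 0"
    if t: "test_function U \<psi>" for \<psi>
  proof -
    obtain K where K: "compact K" "K \<subseteq> U" "\<And>x. x \<notin> K \<Longrightarrow> \<psi> x = 0"
      "\<And>x e. x \<notin> K \<Longrightarrow> frechet_derivative \<psi> (at x) e = 0"
      using test_function_support[OF t] by blast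
    obtain R where R: "\<And>x. x \<in> K \<Longrightarrow> norm x \<le> R"
      using compact_imp_bounded[OF K(1)] by (auto simp: bounded_iff)
    have out: "(s, z) \<notin> K" if "s \<notin> {- R..R} \<or> z \<notin> {- R..R}" for s z
      using R[of "(s, z)"] that norm_fst_le[of s z] norm_snd_le[of z s] by fastforce
    define H where "H x = f (snd x) * frechet_derivative \<psi> (at x) ez + f' (snd x) * \<psi> x" for x
    define G where "G x = f (snd x) * frechet_derivative \<psi> (at x) e\<theta>" for x
    have cH: "continuous_on UNIV H" and cG: "continuous_on UNIV G"
      unfolding H_def G_def
      by (intro continuous_on_add continuous_on_mult c1 c2 test_function_continuous[OF t] b)+
    have iH: "integrable lborel H" and iG: "integrable lborel G"
      by (rule integrable_continuous_compact_support[OF _ K(1)]; use cH cG K(3,4) in \<open>simp add: H_def G_def\<close>)+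
    have inner: "(LINT z|lborel. H (s, z)) = 0" for s
    proof (rule integral_derivative_compact_support[where g = "\<lambda>z. f z * \<psi> (s, z)" and R = R])
      show "((\<lambda>z. f z * \<psi> (s, z)) has_real_derivative H (s, z)) (at z)" for z
        unfolding H_def
        by (rule derivative_eq_intros f has_real_derivative_slices(2)[OF test_function_continuous(3)[OF t]] refl | simp)+
      show "continuous_on UNIV (\<lambda>z. H (s, z))"
        by (rule continuous_on_compose2[OF cH]) (auto intro!: continuous_intros)
    qed (use out K(3,4) in \<open>auto simp: H_def\<close>)
    have inner2: "(LINT s|lborel. G (s, z)) = 0" for z
    proof (rule integral_derivative_compact_support[where g = "\<lambda>s. f z * \<psi> (s, z)" and R = R])
      show "((\<lambda>s. f z * \<psi> (s, z)) has_real_derivative G (s, z)) (at s)" for s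
        unfolding G_def
        by (rule derivative_eq_intros has_real_derivative_slices(1)[OF test_function_continuous(3)[OF t]] refl | simp)+
      show "continuous_on UNIV (\<lambda>s. G (s, z))"
        by (rule continuous_on_compose2[OF cG]) (auto intro!: continuous_intros)
    qed (use out K(3,4) in \<open>auto simp: G_def\<close>)
    have "(LINT x|lborel. H x) = (LINT s|lborel. LINT z|lborel. H (s, z))"
      using lborel_pair.integral_fst'[of H] iH by (simp add: lborel_prod)
    then have H0: "(LINT x|lborel. H x) = 0" by (simp add: inner)
    have "(LINT x|lborel. G x) = (LINT z|lborel. LINT s|lborel. G (s, z))"
      using lborel_pair.integral_snd[of "\<lambda>s z. G (s, z)"] iG by (simp add: lborel_prod)
    then have G0: "(LINT x|lborel. G x) = 0" by (simp add: inner2)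
    have to_U: "set_lebesgue_integral lebesgue U F = (LINT x|lborel. F x)"
      if "continuous_on UNIV F" "\<And>x. x \<notin> K \<Longrightarrow> F x = 0" for F :: "real \<times> real \<Rightarrow> real"
    proof -
      have "set_lebesgue_integral lebesgue U F = set_lebesgue_integral lebesgue UNIV F"
        using set_integral_restrict(1)[of K U F] set_integral_restrict(1)[of K UNIV F] K(2) that(2) by simp
      then show ?thesis
        using integral_completion[of F lborel] borel_measurable_continuous_onI[OF that(1)]
        by (simp add: set_lebesgue_integral_def)
    qed
    show "set_lebesgue_integral lebesgue U (\<lambda>x. f (snd x) * frechet_derivative \<psi> (at x) e\<theta>) = 0"
      using to_U[OF cG] G0 K(4) by (simp add: G_def[abs_def])
    have "set_lebesgue_integral lebesgue U H = 0" using to_U[OF cH] H0 K(3,4) by (simp add: H_def[abs_def])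
    then show "set_lebesgue_integral lebesgue U (\<lambda>x. f (snd x) * frechet_derivative \<psi> (at x) ez) =
        - set_lebesgue_integral lebesgue U (\<lambda>x. f' (snd x) * \<psi> x)"
      using set_integral_add(2)[OF locally_integrable_mult_test(2)[OF li(1) t b(2)] locally_integrable_mult_test(1)[OF li(2) t]]
      by (simp add: H_def[abs_def])
  qed
  show "has_weak_pderiv U ez (\<lambda>x. f (snd x)) (\<lambda>x. f' (snd x))"
    using li key(1) by (simp add: has_weak_pderiv_def)
  show "has_weak_pderiv U e\<theta> (\<lambda>x. f (snd x)) (\<lambda>x. 0)"
    using li key(2) continuous_imp_locally_integrable[of "\<lambda>_. 0" U]
    by (simp add: has_weak_pderiv_def set_lebesgue_integral_def)
qed

lemma interior_Omega: "interior Omega = {0<..<2*pi} \<times> {-1/2<..<1/2}"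
  by (simp add: Omega_def interior_Times)

lemma AE_Omega_interior: "AE x in lebesgue. x \<in> Omega \<longrightarrow> x \<in> interior Omega"
proof -
  have "Omega = cbox (0, -1/2) (2*pi, 1/2)" by (simp add: Omega_def cbox_Pair_eq)
  then have "negligible (Omega - interior Omega)"
    by (metis negligible_frontier_interval interior_cbox)
  then have "AE x in lebesgue. x \<notin> Omega - interior Omega"
    by (intro AE_not_in) (simp add: negligible_iff_null_sets)
  then show ?thesis by eventually_elim auto
qed

lemma sets_Omega [simp]: "Omega \<in> sets borel" "Omega \<in> sets lebesgue"
  by (auto simp: Omega_def borel_closed closed_Times)

text \<open>Whichever weak derivative the choice operator picks, it agrees almost everywhere with a known one.\<close>

lemma pd_AE_eq:
  assumes "has_weak_pderiv (interior Omega) e f g"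
  shows "AE x in lebesgue. x \<in> Omega \<longrightarrow> pd e f x = g x"
    and "has_weak_pderiv (interior Omega) e f (pd e f)"
proof -
  show *: "has_weak_pderiv (interior Omega) e f (pd e f)"
    unfolding weak_pderiv_def by (rule someI[of "has_weak_pderiv (interior Omega) e f", OF assms])
  from weak_pderiv_unique[OF open_interior * assms] AE_Omega_interior
  show "AE x in lebesgue. x \<in> Omega \<longrightarrow> pd e f x = g x"
    by eventually_elim auto
qed

section \<open>Weak derivatives on almost every line\<close>

lemma borel_measurable_fst_snd [measurable]:
  "fst \<in> (borel :: (real \<times> real) measure) \<rightarrow>\<^sub>M borel" "snd \<in> (borel :: (real \<times> real) measure) \<rightarrow>\<^sub>M borel"
  by (intro borel_measurable_continuous_onI continuous_intros)+

lemma indicator_times_outside: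
  assumes "\<And>x. x \<notin> A \<Longrightarrow> f x = (0 :: real)"
  shows "(\<lambda>x. indicator A x * f x) = f"
proof
  fix x show "indicator A x * f x = f x" using assms[of x] by (cases "x \<in> A") auto
qed

lemma integrable_mult_bounded:
  fixes f \<phi> :: "'a \<Rightarrow> real"
  assumes f: "integrable M f" and \<phi>: "\<phi> \<in> borel_measurable M" and B: "\<And>x. \<bar>\<phi> x\<bar> \<le> B"
  shows "integrable M (\<lambda>x. f x * \<phi> x)"
proof (rule Bochner_Integration.integrable_bound[where f = "\<lambda>x. B * f x"])
  show "AE x in M. norm (f x * \<phi> x) \<le> norm (B * f x)"
  proof (rule AE_I2)
    fix x
    have "\<bar>\<phi> x\<bar> * \<bar>f x\<bar> \<le> \<bar>B\<bar> * \<bar>f x\<bar>"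
      using B[of x] by (intro mult_right_mono) linarith+
    then show "norm (f x * \<phi> x) \<le> norm (B * f x)" by (simp add: abs_mult mult.commute)
  qed
qed (use f \<phi> in auto)

lemma AE_fst:
  assumes "AE x in (lborel :: real measure). Q x"
  shows "AE p in (lborel :: (real \<times> real) measure). Q (fst p)"
proof -
  obtain N where N: "\<And>x. x \<in> space lborel - N \<Longrightarrow> Q x" "N \<in> null_sets lborel"
    using AE_E3[OF assms] by blast
  have "AE p in lborel \<Otimes>\<^sub>M (lborel :: real measure). fst p \<notin> N"
  proof (rule lborel_pair.AE_pair_measure)
    have "{p :: real \<times> real. fst p \<notin> N} = fst -` (- N) \<inter> space borel" by auto
    also have "\<dots> \<in> sets borel"
      using N(2) by (intro measurable_sets[OF borel_measurable_fst_snd(1)]) auto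
    finally show "{p \<in> space (lborel \<Otimes>\<^sub>M (lborel :: real measure)). fst p \<notin> N} \<in> sets (lborel \<Otimes>\<^sub>M lborel)"
      unfolding lborel_prod by simp
    show "AE x in lborel. AE y in (lborel :: real measure). fst (x, y) \<notin> N"
      using AE_not_in[OF N(2)] by eventually_elim simp
  qed
  then have "AE p in (lborel :: (real \<times> real) measure). fst p \<notin> N" unfolding lborel_prod .
  then show ?thesis by eventually_elim (use N(1) in auto)
qed

lemma integrable_tensor:
  fixes u v :: "real \<Rightarrow> real"
  assumes [simp]: "integrable lborel u" "integrable lborel v"
  shows "integrable lborel (\<lambda>x. u (fst x) * v (snd x))"
proof -
  have [measurable]: "u \<in> borel_measurable borel" "v \<in> borel_measurable borel"
    using assms[THEN borel_measurable_integrable] by simp_all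
  have "integrable (lborel \<Otimes>\<^sub>M lborel) (\<lambda>x. u (fst x) * v (snd x))"
  proof (rule lborel_pair.Fubini_integrable)
    show "integrable lborel (\<lambda>x. LINT y|lborel. norm (u (fst (x, y)) * v (snd (x, y))))"
      by (simp add: abs_mult)
  qed (auto simp: AE_I2)
  then show ?thesis by (simp add: lborel_prod)
qed

lemma integral_tensor:
  fixes u v :: "real \<Rightarrow> real"
  assumes "integrable lborel u" "integrable lborel v"
  shows "(LINT x|lborel. u (fst x) * v (snd x)) = (LINT x|lborel. u x) * (LINT x|lborel. v x)"
  using lborel_pair.integral_fst'[of "\<lambda>x. u (fst x) * v (snd x)"] integrable_tensor[OF assms]
  by (simp add: lborel_prod)

lemma integrable_indicator_continuous:
  fixes G :: "real \<Rightarrow> real"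
  assumes "continuous_on {a..b} G"
  shows "integrable lborel (\<lambda>y. indicator {a..b} y * G y)"
  using borel_integrable_atLeastAtMost'[OF assms] by (simp add: set_integrable_def)

text \<open>Integration by parts against the primitive of a merely integrable function. The primitive need not be
differentiable, so the proof exchanges the order of integration over the triangle
\<open>a \<le> s \<le> y \<le> b\<close>.\<close>

lemma primitive_by_parts:
  fixes \<gamma> G G' :: "real \<Rightarrow> real"
  assumes \<gamma>: "integrable lborel \<gamma>"
    and G: "\<And>x. x \<in> {a..b} \<Longrightarrow> (G has_real_derivative G' x) (at x within {a..b})" "continuous_on {a..b} G'"
  shows "(LINT y|lborel. indicator {a..b} y * (LINT s|lborel. indicator {a..y} s * \<gamma> s) * G' y)
       = (LINT s|lborel. indicator {a..b} s * \<gamma> s * (G b - G s))"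
proof -
  let ?w = "\<lambda>y. indicator {a..b} y * G' y"
  have w: "integrable lborel ?w" by (rule integrable_indicator_continuous[OF G(2)])
  have [measurable]: "\<gamma> \<in> borel_measurable borel" using \<gamma> by (auto dest: borel_measurable_integrable)
  define F where "F s y = (\<gamma> s * ?w y) * indicator {x. a \<le> fst x \<and> fst x \<le> snd x} (s, y)" for s y
  have "integrable lborel (\<lambda>x. (\<gamma> (fst x) * ?w (snd x)) * indicator {x. a \<le> fst x \<and> fst x \<le> snd x} x)"
  proof (rule integrable_mult_bounded[OF integrable_tensor[OF \<gamma> w], of _ 1])
    have "{x :: real \<times> real. a \<le> fst x \<and> fst x \<le> snd x} \<in> sets borel"
      by (intro borel_closed closed_Collect_conj closed_Collect_le continuous_intros)
    then show "indicator {x :: real \<times> real. a \<le> fst x \<and> fst x \<le> snd x} \<in> borel_measurable lborel"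
      by (simp add: borel_measurable_indicator)
  qed (auto simp: indicator_def)
  then have F: "integrable (lborel \<Otimes>\<^sub>M lborel) (case_prod F)"
    by (simp add: lborel_prod F_def case_prod_beta')
  have "(LINT y|lborel. LINT s|lborel. F s y) = (LINT s|lborel. LINT y|lborel. F s y)"
    by (rule lborel_pair.Fubini_integral[OF F])
  also have "(\<lambda>s. LINT y|lborel. F s y) = (\<lambda>s. indicator {a..b} s * \<gamma> s * (G b - G s))"
  proof
    fix s
    show "(LINT y|lborel. F s y) = indicator {a..b} s * \<gamma> s * (G b - G s)"
    proof (cases "s \<in> {a..b}")
      case True
      have "(\<lambda>y. F s y) = (\<lambda>y. \<gamma> s * (indicator {s..b} y *\<^sub>R G' y))"
        using True by (auto simp: F_def indicator_def fun_eq_iff)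
      moreover have "(LINT y|lborel. indicator {s..b} y *\<^sub>R G' y) = G b - G s"
      proof (rule integral_FTC_Icc)
        show "(G has_vector_derivative G' y) (at y within {s..b})" if "s \<le> y" "y \<le> b" for y
          using has_field_derivative_subset[OF G(1)[of y], of "{s..b}"] True that
          by (auto simp: has_real_derivative_iff_has_vector_derivative)
      qed (use True G(2) in \<open>auto intro: continuous_on_subset\<close>)
      ultimately show ?thesis using True by simp
    next
      case False
      then have "(\<lambda>y. F s y) = (\<lambda>y. 0)"
        by (auto simp: F_def indicator_def fun_eq_iff)
      then show ?thesis using False by simp
    qed
  qed
  also have "(\<lambda>y. LINT s|lborel. F s y) = (\<lambda>y. indicator {a..b} y * (LINT s|lborel. indicator {a..y} s * \<gamma> s) * G' y)"
  proof
    fix y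
    have "(\<lambda>s. F s y) = (\<lambda>s. (indicator {a..y} s * \<gamma> s) * ?w y)"
      by (auto simp: F_def indicator_def fun_eq_iff)
    then show "(LINT s|lborel. F s y) = indicator {a..b} y * (LINT s|lborel. indicator {a..y} s * \<gamma> s) * G' y"
      by simp
  qed
  finally show ?thesis .
qed

lemma bounded_continuous_compact_support:
  fixes G :: "real \<Rightarrow> real"
  assumes "continuous_on UNIV G" "\<And>x. x \<notin> {a..b} \<Longrightarrow> G x = 0"
  obtains B where "\<And>x. \<bar>G x\<bar> \<le> B"
proof -
  have "bounded (G ` {a..b})"
    using continuous_on_subset[OF assms(1), of "{a..b}"] by (intro compact_imp_bounded compact_continuous_image) auto
  then obtain B where B: "\<forall>x\<in>{a..b}. \<bar>G x\<bar> \<le> B" by (auto simp: bounded_iff)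
  have "\<bar>G x\<bar> \<le> max B 0" for x
    using B assms(2)[of x] by (cases "x \<in> {a..b}") (auto simp: le_max_iff_disj)
  then show ?thesis using that by blast
qed

text \<open>Let \<open>P\<close> be the primitive of \<open>g\<close> in the second variable. The difference \<open>f - P\<close> is orthogonal to every
\<open>\<eta> \<otimes> G'\<close>. Any bump differs from a multiple of one fixed bump \<open>b0\<close> by such a \<open>G'\<close>, hence integrating
\<open>f - P\<close> against a bump in \<open>y\<close> only sees its average \<open>c x\<close> against \<open>b0\<close>. By the fundamental lemma
\<open>f - P\<close> equals \<open>c x\<close>, that is, it does not depend on the second variable.\<close>

lemma absolutely_continuous_slices:
  fixes f g :: "real \<times> real \<Rightarrow> real"
  assumes f: "integrable lborel f" and g: "integrable lborel g" and M: "0 < M"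
    and weak: "\<And>\<eta> G G'. smooth \<eta> \<Longrightarrow> smooth G \<Longrightarrow> smooth G' \<Longrightarrow>
        (\<And>x. (G has_real_derivative G' x) (at x)) \<Longrightarrow>
        (\<And>x. x \<notin> {- N..N} \<Longrightarrow> \<eta> x = 0) \<Longrightarrow> (\<And>x. x \<notin> {- M..M} \<Longrightarrow> G x = 0) \<Longrightarrow>
        (LINT x|lborel. f x * (\<eta> (fst x) * G' (snd x))) = - (LINT x|lborel. g x * (\<eta> (fst x) * G (snd x)))"
  shows "AE x in lborel. x \<in> {- N<..<N} \<longrightarrow> (\<exists>c. AE y in lborel. y \<in> {- M<..<M} \<longrightarrow>
           f (x, y) = c + (LINT s|lborel. indicator {- M..y} s * g (x, s)))"
proof -
  let ?I = "indicator {- M..M} :: real \<Rightarrow> real"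
  have [measurable]: "f \<in> borel_measurable borel" "g \<in> borel_measurable borel"
    using f g by (auto dest: borel_measurable_integrable)
  define P where "P x y = (LINT s|lborel. indicator {- M..y} s * g (x, s))" for x y
  have P[measurable]: "(\<lambda>p. P (fst p) (snd p)) \<in> borel_measurable borel"
  proof -
    let ?S = "{x :: (real \<times> real) \<times> real. - M \<le> snd x \<and> snd x \<le> snd (fst x)}"
    have S: "?S \<in> sets borel"
      by (intro borel_closed closed_Collect_conj closed_Collect_le continuous_intros)
    have "(\<lambda>x::(real \<times> real) \<times> real. (fst (fst x), snd x)) \<in> borel \<rightarrow>\<^sub>M borel"
      by (intro borel_measurable_continuous_onI continuous_intros)
    then have "(\<lambda>x::(real \<times> real) \<times> real. g (fst (fst x), snd x)) \<in> borel_measurable borel"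
      by (rule measurable_compose) simp
    with S have "(\<lambda>x. indicator ?S x * g (fst (fst x), snd x)) \<in> borel_measurable borel"
      by (intro borel_measurable_times borel_measurable_indicator)
    moreover have "sets ((borel :: (real \<times> real) measure) \<Otimes>\<^sub>M (lborel :: real measure)) = sets borel"
      unfolding borel_prod[symmetric] by (intro sets_pair_measure_cong) simp_all
    ultimately have "(\<lambda>(p, s). indicator ?S (p, s) * g (fst p, s)) \<in> borel_measurable (borel \<Otimes>\<^sub>M lborel)"
      by (subst measurable_cong_sets[OF _ refl]) (simp_all add: case_prod_beta')
    then have "(\<lambda>p. LINT s|lborel. indicator ?S (p, s) * g (fst p, s)) \<in> borel_measurable borel"
      by (rule lborel.borel_measurable_lebesgue_integral)
    then show ?thesis
      by (simp add: P_def indicator_def)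
  qed
  define Q where "Q x = (LINT s|lborel. \<bar>g (x, s)\<bar>)" for x
  have gs: "AE x in lborel. integrable lborel (\<lambda>s. g (x, s))"
    using lborel_pair.AE_integrable_fst'[of g] g by (simp add: lborel_prod)
  have Q: "integrable lborel Q"
    unfolding Q_def[abs_def] using lborel_pair.integrable_fst'[of "\<lambda>x. \<bar>g x\<bar>"] g by (simp add: lborel_prod)
  have PQ: "\<bar>P x y\<bar> \<le> Q x" if "integrable lborel (\<lambda>s. g (x, s))" for x y
  proof -
    have "\<bar>P x y\<bar> \<le> (LINT s|lborel. \<bar>indicator {- M..y} s * g (x, s)\<bar>)"
      unfolding P_def by (rule integral_abs_bound)
    also have "\<dots> \<le> Q x"
      unfolding Q_def
    proof (rule integral_mono)
      show "integrable lborel (\<lambda>s. \<bar>indicator {- M..y} s * g (x, s)\<bar>)"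
        using integrable_mult_indicator[OF _ that, of "{- M..y}"] by (intro integrable_abs) simp
    qed (use that in \<open>auto simp: indicator_def\<close>)
    finally show ?thesis .
  qed
  define R where "R p = ?I (snd p) * (f p - P (fst p) (snd p))" for p
  have mI[measurable]: "(\<lambda>p :: real \<times> real. ?I (snd p)) \<in> borel_measurable borel"
    by (rule measurable_compose[OF borel_measurable_fst_snd(2)]) simp
  have [measurable]: "R \<in> borel_measurable borel"
    unfolding R_def by (intro borel_measurable_times borel_measurable_diff mI P) simp
  have iI: "integrable lborel ?I" by (rule integrable_real_indicator) (simp_all add: emeasure_lborel_Icc_eq)
  \<comment> \<open>\<open>P\<close> is dominated by the slice norm of \<open>g\<close>, which is integrable in \<open>x\<close>.\<close>
  have IP: "integrable lborel (\<lambda>p. ?I (snd p) * P (fst p) (snd p))"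
  proof (rule Bochner_Integration.integrable_bound[where f = "\<lambda>p. Q (fst p) * ?I (snd p)"])
    show "integrable lborel (\<lambda>p. Q (fst p) * ?I (snd p))"
      by (intro integrable_tensor Q iI)
    from AE_fst[OF gs] show "AE p in lborel. norm (?I (snd p) * P (fst p) (snd p)) \<le> norm (Q (fst p) * ?I (snd p))"
    proof eventually_elim
      case (elim p)
      then show ?case using PQ[OF elim, of "snd p"] by (auto simp: indicator_def)
    qed
  qed measurable
  have IR: "integrable lborel R"
    using Bochner_Integration.integrable_diff[OF integrable_mult_bounded[OF f, of "\<lambda>p. ?I (snd p)" 1] IP]
    by (simp add: R_def[abs_def] right_diff_distrib mult.commute)
  have R0: "(LINT x|lborel. R x * (\<eta> (fst x) * G' (snd x))) = 0"
    if "smooth \<eta>" "smooth G" "smooth G'" and G: "\<And>x. (G has_real_derivative G' x) (at x)"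
      and z: "\<And>x. x \<notin> {- N..N} \<Longrightarrow> \<eta> x = 0" "\<And>x. x \<notin> {- M..M} \<Longrightarrow> G x = 0" "\<And>x. x \<notin> {- M..M} \<Longrightarrow> G' x = 0"
    for \<eta> G G'
  proof -
    note cont = smooth_continuous_on[OF \<open>smooth \<eta>\<close>, of UNIV] smooth_continuous_on[OF \<open>smooth G\<close>, of UNIV]
      smooth_continuous_on[OF \<open>smooth G'\<close>, of UNIV]
    note [measurable] = cont[THEN borel_measurable_continuous_onI]
    obtain B1 where B1: "\<And>x. \<bar>\<eta> x\<bar> \<le> B1" using bounded_continuous_compact_support[OF cont(1) z(1)] by blast
    obtain B2 where B2: "\<And>x. \<bar>G x\<bar> \<le> B2" using bounded_continuous_compact_support[OF cont(2) z(2)] by blast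
    obtain B3 where B3: "\<And>x. \<bar>G' x\<bar> \<le> B3" using bounded_continuous_compact_support[OF cont(3) z(3)] by blast
    have bd: "\<bar>\<eta> (fst x) * G' (snd x)\<bar> \<le> B1 * B3" "\<bar>\<eta> (fst x) * G (snd x)\<bar> \<le> B1 * B2" for x
      using B1 B2 B3 by (auto simp: abs_mult intro!: mult_mono order_trans[OF abs_ge_zero B1])
    have i1: "integrable lborel (\<lambda>x. f x * (\<eta> (fst x) * G' (snd x)))"
      by (rule integrable_mult_bounded[OF f _ bd(1)]) measurable
    have i2: "integrable lborel (\<lambda>p. ?I (snd p) * P (fst p) (snd p) * (\<eta> (fst p) * G' (snd p)))"
      by (rule integrable_mult_bounded[OF IP _ bd(1)]) measurable
    have i3: "integrable lborel (\<lambda>x. g x * (\<eta> (fst x) * G (snd x)))"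
      by (rule integrable_mult_bounded[OF g _ bd(2)]) measurable
    have "(LINT p|lborel. ?I (snd p) * P (fst p) (snd p) * (\<eta> (fst p) * G' (snd p)))
        = (LINT x|lborel. LINT y|lborel. ?I y * P x y * (\<eta> x * G' y))"
      using lborel_pair.integral_fst'[of "\<lambda>p. ?I (snd p) * P (fst p) (snd p) * (\<eta> (fst p) * G' (snd p))"] i2
      by (simp add: lborel_prod)
    also have "\<dots> = (LINT x|lborel. LINT y|lborel. - (g (x, y) * (\<eta> x * G y)))"
    proof (rule integral_cong_AE)
      show "AE x in lborel. (LINT y|lborel. ?I y * P x y * (\<eta> x * G' y)) = (LINT y|lborel. - (g (x, y) * (\<eta> x * G y)))"
        using gs
      proof eventually_elim
        case (elim x)
        have "(LINT y|lborel. ?I y * P x y * (\<eta> x * G' y)) = (LINT y|lborel. \<eta> x * (?I y * P x y * G' y))"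
          by (simp add: mult_ac)
        also have "\<dots> = \<eta> x * (LINT y|lborel. ?I y * P x y * G' y)" by simp
        also have "(LINT y|lborel. ?I y * P x y * G' y) = (LINT s|lborel. ?I s * g (x, s) * (G M - G s))"
          unfolding P_def
          by (rule primitive_by_parts[OF elim has_field_derivative_at_within[OF G] continuous_on_subset[OF cont(3)]]) simp
        also have "G M = 0"
        proof -
          have "G -` {0} \<supseteq> closure {M<..}"
          proof (rule closure_minimal)
            show "{M<..} \<subseteq> G -` {0}" using z(2) by auto
            show "closed (G -` {0})" using cont(2) by (simp add: continuous_closed_vimage continuous_on_eq_continuous_at)
          qed
          then show ?thesis by (auto simp: subset_iff)
        qed
        also have "(\<lambda>s. ?I s * g (x, s) * (0 - G s)) = (\<lambda>s. - (g (x, s) * G s))"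
          using z(2) by (force simp: indicator_def)
        also have "\<eta> x * (LINT s|lborel. - (g (x, s) * G s)) = (LINT y|lborel. \<eta> x * (- (g (x, y) * G y)))" 
          by (rule integral_mult_right_zero[symmetric])
        finally show ?case by (simp add: mult_ac)
      qed
      show "(\<lambda>x. LINT y|lborel. ?I y * P x y * (\<eta> x * G' y)) \<in> borel_measurable lborel"
        using lborel_pair.integrable_fst'[of "\<lambda>p. ?I (snd p) * P (fst p) (snd p) * (\<eta> (fst p) * G' (snd p))"] i2
        by (simp add: lborel_prod borel_measurable_integrable)
      show "(\<lambda>x. LINT y|lborel. - (g (x, y) * (\<eta> x * G y))) \<in> borel_measurable lborel"
        using lborel_pair.integrable_fst'[of "\<lambda>x. - (g x * (\<eta> (fst x) * G (snd x)))"] i3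
        by (simp add: lborel_prod borel_measurable_integrable)
    qed
    also have "\<dots> = (LINT x|lborel. - (g x * (\<eta> (fst x) * G (snd x))))"
      using lborel_pair.integral_fst'[of "\<lambda>x. - (g x * (\<eta> (fst x) * G (snd x)))"] i3
      by (simp add: lborel_prod)
    also have "\<dots> = (LINT x|lborel. f x * (\<eta> (fst x) * G' (snd x)))"
      using weak[OF that(1-3) G z(1,2)] by simp
    finally have eq: "(LINT p|lborel. ?I (snd p) * P (fst p) (snd p) * (\<eta> (fst p) * G' (snd p)))
       = (LINT x|lborel. f x * (\<eta> (fst x) * G' (snd x)))" .
    have "(\<lambda>x. R x * (\<eta> (fst x) * G' (snd x))) = (\<lambda>x. f x * (\<eta> (fst x) * G' (snd x))
       - ?I (snd x) * P (fst x) (snd x) * (\<eta> (fst x) * G' (snd x)))"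
    proof
      fix x
      show "R x * (\<eta> (fst x) * G' (snd x)) = f x * (\<eta> (fst x) * G' (snd x))
       - ?I (snd x) * P (fst x) (snd x) * (\<eta> (fst x) * G' (snd x))"
        using z(3)[of "snd x"] by (cases "snd x \<in> {- M..M}") (auto simp: R_def algebra_simps)
    qed
    then show ?thesis using i1 i2 eq by simp
  qed
  define b0 where "b0 = bump (- M) M 0"
  have b0_out: "b0 x = 0" if "x \<notin> {- M..M}" for x using that by (auto simp: b0_def bump_outside)
  have b0_abs: "\<bar>b0 x\<bar> \<le> 1" for x by (simp add: b0_def bump_nonneg bump_le_1)
  have b0_smooth: "smooth b0" by (simp add: b0_def smooth_bump)
  have ib: "integrable lborel (bump a b n)" for a b n
  proof -
    have "(\<lambda>x. indicator {a..b} x * bump a b n x) = bump a b n"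
      using bump_outside[of _ a b n] by (intro indicator_times_outside) auto
    then show ?thesis
      using integrable_indicator_continuous[of a b "bump a b n", OF smooth_continuous_on[OF smooth_bump]] by simp
  qed
  have ib0: "integrable lborel b0" unfolding b0_def by (rule ib)
  have [measurable]: "b0 \<in> borel_measurable borel" unfolding b0_def by measurable
  define K0 where "K0 = (LINT x|lborel. b0 x)"
  have "K0 \<noteq> 0"
  proof
    assume "K0 = 0"
    then have "AE x in lborel. b0 x = 0"
      using integral_nonneg_eq_0_iff_AE[OF ib0] by (auto simp: K0_def b0_def bump_nonneg)
    then have "AE x in lborel. x \<notin> {- M<..<M}"
    proof eventually_elim
      case (elim x)
      then show ?case using bump_pos[of x "- M" M 0] by (auto simp: b0_def)
    qed
    then have "{- M<..<M} \<in> null_sets lborel" by (subst (asm) AE_iff_null_sets[symmetric]) auto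
    then show False using M by (auto simp: null_sets_def)
  qed
  define c where "c x = (LINT y|lborel. R (x, y) * b0 y) / K0" for x
  have iRb: "integrable lborel (\<lambda>p. R p * b0 (snd p))"
    by (rule integrable_mult_bounded[OF IR _ b0_abs]) measurable
  have ic: "integrable lborel c"
    unfolding c_def[abs_def] using lborel_pair.integrable_fst'[of "\<lambda>p. R p * b0 (snd p)"] iRb by (simp add: lborel_prod)
  have [measurable]: "c \<in> borel_measurable borel" using borel_measurable_integrable[OF ic] by simp
  define h where "h p = ?I (snd p) * R p - c (fst p) * ?I (snd p)" for p
  have ih: "integrable lborel h"
    unfolding h_def[abs_def]
    using integrable_mult_bounded[OF IR, of "\<lambda>p. ?I (snd p)" 1] integrable_tensor[OF ic iI] mI
    by (intro Bochner_Integration.integrable_diff) (auto simp: mult.commute)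
  have "AE p in lborel. p \<in> {- N<..<N} \<times> {- M<..<M} \<longrightarrow> h p = 0"
  proof (rule fundamental_lemma_rectangle[OF ih])
    fix a b c' d n assume s: "{a..b} \<times> {c'..d} \<subseteq> {- N..N} \<times> {- M..M}"
    define \<eta> where "\<eta> = bump a b n"
    define g1 where "g1 = bump c' d n"
    show "(LINT x|lborel. h x * (bump a b n (fst x) * bump c' d n (snd x))) = 0"
    proof (cases "a \<le> b \<and> c' \<le> d")
      case False
      then have "bump a b n (fst x) * bump c' d n (snd x) = 0" for x
        using bump_outside[of "fst x" a b n] bump_outside[of "snd x" c' d n] by auto
      then show ?thesis by (simp only: mult_zero_right integral_zero)
    next
      case True
      have sub: "{a..b} \<subseteq> {- N..N}" "{c'..d} \<subseteq> {- M..M}" using s True by (auto simp: Times_subset_cancel2 times_subset_iff)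
      have \<eta>: "smooth \<eta>" "\<And>x. x \<notin> {- N..N} \<Longrightarrow> \<eta> x = 0" "\<And>x. \<bar>\<eta> x\<bar> \<le> 1"
      proof -
        fix x assume "x \<notin> {- N..N}"
        then have "x \<notin> {a<..<b}" using sub(1) by (auto simp: subset_iff)
        then show "\<eta> x = 0" unfolding \<eta>_def by (rule bump_outside)
      qed (simp_all add: \<eta>_def smooth_bump bump_nonneg bump_le_1)
      have g1: "smooth g1" "\<And>x. x \<notin> {- M..M} \<Longrightarrow> g1 x = 0" "\<And>x. \<bar>g1 x\<bar> \<le> 1" "integrable lborel g1"
      proof -
        fix x assume "x \<notin> {- M..M}"
        then have "x \<notin> {c'<..<d}" using sub(2) by (auto simp: subset_iff)
        then show "g1 x = 0" unfolding g1_def by (rule bump_outside)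
      qed (simp_all add: g1_def smooth_bump bump_nonneg bump_le_1 ib)
      have [measurable]: "\<eta> \<in> borel_measurable borel" "g1 \<in> borel_measurable borel"
        by (simp_all add: \<eta>_def g1_def)
      \<comment> \<open>Subtracting the right multiple of \<open>b0\<close> makes the mean zero, so that an antiderivative is admissible.\<close>
      define k where "k = (LINT x|lborel. g1 x) / K0"
      define G' where "G' x = g1 x + (- k) * b0 x" for x
      have sG': "smooth G'" unfolding G'_def by (intro smooth_add smooth_mult smooth_const g1 b0_smooth)
      have G'_out: "G' x = 0" if "x \<notin> {- M..M}" for x using g1(2) b0_out that by (simp add: G'_def)
      have "integral {- M..M} G' = (LINT x|lborel. indicator {- M..M} x *\<^sub>R G' x)"
        using set_borel_integral_eq_integral(2)[of "{- M..M}" G'] borel_integrable_atLeastAtMost'[of "- M" M G']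
          smooth_continuous_on[OF sG'] by (simp add: set_lebesgue_integral_def)
      also have "(\<lambda>x. indicator {- M..M} x *\<^sub>R G' x) = G'"
        unfolding real_scaleR_def by (rule indicator_times_outside[OF G'_out])
      also have "(LINT x|lborel. G' x) = 0"
        using \<open>K0 \<noteq> 0\<close> g1(4) ib0 by (simp add: G'_def k_def K0_def)
      finally have "integral {- M..M} G' = 0" .
      then obtain G where G: "\<And>x. (G has_real_derivative G' x) (at x)" "smooth G" "\<And>x. x \<notin> {- M..M} \<Longrightarrow> G x = 0"
      proof -
        have "- M \<le> M" using M by simp
        from smooth_antiderivative[OF sG' G'_out \<open>integral {- M..M} G' = 0\<close> this] show ?thesis using that by blast
      qed
      have i1: "integrable lborel (\<lambda>x. R x * (\<eta> (fst x) * g1 (snd x)))"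
        using \<eta>(3) g1(3) by (intro integrable_mult_bounded[OF IR, of _ 1]) (auto simp: abs_mult intro!: mult_le_one)
      have i2: "integrable lborel (\<lambda>x. R x * b0 (snd x) * \<eta> (fst x))"
        by (rule integrable_mult_bounded[OF iRb _ \<eta>(3)]) measurable
      have i3: "integrable lborel (\<lambda>x. c x * \<eta> x)"
        by (rule integrable_mult_bounded[OF ic _ \<eta>(3)]) measurable
      have "0 = (LINT x|lborel. R x * (\<eta> (fst x) * G' (snd x)))"
        using R0[OF \<eta>(1) G(2) sG' G(1) \<eta>(2) G(3) G'_out] by simp
      also have "\<dots> = (LINT x|lborel. R x * (\<eta> (fst x) * g1 (snd x)) - k * (R x * b0 (snd x) * \<eta> (fst x)))"
        by (simp add: G'_def algebra_simps)
      also have "\<dots> = (LINT x|lborel. R x * (\<eta> (fst x) * g1 (snd x))) - k * (LINT x|lborel. R x * b0 (snd x) * \<eta> (fst x))"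
        using i1 i2 by simp
      also have "(LINT x|lborel. R x * b0 (snd x) * \<eta> (fst x)) = (LINT x|lborel. LINT y|lborel. R (x, y) * b0 y * \<eta> x)"
        using lborel_pair.integral_fst'[of "\<lambda>x. R x * b0 (snd x) * \<eta> (fst x)"] i2 by (simp add: lborel_prod)
      also have "\<dots> = (LINT x|lborel. K0 * (c x * \<eta> x))"
        using \<open>K0 \<noteq> 0\<close> by (simp add: c_def)
      finally have e: "(LINT x|lborel. R x * (\<eta> (fst x) * g1 (snd x))) = k * K0 * (LINT x|lborel. c x * \<eta> x)" by simp
      have "h x * (\<eta> (fst x) * g1 (snd x)) = R x * (\<eta> (fst x) * g1 (snd x)) - (c (fst x) * \<eta> (fst x)) * g1 (snd x)" for x
        using g1(2)[of "snd x"] by (cases "snd x \<in> {- M..M}") (auto simp: h_def algebra_simps)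
      then have "(LINT x|lborel. h x * (\<eta> (fst x) * g1 (snd x)))
        = (LINT x|lborel. R x * (\<eta> (fst x) * g1 (snd x))) - (LINT x|lborel. (c (fst x) * \<eta> (fst x)) * g1 (snd x))"
        using i1 integrable_tensor[OF i3 g1(4)] by simp
      also have "\<dots> = 0"
        using integral_tensor[OF i3 g1(4)] \<open>K0 \<noteq> 0\<close> by (simp add: e k_def)
      finally show ?thesis by (simp add: \<eta>_def g1_def)
    qed
  qed
  then have "AE x in lborel. AE y in lborel. (x, y) \<in> {- N<..<N} \<times> {- M<..<M} \<longrightarrow> h (x, y) = 0"
    using lborel_pair.AE_pair[of "\<lambda>p. p \<in> {- N<..<N} \<times> {- M<..<M} \<longrightarrow> h p = 0"] by (simp only: lborel_prod)
  then show ?thesis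
  proof eventually_elim
    case (elim x)
    show ?case
    proof (intro impI exI[of _ "c x"])
      assume x: "x \<in> {- N<..<N}"
      show "AE y in lborel. y \<in> {- M<..<M} \<longrightarrow> f (x, y) = c x + (LINT s|lborel. indicator {- M..y} s * g (x, s))"
        using elim
      proof eventually_elim
        case (elim y)
        then show ?case using x by (auto simp: h_def R_def P_def)
      qed
    qed
  qed
qed

section \<open>Interpolation inequalities for nonnegative periodic profiles\<close>

lemma integrable_product:
  fixes f g :: "'a \<Rightarrow> real"
  assumes [measurable]: "f \<in> borel_measurable M" "g \<in> borel_measurable M"
    and "integrable M (\<lambda>x. (f x)\<^sup>2)" "integrable M (\<lambda>x. (g x)\<^sup>2)"
  shows "integrable M (\<lambda>x. f x * g x)"
proof (rule Bochner_Integration.integrable_bound[where f = "\<lambda>x. (f x)\<^sup>2 + (g x)\<^sup>2"])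
  show "AE x in M. norm (f x * g x) \<le> norm ((f x)\<^sup>2 + (g x)\<^sup>2)"
  proof (rule AE_I2)
    fix x
    have "2 * (\<bar>f x\<bar> * \<bar>g x\<bar>) \<le> \<bar>f x\<bar>\<^sup>2 + \<bar>g x\<bar>\<^sup>2" using sum_squares_bound[of "\<bar>f x\<bar>" "\<bar>g x\<bar>"] by simp
    moreover have "0 \<le> \<bar>f x\<bar> * \<bar>g x\<bar>" by simp
    ultimately have "\<bar>f x\<bar> * \<bar>g x\<bar> \<le> (f x)\<^sup>2 + (g x)\<^sup>2" unfolding power2_abs by linarith
    then show "norm (f x * g x) \<le> norm ((f x)\<^sup>2 + (g x)\<^sup>2)"
      by (simp add: abs_mult)
  qed
qed (use assms in auto)

lemma Cauchy_Schwarz_integral: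
  fixes f g :: "'a \<Rightarrow> real"
  assumes [measurable]: "f \<in> borel_measurable M" "g \<in> borel_measurable M"
    and f2: "integrable M (\<lambda>x. (f x)\<^sup>2)" and g2: "integrable M (\<lambda>x. (g x)\<^sup>2)"
  shows "(LINT x|M. f x * g x)\<^sup>2 \<le> (LINT x|M. (f x)\<^sup>2) * (LINT x|M. (g x)\<^sup>2)"
proof -
  define A B C where "A = (LINT x|M. (f x)\<^sup>2)" and "B = (LINT x|M. (g x)\<^sup>2)" and "C = (LINT x|M. f x * g x)"
  have fg: "integrable M (\<lambda>x. f x * g x)" by (rule integrable_product[OF assms])
  have pos: "0 \<le> A + 2 * t * C + t\<^sup>2 * B" for t
  proof -
    have "0 \<le> (LINT x|M. (f x + t * g x)\<^sup>2)" by simp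
    also have "(\<lambda>x. (f x + t * g x)\<^sup>2) = (\<lambda>x. (f x)\<^sup>2 + (2 * t) * (f x * g x) + t\<^sup>2 * (g x)\<^sup>2)"
      by (auto simp: power2_eq_square algebra_simps)
    finally show ?thesis using f2 g2 fg by (simp add: A_def B_def C_def)
  qed
  have B: "0 \<le> B" by (simp add: B_def)
  have "C\<^sup>2 \<le> A * B"
  proof (cases "B = 0")
    case True
    have "C = 0"
    proof (rule ccontr)
      assume "C \<noteq> 0"
      then show False using pos[of "- (A + 1) / (2 * C)"] True by (simp add: field_simps)
    qed
    then show ?thesis using True by simp
  next
    case False
    then have "B > 0" using B by simp
    then show ?thesis using pos[of "- C / B"] by (simp add: field_simps power2_eq_square)
  qed
  then show ?thesis by (simp add: A_def B_def C_def)
qed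

abbreviation Leb :: "real \<Rightarrow> real \<Rightarrow> real measure" where
  "Leb a b \<equiv> restrict_space lborel {a..b}"

lemma integral_Leb: "(LINT y|Leb a b. f y) = (LINT y|lborel. indicator {a..b} y * (f y :: real))"
  by (subst integral_restrict_space) auto

lemma integrable_Leb: "integrable (Leb a b) f \<longleftrightarrow> integrable lborel (\<lambda>y. indicator {a..b} y * (f y :: real))"
  by (subst integrable_restrict_space) auto

lemma AE_Leb: "(AE y in Leb a b. Q y) \<longleftrightarrow> (AE y in lborel. y \<in> {a..b} \<longrightarrow> Q y)"
  by (subst AE_restrict_space_iff) auto

lemma integrable_Leb_continuous:
  "continuous_on {a..b} G \<Longrightarrow> integrable (Leb a b) (G :: real \<Rightarrow> real)"
  unfolding integrable_Leb by (rule integrable_indicator_continuous)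

lemma integrable_Leb_lborel:
  assumes "integrable lborel (f :: real \<Rightarrow> real)"
  shows "integrable (Leb a b) f"
  using integrable_mult_indicator[OF _ assms, of "{a..b}"] by (simp add: integrable_Leb)

lemma measure_Leb: "a \<le> b \<Longrightarrow> measure (Leb a b) (space (Leb a b)) = b - a"
  by (subst measure_restrict_space) auto

text \<open>\<open>W\<close> is a nonnegative periodic function with derivative \<open>P\<close> and second derivative \<open>q\<close> in \<open>L\<^sup>2\<close>. The
second derivative enters through the integral formula for \<open>P\<close>, since \<open>P\<close> is only absolutely
continuous.\<close>

definition periodic_H2_profile ::
    "real \<Rightarrow> real \<Rightarrow> (real \<Rightarrow> real) \<Rightarrow> (real \<Rightarrow> real) \<Rightarrow> (real \<Rightarrow> real) \<Rightarrow> bool" where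
  "periodic_H2_profile a b W P q \<longleftrightarrow> a < b \<and>
     (\<forall>y\<in>{a..b}. (W has_real_derivative P y) (at y within {a..b}) \<and> 0 \<le> W y \<and>
        P y = P a + (LINT s|lborel. indicator {a..y} s * q s)) \<and>
     continuous_on {a..b} P \<and> W a = W b \<and> P a = P b \<and> integrable lborel q \<and>
     integrable (Leb a b) (\<lambda>y. (q y)\<^sup>2)"

context
  fixes a b :: real and W P q :: "real \<Rightarrow> real"
  assumes prof: "periodic_H2_profile a b W P q"
begin

lemma profile:
  "a < b" "y \<in> {a..b} \<Longrightarrow> (W has_real_derivative P y) (at y within {a..b})" "y \<in> {a..b} \<Longrightarrow> 0 \<le> W y"
  "y \<in> {a..b} \<Longrightarrow> P y = P a + (LINT s|lborel. indicator {a..y} s * q s)"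
  "continuous_on {a..b} P" "W a = W b" "P a = P b" "integrable lborel q" "integrable (Leb a b) (\<lambda>y. (q y)\<^sup>2)"
  using prof unfolding periodic_H2_profile_def by blast+

lemma profile_W_continuous: "continuous_on {a..b} W"
  using profile(2) by (meson DERIV_continuous continuous_on_eq_continuous_within)

lemma profile_by_parts:
  assumes \<Phi>: "\<And>y. y \<in> {a..b} \<Longrightarrow> (\<Phi> has_real_derivative \<Phi>' y) (at y within {a..b})"
    and \<Phi>': "continuous_on {a..b} \<Phi>'" and per: "\<Phi> a = \<Phi> b"
  shows "(LINT y|Leb a b. P y * \<Phi>' y) = - (LINT y|Leb a b. q y * \<Phi> y)"
proof -
  let ?I = "indicator {a..b} :: real \<Rightarrow> real"
  have c\<Phi>: "continuous_on {a..b} \<Phi>"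
    using \<Phi> by (meson DERIV_continuous continuous_on_eq_continuous_within)
  obtain B where B: "\<forall>y\<in>{a..b}. \<bar>\<Phi> y\<bar> \<le> B"
    using compact_imp_bounded[OF compact_continuous_image[OF c\<Phi>]] by (auto simp: bounded_iff)
  have i\<Phi>: "integrable lborel (\<lambda>s. ?I s * \<Phi> s)" by (rule integrable_indicator_continuous[OF c\<Phi>])
  have iq\<Phi>: "integrable lborel (\<lambda>s. q s * (?I s * \<Phi> s))"
  proof (rule integrable_mult_bounded[OF profile(8) borel_measurable_integrable[OF i\<Phi>], of "max B 0"])
    fix x show "\<bar>?I x * \<Phi> x\<bar> \<le> max B 0" using B by (cases "x \<in> {a..b}") (auto simp: le_max_iff_disj)
  qed
  have iIq: "integrable lborel (\<lambda>s. ?I s * q s)"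
    using integrable_mult_indicator[OF _ profile(8), of "{a..b}"] by simp
  have i\<Phi>': "integrable lborel (\<lambda>s. ?I s * \<Phi>' s)" by (rule integrable_indicator_continuous[OF \<Phi>'])
  have "(LINT y|Leb a b. P y * \<Phi>' y)
      = (LINT y|lborel. P a * (?I y * \<Phi>' y) + ?I y * (LINT s|lborel. indicator {a..y} s * q s) * \<Phi>' y)"
    unfolding integral_Leb
  proof (rule Bochner_Integration.integral_cong[OF refl])
    fix y show "?I y * (P y * \<Phi>' y) = P a * (?I y * \<Phi>' y) + ?I y * (LINT s|lborel. indicator {a..y} s * q s) * \<Phi>' y"
      using profile(4)[of y] by (cases "y \<in> {a..b}") (auto simp: algebra_simps)
  qed
  also have "\<dots> = P a * (LINT y|lborel. ?I y * \<Phi>' y) + (LINT y|lborel. ?I y * (LINT s|lborel. indicator {a..y} s * q s) * \<Phi>' y)"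
  proof (subst Bochner_Integration.integral_add)
    have "integrable lborel (\<lambda>y. ?I y * (P y * \<Phi>' y) - P a * (?I y * \<Phi>' y))"
      using integrable_indicator_continuous[OF continuous_on_mult[OF profile(5) \<Phi>']] i\<Phi>' by simp
    moreover have "?I y * (P y * \<Phi>' y) - P a * (?I y * \<Phi>' y) = ?I y * (LINT s|lborel. indicator {a..y} s * q s) * \<Phi>' y" for y
      using profile(4)[of y] by (cases "y \<in> {a..b}") (auto simp: algebra_simps)
    ultimately show "integrable lborel (\<lambda>y. ?I y * (LINT s|lborel. indicator {a..y} s * q s) * \<Phi>' y)" by simp
  qed (use i\<Phi>' in auto)
  also have "(LINT y|lborel. ?I y * (LINT s|lborel. indicator {a..y} s * q s) * \<Phi>' y)
      = (LINT s|lborel. ?I s * q s * (\<Phi> b - \<Phi> s))"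
    by (rule primitive_by_parts[OF profile(8) \<Phi> \<Phi>'])
  also have "(LINT y|lborel. ?I y * \<Phi>' y) = \<Phi> b - \<Phi> a"
    using integral_FTC_Icc[of a b \<Phi> \<Phi>'] profile(1) \<Phi> \<Phi>'
    by (simp add: has_real_derivative_iff_has_vector_derivative)
  also have "(LINT s|lborel. ?I s * q s * (\<Phi> b - \<Phi> s)) = \<Phi> b * (LINT s|lborel. ?I s * q s) - (LINT s|lborel. q s * (?I s * \<Phi> s))"
    using iIq iq\<Phi> by (simp add: algebra_simps)
  also have "(LINT s|lborel. ?I s * q s) = 0"
    using profile(4)[of b] profile(1,7) by simp
  finally show ?thesis using per by (simp add: integral_Leb mult_ac)
qed

lemma profile_measurable:
  "W \<in> borel_measurable (Leb a b)" "P \<in> borel_measurable (Leb a b)" "q \<in> borel_measurable (Leb a b)"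
  using integrable_Leb_continuous[OF profile_W_continuous] integrable_Leb_continuous[OF profile(5)]
    integrable_Leb_lborel[OF profile(8)] by (auto dest: borel_measurable_integrable)

text \<open>Subtract the minimum: \<open>V = W - min W\<close>, with maximum \<open>M\<close>. Since \<open>V\<^sup>2\<close> rises from \<open>0\<close> to \<open>M\<^sup>2\<close>,
\<open>M\<^sup>2 \<le> 2 \<integral> V \<bar>P\<bar> \<le> 2 sqrt (M A) sqrt D\<close>, that is, \<open>M\<^sup>3 \<le> 4 A D\<close>. Integrating by parts,
\<open>D = - \<integral> q V\<close>, so \<open>D\<^sup>2 \<le> B M A\<close>. Eliminating \<open>M\<close> gives the claim.\<close>

lemma profile_interpolation:
  "(LINT y|Leb a b. (P y)\<^sup>2) ^ 5 \<le> 4 * (LINT y|Leb a b. W y) ^ 4 * (LINT y|Leb a b. (q y)\<^sup>2) ^ 3"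
proof -
  define A B D where "A = (LINT y|Leb a b. W y)" and "B = (LINT y|Leb a b. (q y)\<^sup>2)" and "D = (LINT y|Leb a b. (P y)\<^sup>2)"
  note cW = profile_W_continuous and cP = profile(5)
  have ne: "{a..b} \<noteq> {}" using profile(1) by simp
  obtain y0 where y0: "y0 \<in> {a..b}" "\<And>y. y \<in> {a..b} \<Longrightarrow> W y0 \<le> W y"
    using continuous_attains_inf[OF compact_Icc ne cW] by blast
  define V where "V y = W y - W y0" for y
  have cV: "continuous_on {a..b} V" unfolding V_def by (intro continuous_intros cW)
  have V0: "0 \<le> V y" if "y \<in> {a..b}" for y using y0 that by (simp add: V_def)
  have dV: "(V has_real_derivative P y) (at y within {a..b})" if "y \<in> {a..b}" for y
    unfolding V_def using profile(2)[OF that] by (auto intro!: derivative_eq_intros)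
  obtain y1 where y1: "y1 \<in> {a..b}" "\<And>y. y \<in> {a..b} \<Longrightarrow> V y \<le> V y1"
    using continuous_attains_sup[OF compact_Icc ne cV] by blast
  define M where "M = V y1"
  have M0: "0 \<le> M" using V0 y1 by (simp add: M_def)
  have spc: "space (Leb a b) = {a..b}" by (simp add: space_restrict_space)
  have iW: "integrable (Leb a b) W" and iV: "integrable (Leb a b) V" and iV2: "integrable (Leb a b) (\<lambda>y. (V y)\<^sup>2)"
    and iP2: "integrable (Leb a b) (\<lambda>y. (P y)\<^sup>2)" and iVP: "integrable (Leb a b) (\<lambda>y. \<bar>V y\<bar> * \<bar>P y\<bar>)"
    by (intro integrable_Leb_continuous continuous_intros cW cV cP)+
  have mV: "V \<in> borel_measurable (Leb a b)" using iV by (rule borel_measurable_integrable)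
  have "(LINT y|Leb a b. V y) \<le> A"
    unfolding A_def using y0 profile(3)[OF y0(1)] by (intro integral_mono iV iW) (simp add: V_def)
  moreover have "(LINT y|Leb a b. (V y)\<^sup>2) \<le> (LINT y|Leb a b. M * V y)"
    using y1 V0 iV by (intro integral_mono iV2) (auto simp: spc power2_eq_square M_def intro!: mult_right_mono)
  ultimately have V2: "(LINT y|Leb a b. (V y)\<^sup>2) \<le> M * A"
    using M0 mult_left_mono[of "LINT y|Leb a b. V y" A M] by simp
  have nn: "0 \<le> A" "0 \<le> B" "0 \<le> D" unfolding A_def B_def D_def
    using profile(3) by (auto intro!: integral_nonneg_AE AE_I2 simp: spc)
  have "M\<^sup>2 \<le> 2 * (LINT y|Leb a b. \<bar>V y\<bar> * \<bar>P y\<bar>)"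
  proof -
    have *: "\<bar>(V v)\<^sup>2 - (V u)\<^sup>2\<bar> \<le> 2 * (LINT y|Leb a b. \<bar>V y\<bar> * \<bar>P y\<bar>)" if "u \<le> v" "u \<in> {a..b}" "v \<in> {a..b}" for u v
    proof -
      have c2: "continuous_on {u..v} (\<lambda>y. 2 * V y * P y)"
        using that by (intro continuous_intros continuous_on_subset[OF cV] continuous_on_subset[OF cP]) auto
      have "(LINT y|lborel. indicator {u..v} y *\<^sub>R (2 * V y * P y)) = (V v)\<^sup>2 - (V u)\<^sup>2"
      proof (rule integral_FTC_Icc[OF that(1) _ c2])
        fix y assume "u \<le> y" "y \<le> v"
        then have "(V has_real_derivative P y) (at y within {u..v})"
          using has_field_derivative_subset[OF dV[of y], of "{u..v}"] that by auto
        then show "((\<lambda>y. (V y)\<^sup>2) has_vector_derivative 2 * V y * P y) (at y within {u..v})"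
          unfolding has_real_derivative_iff_has_vector_derivative[symmetric]
          by (auto intro!: derivative_eq_intros)
      qed
      then have "\<bar>(V v)\<^sup>2 - (V u)\<^sup>2\<bar> \<le> (LINT y|lborel. \<bar>indicator {u..v} y * (2 * V y * P y)\<bar>)"
        using integral_abs_bound[of lborel "\<lambda>y. indicator {u..v} y * (2 * V y * P y)"] by simp
      also have "\<dots> \<le> (LINT y|lborel. 2 * (indicator {a..b} y * (\<bar>V y\<bar> * \<bar>P y\<bar>)))"
      proof (rule integral_mono)
        show "integrable lborel (\<lambda>y. \<bar>indicator {u..v} y * (2 * V y * P y)\<bar>)"
          by (intro integrable_abs integrable_indicator_continuous c2)
        show "integrable lborel (\<lambda>y. 2 * (indicator {a..b} y * (\<bar>V y\<bar> * \<bar>P y\<bar>)))"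
          using iVP by (simp add: integrable_Leb)
      qed (use that in \<open>auto simp: indicator_def abs_mult\<close>)
      finally show ?thesis by (simp add: integral_Leb)
    qed
    have "V y0 = 0" by (simp add: V_def)
    then show ?thesis
      using *[of y0 y1] *[of y1 y0] y0(1) y1(1) by (cases "y0 \<le> y1") (auto simp: M_def)
  qed
  moreover have "(LINT y|Leb a b. \<bar>V y\<bar> * \<bar>P y\<bar>)\<^sup>2 \<le> (M * A) * D"
  proof -
    have "(LINT y|Leb a b. \<bar>V y\<bar> * \<bar>P y\<bar>)\<^sup>2 \<le> (LINT y|Leb a b. \<bar>V y\<bar>\<^sup>2) * (LINT y|Leb a b. \<bar>P y\<bar>\<^sup>2)"
      using iV2 iP2 profile_measurable mV by (intro Cauchy_Schwarz_integral) auto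
    also have "\<dots> \<le> (M * A) * D" using V2 nn by (simp add: D_def mult_right_mono)
    finally show ?thesis .
  qed
  ultimately have "(M\<^sup>2)\<^sup>2 \<le> 4 * ((M * A) * D)"
    using power_mono[of "M\<^sup>2" "2 * (LINT y|Leb a b. \<bar>V y\<bar> * \<bar>P y\<bar>)" 2] by (simp add: power_mult_distrib)
  then have "M * M ^ 3 \<le> M * (4 * A * D)" by (simp add: power2_eq_square power3_eq_cube mult_ac)
  then have M3: "M ^ 3 \<le> 4 * A * D"
    using M0 nn by (cases "M = 0") auto
  have "D = - (LINT y|Leb a b. q y * V y)"
    using profile_by_parts[of V P] dV cP profile(6) by (simp add: D_def power2_eq_square V_def)
  then have "D\<^sup>2 \<le> B * (LINT y|Leb a b. (V y)\<^sup>2)"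
    using Cauchy_Schwarz_integral[OF profile_measurable(3) mV profile(9) iV2] by (simp add: B_def)
  also have "\<dots> \<le> B * (M * A)" using V2 nn by (intro mult_left_mono)
  finally have "(D\<^sup>2) ^ 3 \<le> (B * (M * A)) ^ 3" by (intro power_mono) auto
  also have "\<dots> = M ^ 3 * (A * B) ^ 3" by (simp add: power_mult_distrib)
  also have "\<dots> \<le> 4 * A * D * (A * B) ^ 3" using M3 nn by (intro mult_right_mono) auto
  finally have "D * D ^ 5 \<le> D * (4 * A ^ 4 * B ^ 3)"
    by (simp add: power_mult_distrib flip: power_mult) (simp add: eval_nat_numeral mult_ac)
  then have "D ^ 5 \<le> 4 * A ^ 4 * B ^ 3"
    using nn by (cases "D = 0") auto
  then show ?thesis by (simp add: A_def B_def D_def)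
qed

text \<open>The sharp bound has to be additive over many separated folds, which rules out the maximum of \<open>W\<close> as
an intermediate quantity. Instead, for \<open>V = W + \<delta>\<close>, integration by parts against \<open>2 sqrt V\<close> gives
\<open>\<integral> P\<^sup>2 / sqrt V = - 2 \<integral> q sqrt V \<le> 2 sqrt (B \<integral> V)\<close>, and this weighted slope energy controls
\<open>P\<^sup>2\<close> except where \<open>V\<close> exceeds \<open>\<tau>\<^sup>2\<close>. The shift by \<open>\<delta>\<close>, which tends to zero, makes the
square root differentiable.\<close>

lemma profile_interpolation_bounded_slope:
  assumes m: "\<And>y. y \<in> {a..b} \<Longrightarrow> \<bar>P y\<bar> \<le> m" and \<tau>: "0 < \<tau>"
  shows "(LINT y|Leb a b. (P y)\<^sup>2) \<le>
     2 * \<tau> * sqrt ((LINT y|Leb a b. (q y)\<^sup>2) * (LINT y|Leb a b. W y)) + m\<^sup>2 * (LINT y|Leb a b. W y) / \<tau>\<^sup>2"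
proof -
  define A B D where "A = (LINT y|Leb a b. W y)" and "B = (LINT y|Leb a b. (q y)\<^sup>2)" and "D = (LINT y|Leb a b. (P y)\<^sup>2)"
  note cW = profile_W_continuous and cP = profile(5)
  have spc: "space (Leb a b) = {a..b}" by (simp add: space_restrict_space)
  have ineq: "D \<le> 2 * \<tau> * sqrt (B * (A + \<delta> * (b - a))) + m\<^sup>2 * (A + \<delta> * (b - a)) / \<tau>\<^sup>2" if \<delta>: "0 < \<delta>" for \<delta>
  proof -
    define V where "V y = W y + \<delta>" for y
    have V: "0 < V y" if "y \<in> {a..b}" for y using profile(3)[OF that] \<delta> by (simp add: V_def)
    have cV: "continuous_on {a..b} V" unfolding V_def by (intro continuous_intros cW)
    have cd: "continuous_on {a..b} (\<lambda>y. P y / sqrt (V y))"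
      using V by (intro continuous_intros cP cV) force
    have cd2: "continuous_on {a..b} (\<lambda>y. P y * (P y / sqrt (V y)))"
      by (intro continuous_on_mult cP cd)
    have iV: "integrable (Leb a b) V" and iPP: "integrable (Leb a b) (\<lambda>y. P y * (P y / sqrt (V y)))"
      and iP2: "integrable (Leb a b) (\<lambda>y. (P y)\<^sup>2)" and iS: "integrable (Leb a b) (\<lambda>y. sqrt (V y))"
      and iW: "integrable (Leb a b) W"
      by (intro integrable_Leb_continuous cV cd2 cW continuous_intros cP)+
    have AV: "(LINT y|Leb a b. V y) = A + \<delta> * (b - a)"
    proof -
      have "integrable (Leb a b) (\<lambda>y. \<delta>)" by (intro integrable_Leb_continuous continuous_intros)
      then show ?thesis using iW profile(1) measure_Leb[of a b] unfolding V_def A_def by simp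
    qed
    have "(LINT y|Leb a b. P y * (P y / sqrt (V y))) = - (LINT y|Leb a b. q y * (2 * sqrt (V y)))"
    proof (rule profile_by_parts[OF _ cd])
      fix y assume y: "y \<in> {a..b}"
      show "((\<lambda>y. 2 * sqrt (V y)) has_real_derivative P y / sqrt (V y)) (at y within {a..b})"
        unfolding V_def using profile(2)[OF y] V[OF y]
        by (auto intro!: derivative_eq_intros simp: V_def field_simps)
    qed (simp add: V_def profile(6))
    also have "\<dots> \<le> 2 * sqrt (B * (A + \<delta> * (b - a)))"
    proof -
      have sq: "(LINT y|Leb a b. (sqrt (V y))\<^sup>2) = (LINT y|Leb a b. V y)"
        using V by (intro Bochner_Integration.integral_cong) (auto simp: spc less_imp_le)
      have isq: "integrable (Leb a b) (\<lambda>y. (sqrt (V y))\<^sup>2)"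
        using iV V by (subst Bochner_Integration.integrable_cong[where g = V]) (auto simp: spc less_imp_le)
      have "(LINT y|Leb a b. q y * sqrt (V y))\<^sup>2 \<le> B * (LINT y|Leb a b. (sqrt (V y))\<^sup>2)"
        unfolding B_def
        by (intro Cauchy_Schwarz_integral profile_measurable profile(9) isq borel_measurable_integrable[OF iS])
      then have "\<bar>LINT y|Leb a b. q y * sqrt (V y)\<bar> \<le> sqrt (B * (A + \<delta> * (b - a)))"
        unfolding sq AV by (rule real_le_rsqrt[of "\<bar>_\<bar>", unfolded power2_abs])
      moreover have "(LINT y|Leb a b. q y * (2 * sqrt (V y))) = 2 * (LINT y|Leb a b. q y * sqrt (V y))"
        unfolding integral_mult_right_zero[symmetric] by (simp add: mult_ac)
      ultimately show ?thesis by linarith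
    qed
    finally have 1: "(LINT y|Leb a b. P y * (P y / sqrt (V y))) \<le> 2 * sqrt (B * (A + \<delta> * (b - a)))" .
    have i1: "integrable (Leb a b) (\<lambda>y. \<tau> * (P y * (P y / sqrt (V y))))"
      by (rule integrable_mult_right[OF iPP])
    have i2: "integrable (Leb a b) (\<lambda>y. m\<^sup>2 / \<tau>\<^sup>2 * V y)"
      by (rule integrable_mult_right[OF iV])
    note i12 = Bochner_Integration.integrable_add[OF i1 i2]
    have "D \<le> (LINT y|Leb a b. \<tau> * (P y * (P y / sqrt (V y))) + m\<^sup>2 / \<tau>\<^sup>2 * V y)"
      unfolding D_def
    proof (rule integral_mono[OF iP2])
      fix y assume "y \<in> space (Leb a b)"
      then have y: "y \<in> {a..b}" by (simp add: spc)
      have Vy: "0 < V y" "0 < sqrt (V y)" using V[OF y] by auto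
      \<comment> \<open>Where the profile is low its weight makes the first term large; elsewhere the second
        term exceeds the maximal slope.\<close>
      show "(P y)\<^sup>2 \<le> \<tau> * (P y * (P y / sqrt (V y))) + m\<^sup>2 / \<tau>\<^sup>2 * V y"
      proof (cases "sqrt (V y) \<le> \<tau>")
        case True
        then have "(P y)\<^sup>2 * 1 \<le> (P y)\<^sup>2 * (\<tau> / sqrt (V y))" using Vy by (intro mult_left_mono) auto
        also have "\<dots> = \<tau> * (P y * (P y / sqrt (V y)))" by (simp add: power2_eq_square)
        finally show ?thesis using Vy by (simp add: add_increasing2)
      next
        case False
        then have "\<tau>\<^sup>2 \<le> (sqrt (V y))\<^sup>2" using \<tau> by (intro power_mono) auto
        then have "\<tau>\<^sup>2 \<le> V y" using Vy by simp
        have "(P y)\<^sup>2 \<le> m\<^sup>2" using m[OF y] by (simp add: abs_le_square_iff[symmetric])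
        also have "m\<^sup>2 * 1 \<le> m\<^sup>2 * (V y / \<tau>\<^sup>2)" using \<open>\<tau>\<^sup>2 \<le> V y\<close> \<tau> by (intro mult_left_mono) auto
        finally have "(P y)\<^sup>2 \<le> m\<^sup>2 / \<tau>\<^sup>2 * V y" by simp
        moreover have "0 \<le> \<tau> * (P y * (P y / sqrt (V y)))"
          using \<tau> Vy by (simp add: power2_eq_square[symmetric])
        ultimately show ?thesis by linarith
      qed
    qed (rule i12)
    also have "\<dots> = \<tau> * (LINT y|Leb a b. P y * (P y / sqrt (V y))) + m\<^sup>2 / \<tau>\<^sup>2 * (A + \<delta> * (b - a))"
      unfolding AV[symmetric]
      by (subst Bochner_Integration.integral_add[OF i1 i2]) (simp only: integral_mult_right_zero)
    also have "\<dots> \<le> \<tau> * (2 * sqrt (B * (A + \<delta> * (b - a)))) + m\<^sup>2 / \<tau>\<^sup>2 * (A + \<delta> * (b - a))"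
      using 1 \<tau> by (intro add_right_mono mult_left_mono) auto
    finally show ?thesis by (simp add: mult_ac)
  qed
  have "((\<lambda>\<delta>. 2 * \<tau> * sqrt (B * (A + \<delta> * (b - a))) + m\<^sup>2 * (A + \<delta> * (b - a)) / \<tau>\<^sup>2)
    \<longlongrightarrow> 2 * \<tau> * sqrt (B * (A + 0 * (b - a))) + m\<^sup>2 * (A + 0 * (b - a)) / \<tau>\<^sup>2) (at_right 0)"
    by (intro tendsto_intros) (use \<tau> in auto)
  then have "D \<le> 2 * \<tau> * sqrt (B * (A + 0 * (b - a))) + m\<^sup>2 * (A + 0 * (b - a)) / \<tau>\<^sup>2"
    by (rule tendsto_lowerbound) (use ineq in \<open>auto simp: eventually_at_right_less intro!: eventually_at_rightI[of 0 1]\<close>)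
  then show ?thesis by (simp add: A_def B_def D_def)
qed

end

section \<open>Slices of periodic Sobolev functions\<close>

lemma integral_swap:
  fixes f :: "real \<times> real \<Rightarrow> real"
  assumes [measurable]: "f \<in> borel_measurable borel"
  shows "(LINT p|lborel. f (snd p, fst p)) = (LINT p|lborel. f p)"
    and "integrable lborel (\<lambda>p. f (snd p, fst p)) = integrable lborel f"
  using lborel_pair.integral_product_swap[of f] lborel_pair.integrable_product_swap_iff[of f] assms
  by (simp_all add: lborel_prod case_prod_beta')

lemma integrable_indicator_times:
  assumes "integrable lborel (\<gamma> :: real \<Rightarrow> real)" "A \<in> sets borel"
  shows "integrable lborel (\<lambda>s. indicator A s * \<gamma> s)"
  using integrable_mult_indicator[of A lborel \<gamma>] assms by simp

lemma integral_lebesgue_lborel: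
  assumes "f \<in> borel_measurable borel"
  shows "(LINT x|lebesgue. f x) = (LINT x|lborel. (f x :: real))"
    and "integrable lebesgue f = integrable lborel f"
  using integral_completion[of f lborel] integrable_completion[of f lborel] assms by simp_all

lemma derivative_outside_support:
  assumes "\<And>x. (G has_real_derivative G' x) (at x)" "\<And>x. x \<notin> {a..b} \<Longrightarrow> G x = (0::real)" "x \<notin> {a..b}"
  shows "G' x = 0"
proof -
  have "((\<lambda>x. 0) has_real_derivative 0) (at x)" by simp
  then have "(G has_real_derivative 0) (at x)"
  proof (rule has_field_derivative_transform_within_open)
    show "open (- {a..b})" by (intro open_Compl closed_atLeastAtMost)
  qed (use assms in auto)
  then show ?thesis using assms(1) DERIV_unique by blast
qed

text \<open>The defining identity of a weak derivative, carried over to Borel representatives on \<open>lborel\<close>.\<close>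

lemma weak_pderiv_against_product:
  fixes F g F' g' :: "real \<times> real \<Rightarrow> real"
  assumes w: "has_weak_pderiv UNIV e F g" and t: "test_function UNIV \<psi>" and e: "e \<in> {e\<theta>, ez}"
    and F': "F' \<in> borel_measurable borel" "AE x in lebesgue. F x = F' x"
    and g': "g' \<in> borel_measurable borel" "AE x in lebesgue. g x = g' x"
  shows "(LINT x|lborel. F' x * frechet_derivative \<psi> (at x) e) = - (LINT x|lborel. g' x * \<psi> x)"
proof -
  have eB: "e \<in> Basis" using e by (simp add: prod_Basis)
  have m: "\<psi> \<in> borel_measurable borel" "(\<lambda>x. frechet_derivative \<psi> (at x) e) \<in> borel_measurable borel"
    by (intro borel_measurable_continuous_onI test_function_continuous[OF t] eB)+
  have li: "locally_integrable UNIV F" "locally_integrable UNIV g" using w by (auto simp: has_weak_pderiv_def)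
  have m': "(\<lambda>x. F' x * frechet_derivative \<psi> (at x) e) \<in> borel_measurable lebesgue"
    "(\<lambda>x. g' x * \<psi> x) \<in> borel_measurable lebesgue"
    using borel_measurable_times[OF F'(1) m(2)] borel_measurable_times[OF g'(1) m(1)]
    by (simp_all add: measurable_completion)
  have "(LINT x|lebesgue. F' x * frechet_derivative \<psi> (at x) e) = (LINT x|lebesgue. F x * frechet_derivative \<psi> (at x) e)"
    using locally_integrable_mult_test(2)[OF li(1) t eB] F'(2) m'(1)
    by (intro integral_cong_AE) (auto simp: set_integrable_def dest: borel_measurable_integrable elim: eventually_mono)
  moreover have "(LINT x|lebesgue. g' x * \<psi> x) = (LINT x|lebesgue. g x * \<psi> x)"
    using locally_integrable_mult_test(1)[OF li(2) t] g'(2) m'(2)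
    by (intro integral_cong_AE) (auto simp: set_integrable_def dest: borel_measurable_integrable elim: eventually_mono)
  moreover have "(LINT x|lebesgue. F x * frechet_derivative \<psi> (at x) e) = - (LINT x|lebesgue. g x * \<psi> x)"
    using w t by (simp add: has_weak_pderiv_def set_lebesgue_integral_def)
  ultimately show ?thesis
    using integral_lebesgue_lborel(1)[OF borel_measurable_times[OF F'(1) m(2)]]
      integral_lebesgue_lborel(1)[OF borel_measurable_times[OF g'(1) m(1)]] by simp
qed

lemma integrable_on_rectangle:
  fixes F F' :: "real \<times> real \<Rightarrow> real"
  assumes li: "locally_integrable UNIV F"
    and F': "F' \<in> borel_measurable borel" "AE x in lebesgue. F x = F' x" and K: "compact K"
  shows "integrable lborel (\<lambda>x. indicator K x * F' x)"
proof -
  have i: "integrable lebesgue (\<lambda>x. indicator K x * F x)"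
    using li K by (simp add: locally_integrable_def set_integrable_def)
  have m: "(\<lambda>x. indicator K x * F' x) \<in> borel_measurable borel"
    using F'(1) K by (intro borel_measurable_times borel_measurable_indicator) (auto simp: borel_compact)
  have "integrable lebesgue (\<lambda>x. indicator K x * F' x)"
    by (rule integrable_cong_AE_imp[OF i]) (use m F'(2) in \<open>auto simp: measurable_completion elim: eventually_mono\<close>)
  then show ?thesis using integral_lebesgue_lborel(2)[OF m] by simp
qed

text \<open>The global statement follows by cutting off to the rectangles \<open>[-N, N] \<times> [-M, M]\<close>; only test functions
supported there see the cut-off functions.\<close>

lemma absolutely_continuous_slices_locally:
  fixes f g :: "real \<times> real \<Rightarrow> real"
  assumes int: "\<And>K. compact K \<Longrightarrow> integrable lborel (\<lambda>x. indicator K x * f x)"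
      "\<And>K. compact K \<Longrightarrow> integrable lborel (\<lambda>x. indicator K x * g x)" and M: "0 < M"
    and weak: "\<And>\<eta> G G' N. smooth \<eta> \<Longrightarrow> smooth G \<Longrightarrow> smooth G' \<Longrightarrow>
        (\<And>x. (G has_real_derivative G' x) (at x)) \<Longrightarrow>
        (\<And>x. x \<notin> {- N..N} \<Longrightarrow> \<eta> x = 0) \<Longrightarrow> (\<And>x. x \<notin> {- M..M} \<Longrightarrow> G x = 0) \<Longrightarrow>
        (LINT x|lborel. f x * (\<eta> (fst x) * G' (snd x))) = - (LINT x|lborel. g x * (\<eta> (fst x) * G (snd x)))"
  shows "AE x in lborel. \<exists>c. AE y in lborel. y \<in> {- M<..<M} \<longrightarrow>
           f (x, y) = c + (LINT s|lborel. indicator {- M..y} s * g (x, s))"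
proof -
  have "AE x in lborel. x \<in> {- real N<..<real N} \<longrightarrow> (\<exists>c. AE y in lborel. y \<in> {- M<..<M} \<longrightarrow>
           f (x, y) = c + (LINT s|lborel. indicator {- M..y} s * g (x, s)))" for N :: nat
  proof -
    define K where "K = {- real N..real N} \<times> {- M..M}"
    have K: "compact K" unfolding K_def by (intro compact_Times compact_Icc)
    have "AE x in lborel. x \<in> {- real N<..<real N} \<longrightarrow> (\<exists>c. AE y in lborel. y \<in> {- M<..<M} \<longrightarrow>
           indicator K (x, y) * f (x, y) = c + (LINT s|lborel. indicator {- M..y} s * (indicator K (x, s) * g (x, s))))"
    proof (rule absolutely_continuous_slices[OF int[OF K] M])
      fix \<eta> G G' :: "real \<Rightarrow> real"
      assume s: "smooth \<eta>" "smooth G" "smooth G'" and d: "\<And>x. (G has_real_derivative G' x) (at x)"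
        and z: "\<And>x. x \<notin> {- real N..real N} \<Longrightarrow> \<eta> x = 0" "\<And>x. x \<notin> {- M..M} \<Longrightarrow> G x = 0"
      have z': "G' x = 0" if "x \<notin> {- M..M}" for x using derivative_outside_support[OF d z(2) that] .
      have eq: "f x * (\<eta> (fst x) * G' (snd x)) = indicator K x * f x * (\<eta> (fst x) * G' (snd x))"
        "g x * (\<eta> (fst x) * G (snd x)) = indicator K x * g x * (\<eta> (fst x) * G (snd x))" for x
        using z(1)[of "fst x"] z(2)[of "snd x"] z'[of "snd x"]
        by (cases "x \<in> K"; cases x; force simp: K_def)+
      show "(LINT x|lborel. indicator K x * f x * (\<eta> (fst x) * G' (snd x))) =
        - (LINT x|lborel. indicator K x * g x * (\<eta> (fst x) * G (snd x)))"
        using weak[OF s d z] by (simp add: eq)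
    qed
    then show ?thesis
    proof eventually_elim
      case (elim x)
      show ?case
      proof
        assume x: "x \<in> {- real N<..<real N}"
        then obtain c where c: "AE y in lborel. y \<in> {- M<..<M} \<longrightarrow>
           indicator K (x, y) * f (x, y) = c + (LINT s|lborel. indicator {- M..y} s * (indicator K (x, s) * g (x, s)))"
          using elim by blast
        have "AE y in lborel. y \<in> {- M<..<M} \<longrightarrow> f (x, y) = c + (LINT s|lborel. indicator {- M..y} s * g (x, s))"
          using c
        proof eventually_elim
          case (elim y)
          show ?case
          proof
            assume y: "y \<in> {- M<..<M}"
            have "(\<lambda>s. indicator {- M..y} s * (indicator K (x, s) * g (x, s))) = (\<lambda>s. indicator {- M..y} s * g (x, s))"
              using x y by (auto simp: K_def indicator_def)
            then show "f (x, y) = c + (LINT s|lborel. indicator {- M..y} s * g (x, s))"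
              using elim x y by (simp add: K_def)
          qed
        qed
        then show "\<exists>c. AE y in lborel. y \<in> {- M<..<M} \<longrightarrow>
           f (x, y) = c + (LINT s|lborel. indicator {- M..y} s * g (x, s))" by blast
      qed
    qed
  qed
  then have "AE x in lborel. \<forall>N::nat. x \<in> {- real N<..<real N} \<longrightarrow> (\<exists>c. AE y in lborel. y \<in> {- M<..<M} \<longrightarrow>
           f (x, y) = c + (LINT s|lborel. indicator {- M..y} s * g (x, s)))"
    unfolding AE_all_countable by blast
  then show ?thesis
  proof eventually_elim
    case (elim x)
    obtain N :: nat where "\<bar>x\<bar> < real N" using reals_Archimedean2 by blast
    then have "x \<in> {- real N<..<real N}" by auto
    with elim show ?case by blast
  qed
qed

lemma weak_pderiv_z_slices:
  fixes F g F' g' :: "real \<times> real \<Rightarrow> real"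
  assumes w: "has_weak_pderiv UNIV ez F g"
    and F': "F' \<in> borel_measurable borel" "AE x in lebesgue. F x = F' x"
    and g': "g' \<in> borel_measurable borel" "AE x in lebesgue. g x = g' x"
    and M: "0 < M"
  shows "AE x in lborel. \<exists>c. AE y in lborel. y \<in> {- M<..<M} \<longrightarrow>
           F' (x, y) = c + (LINT s|lborel. indicator {- M..y} s * g' (x, s))"
proof (rule absolutely_continuous_slices_locally[OF _ _ M])
  have li: "locally_integrable UNIV F" "locally_integrable UNIV g" using w by (auto simp: has_weak_pderiv_def)
  show "integrable lborel (\<lambda>x. indicator K x * F' x)" "integrable lborel (\<lambda>x. indicator K x * g' x)"
    if "compact K" for K
    using integrable_on_rectangle[OF li(1) F' that] integrable_on_rectangle[OF li(2) g' that] .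
  fix \<eta> G G' :: "real \<Rightarrow> real" and N :: real
  assume s: "smooth \<eta>" "smooth G" and d: "\<And>x. (G has_real_derivative G' x) (at x)"
    and z: "\<And>x. x \<notin> {- N..N} \<Longrightarrow> \<eta> x = 0" "\<And>x. x \<notin> {- M..M} \<Longrightarrow> G x = 0"
  obtain \<eta>' where \<eta>': "\<And>x. (\<eta> has_real_derivative \<eta>' x) (at x)" using smooth_obtain_deriv[OF s(1)] by blast
  have t: "test_function UNIV (\<lambda>x. \<eta> (fst x) * G (snd x))"
    by (rule test_function_prod[OF s z]) auto
  show "(LINT x|lborel. F' x * (\<eta> (fst x) * G' (snd x))) = - (LINT x|lborel. g' x * (\<eta> (fst x) * G (snd x)))"
    using weak_pderiv_against_product[OF w t _ F' g'] by (simp add: frechet_derivative_prod[OF \<eta>' d])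
qed

lemma weak_pderiv_\<theta>_slices:
  fixes F g F' g' :: "real \<times> real \<Rightarrow> real"
  assumes w: "has_weak_pderiv UNIV e\<theta> F g"
    and F': "F' \<in> borel_measurable borel" "AE x in lebesgue. F x = F' x"
    and g': "g' \<in> borel_measurable borel" "AE x in lebesgue. g x = g' x"
    and M: "0 < M"
  shows "AE x in lborel. \<exists>c. AE y in lborel. y \<in> {- M<..<M} \<longrightarrow>
           F' (y, x) = c + (LINT s|lborel. indicator {- M..y} s * g' (s, x))"
proof -
  have li: "locally_integrable UNIV F" "locally_integrable UNIV g" using w by (auto simp: has_weak_pderiv_def)
  have sw: "integrable lborel (\<lambda>x. indicator K x * f (snd x, fst x))"
    if f: "f \<in> borel_measurable borel" and i: "\<And>K. compact K \<Longrightarrow> integrable lborel (\<lambda>x. indicator K x * f x)"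
      and K: "compact K" for K and f :: "real \<times> real \<Rightarrow> real"
  proof -
    let ?K = "(\<lambda>x. (snd x, fst x)) ` K"
    have K': "compact ?K" using K by (intro compact_continuous_image continuous_intros)
    have "integrable lborel (\<lambda>x. indicator ?K (snd x, fst x) * f (snd x, fst x))"
      using integral_swap(2)[of "\<lambda>x. indicator ?K x * f x"] i[OF K'] borel_measurable_integrable[OF i[OF K']] by simp
    moreover have "indicator ?K (snd x, fst x) = (indicator K x :: real)" for x
      by (cases x) (force simp: indicator_def)
    ultimately show ?thesis by simp
  qed
  have "AE x in lborel. \<exists>c. AE y in lborel. y \<in> {- M<..<M} \<longrightarrow> F' (snd (x, y), fst (x, y)) =
         c + (LINT s|lborel. indicator {- M..y} s * g' (snd (x, s), fst (x, s)))"
  proof (rule absolutely_continuous_slices_locally[OF sw[OF F'(1)] sw[OF g'(1)] M])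
    fix \<eta> G G' :: "real \<Rightarrow> real" and N :: real
    assume s: "smooth \<eta>" "smooth G" "smooth G'" and d: "\<And>x. (G has_real_derivative G' x) (at x)"
      and z: "\<And>x. x \<notin> {- N..N} \<Longrightarrow> \<eta> x = 0" "\<And>x. x \<notin> {- M..M} \<Longrightarrow> G x = 0"
    obtain \<eta>' where \<eta>': "\<And>x. (\<eta> has_real_derivative \<eta>' x) (at x)" using smooth_obtain_deriv[OF s(1)] by blast
    have t: "test_function UNIV (\<lambda>x. G (fst x) * \<eta> (snd x))"
      by (rule test_function_prod[OF s(2,1) z(2,1)]) auto
    note cm = smooth_continuous_on[of _ UNIV, THEN borel_measurable_continuous_onI]
    note [measurable] = cm[OF s(1)] cm[OF s(2)] cm[OF s(3)] F'(1) g'(1)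
    have "(LINT x|lborel. F' x * (\<eta> (snd x) * G' (fst x))) = - (LINT x|lborel. g' x * (\<eta> (snd x) * G (fst x)))"
      using weak_pderiv_against_product[OF w t _ F' g']
      by (simp add: frechet_derivative_prod[OF d \<eta>'] mult.commute[of "\<eta> _"])
    moreover have "(\<lambda>x. F' x * (\<eta> (snd x) * G' (fst x))) \<in> borel_measurable borel"
      "(\<lambda>x. g' x * (\<eta> (snd x) * G (fst x))) \<in> borel_measurable borel" by measurable
    note this[THEN integral_swap(1)]
    ultimately show "(LINT x|lborel. F' (snd x, fst x) * (\<eta> (fst x) * G' (snd x))) =
        - (LINT x|lborel. g' (snd x, fst x) * (\<eta> (fst x) * G (snd x)))"
      by simp
  qed (use integrable_on_rectangle[OF li(1) F'] integrable_on_rectangle[OF li(2) g'] in auto)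
  then show ?thesis by simp
qed

text \<open>The set where two continuous functions differ is open, and a nonempty open set is not null.\<close>

lemma continuous_AE_eq_imp_eq:
  fixes f g :: "real \<Rightarrow> real"
  assumes "continuous_on {a<..<b} f" "continuous_on {a<..<b} g"
    and "AE y in lborel. y \<in> {a<..<b} \<longrightarrow> f y = g y" and x: "x \<in> {a<..<b}"
  shows "f x = g x"
proof (rule ccontr)
  assume ne: "f x \<noteq> g x"
  let ?S = "{a<..<b} \<inter> (\<lambda>y. f y - g y) -` (- {0})"
  have "open ?S"
    by (intro continuous_open_preimage continuous_on_diff assms(1,2)) auto
  moreover have "AE y in lebesgue. y \<notin> ?S"
    using assms(3) unfolding AE_completion_iff by eventually_elim auto
  then have "negligible ?S"
    using AE_iff_null_sets[of ?S lebesgue] \<open>open ?S\<close> by (auto simp: negligible_iff_null_sets)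
  ultimately have "?S = {}" using open_not_negligible by blast
  then show False using ne x by auto
qed

lemma primitive_continuous:
  fixes \<gamma> :: "real \<Rightarrow> real"
  assumes "integrable lborel \<gamma>"
  shows "continuous_on {a..b} (\<lambda>y. LINT s|lborel. indicator {a..y} s * (\<gamma> s :: real))"
proof -
  have si: "set_integrable lborel {a..y} \<gamma>" for y
    using integrable_indicator_times[OF assms, of "{a..y}"] by (simp add: set_integrable_def)
  have "(LINT s|lborel. indicator {a..y} s * \<gamma> s) = integral {a..y} \<gamma>" for y
    using set_borel_integral_eq_integral(2)[OF si] by (simp add: set_lebesgue_integral_def)
  moreover have "continuous_on {a..b} (\<lambda>y. integral {a..y} \<gamma>)"
    by (rule indefinite_integral_continuous_1[OF set_borel_integral_eq_integral(1)[OF si]])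
  ultimately show ?thesis by simp
qed

lemma primitive_split:
  fixes \<gamma> :: "real \<Rightarrow> real"
  assumes \<gamma>: "integrable lborel \<gamma>" and "a \<le> x" "x \<le> y"
  shows "(LINT s|lborel. indicator {a..y} s * (\<gamma> s :: real)) =
     (LINT s|lborel. indicator {a..x} s * \<gamma> s) + (LINT s|lborel. indicator {x..y} s * \<gamma> s)"
proof -
  have i: "integrable lborel (\<lambda>s. indicator {u..v} s * \<gamma> s)" for u v
    using integrable_indicator_times[OF \<gamma>, of "{u..v}"] by simp
  have "AE s in lborel. s \<noteq> x" by (rule AE_lborel_singleton)
  then have "AE s in lborel. indicator {a..y} s * \<gamma> s = indicator {a..x} s * \<gamma> s + indicator {x..y} s * \<gamma> s"
    by eventually_elim (use assms(2,3) in \<open>auto simp: indicator_def\<close>)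
  then have "(LINT s|lborel. indicator {a..y} s * \<gamma> s) = (LINT s|lborel. indicator {a..x} s * \<gamma> s + indicator {x..y} s * \<gamma> s)"
    using borel_measurable_integrable[OF i] by (intro integral_cong_AE) auto
  then show ?thesis using i by simp
qed

lemma AE_lborel_shift:
  assumes "AE y in (lborel :: real measure). Q y"
  shows "AE y in lborel. Q (y + L)"
proof -
  have "lborel = distr lborel borel ((+) L)" by (rule lborel_distr_plus[symmetric])
  then have "AE y in distr lborel borel ((+) L). Q y" using assms by metis
  then have "AE y in lborel. Q (L + y)"
    by (intro AE_distrD[of "(+) L" lborel borel]) auto
  then show ?thesis by (simp add: add.commute)
qed

text \<open>If a primitive agrees almost everywhere with a periodic function, it is periodic itself, since it is
continuous.\<close>

lemma periodic_primitive:
  fixes u \<gamma> :: "real \<Rightarrow> real"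
  assumes \<gamma>: "integrable lborel \<gamma>" and L: "0 \<le> L"
    and per: "\<And>y. u (y + L) = u y"
    and u: "AE y in lborel. y \<in> {- M<..<M} \<longrightarrow> u y = c + (LINT s|lborel. indicator {- M..y} s * \<gamma> s)"
    and x: "- M < x" "x + L < M"
  shows "(LINT s|lborel. indicator {- M..x + L} s * \<gamma> s) = (LINT s|lborel. indicator {- M..x} s * \<gamma> s)"
proof -
  define V where "V y = (LINT s|lborel. indicator {- M..y} s * \<gamma> s)" for y
  have cV: "continuous_on {- M..M} V" unfolding V_def by (rule primitive_continuous[OF \<gamma>])
  have "V (x + L) = V x"
  proof (rule continuous_AE_eq_imp_eq[of "- M" "M - L" "\<lambda>y. V (y + L)" V])
    show "continuous_on {- M<..<M - L} (\<lambda>y. V (y + L))"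
      by (rule continuous_on_compose2[OF cV]) (use L in \<open>auto intro!: continuous_intros\<close>)
    show "continuous_on {- M<..<M - L} V"
      by (rule continuous_on_subset[OF cV]) (use L in auto)
    show "AE y in lborel. y \<in> {- M<..<M - L} \<longrightarrow> V (y + L) = V y"
      using u AE_lborel_shift[OF u, of L]
    proof eventually_elim
      case (elim y)
      then show ?case using per[of y] L by (auto simp: V_def)
    qed
  qed (use x in auto)
  then show ?thesis by (simp add: V_def)
qed

section \<open>The lower bound on one axial slice\<close>

lemma continuous_AE_nonneg_imp_nonneg:
  fixes f :: "real \<Rightarrow> real"
  assumes c: "continuous_on {a..b} f" and ab: "a < b"
    and ae: "AE y in Leb a b. 0 \<le> f y" and y: "y \<in> {a..b}"
  shows "0 \<le> f y"
proof -
  have "0 \<le> f x" if "x \<in> {a<..<b}" for x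
  proof -
    have "\<bar>f x\<bar> = f x"
    proof (rule continuous_AE_eq_imp_eq[OF _ _ _ that])
      show "continuous_on {a<..<b} (\<lambda>x. \<bar>f x\<bar>)" "continuous_on {a<..<b} f"
        by (intro continuous_intros continuous_on_subset[OF c]; auto)+
      show "AE y in lborel. y \<in> {a<..<b} \<longrightarrow> \<bar>f y\<bar> = f y"
        using ae unfolding AE_Leb by eventually_elim auto
    qed
    then show ?thesis by linarith
  qed
  then show ?thesis
    using continuous_ge_on_closure[of "{a<..<b}" f y 0] c y ab by (simp add: closure_greaterThanLessThan)
qed

lemma indicator_sub_window:
  fixes y b :: real
  shows "y \<le> b \<Longrightarrow> (\<lambda>s. indicator {a..y} s * (indicator {a..b} s * f s)) = (\<lambda>s. indicator {a..y} s * (f s :: real))"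
  by (rule ext) (auto simp: indicator_def)

text \<open>On almost every line the radial displacement, reduced by \<open>r\<close>, is a profile in the sense of the
interpolation inequalities. The formulas hold on the window \<open>(-2, 2)\<close>, which contains more than
one period, so that periodicity of the derivative can be read off from that of the function.\<close>

lemma slice_profile:
  fixes u p q :: "real \<Rightarrow> real" and r c d :: real
  assumes per: "\<And>y. u (y + 1) = u y"
    and ip: "integrable lborel (\<lambda>y. indicator {-2..2} y * p y)"
    and iq: "integrable lborel (\<lambda>y. indicator {-2..2} y * q y)"
    and iq2: "integrable (Leb (-1/2) (1/2)) (\<lambda>y. (q y)\<^sup>2)"
    and u: "AE y in lborel. y \<in> {-2<..<2} \<longrightarrow> u y = c + (LINT s|lborel. indicator {-2..y} s * p s)"
    and p: "AE y in lborel. y \<in> {-2<..<2} \<longrightarrow> p y = d + (LINT s|lborel. indicator {-2..y} s * q s)"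
    and ur: "AE y in Leb (-1/2) (1/2). r \<le> u y"
  obtains W P where
    "periodic_H2_profile (-1/2) (1/2) W P (\<lambda>y. indicator {-2..2} y * q y)"
    "AE y in Leb (-1/2) (1/2). W y = u y - r" "AE y in Leb (-1/2) (1/2). P y = p y"
proof
  let ?p = "\<lambda>y. indicator {-2..2} y * p y" and ?q = "\<lambda>y. indicator {-2..2} y * q y"
  define P where "P y = d + (LINT s|lborel. indicator {-2..y} s * ?q s)" for y
  define V where "V y = c + (LINT s|lborel. indicator {-2..y} s * ?p s)" for y
  define W where "W y = V y - r" for y
  have cP: "continuous_on {-2..2} P" unfolding P_def by (intro continuous_intros primitive_continuous iq)
  have cV: "continuous_on {-2..2} V" unfolding V_def by (intro continuous_intros primitive_continuous ip)
  have pP: "AE y in lborel. y \<in> {-2<..<2} \<longrightarrow> p y = P y"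
    using p by eventually_elim (auto simp: P_def indicator_sub_window)
  have uV: "AE y in lborel. y \<in> {-2<..<2} \<longrightarrow> u y = V y"
    using u by eventually_elim (auto simp: V_def indicator_sub_window)
  have half: "AE y in Leb (-1/2) (1/2). Q y" if "AE y in lborel. y \<in> {-2<..<2} \<longrightarrow> Q y" for Q
    using that unfolding AE_Leb by eventually_elim auto
  have siP: "set_integrable lborel {-2..y} P" if "y \<le> 2" for y
    using continuous_on_subset[OF cP, of "{-2..y}"] that by (intro borel_integrable_atLeastAtMost') auto
  have V_int: "V y = c + integral {-2..y} P" if y: "y \<le> 2" for y
  proof -
    have "AE s in lborel. s \<noteq> 2" "AE s in lborel. s \<noteq> -2" by (rule AE_lborel_singleton)+
    with pP have "AE s in lborel. indicator {-2..y} s * ?p s = indicator {-2..y} s * P s"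
      by eventually_elim (use y in \<open>auto simp: indicator_def\<close>)
    then have "(LINT s|lborel. indicator {-2..y} s * ?p s) = (LINT s|lborel. indicator {-2..y} s * P s)"
      using borel_measurable_integrable[OF integrable_indicator_times[OF ip, of "{-2..y}"]]
        borel_measurable_integrable[OF siP[OF y, unfolded set_integrable_def]]
      by (intro integral_cong_AE) auto
    then show ?thesis
      using set_borel_integral_eq_integral(2)[OF siP[OF y]] by (simp add: V_def set_lebesgue_integral_def)
  qed
  have dV2: "(V has_real_derivative P y) (at y within {-2..2})" if "y \<in> {-2..2}" for y
  proof -
    have "((\<lambda>y. c + integral {-2..y} P) has_real_derivative P y) (at y within {-2..2})"
      using integral_has_real_derivative[OF cP that] by (auto intro!: derivative_eq_intros)
    then show ?thesis
      by (rule has_field_derivative_transform_within[where d = 1]) (use that V_int in auto)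
  qed
  have dV: "(V has_real_derivative P y) (at y)" if "y \<in> {-2<..<2}" for y
    using dV2[of y] that at_within_Icc_at[of "-2" y 2] by auto
  have perV: "V (y + 1) = V y" if "y \<in> {-2<..<1}" for y
  proof -
    have "(LINT s|lborel. indicator {-2..y + 1} s * ?p s) = (LINT s|lborel. indicator {-2..y} s * ?p s)"
      by (rule periodic_primitive[OF ip _ per uV[unfolded V_def]]) (use that in auto)
    then show ?thesis by (simp add: V_def)
  qed
  have perP: "P (1/2) = P (-1/2)"
  proof -
    have "((\<lambda>y. V (y + 1) - V y) has_real_derivative P (1/2) - P (-1/2)) (at (-1/2))"
      using DERIV_shift[of V "P (1/2)" "-1/2" 1] dV[of "1/2"] dV[of "-1/2"]
      by (auto intro!: derivative_eq_intros simp: add.commute)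
    moreover have "((\<lambda>y. V (y + 1) - V y) has_real_derivative 0) (at (-1/2))"
      by (rule has_field_derivative_transform_within_open[of "\<lambda>_. 0" 0 _ "{-2<..<1}"]) (auto simp: perV)
    ultimately show ?thesis using DERIV_unique by fastforce
  qed
  show uW: "AE y in Leb (-1/2) (1/2). W y = u y - r"
    using half[OF uV] by eventually_elim (simp add: W_def)
  show "AE y in Leb (-1/2) (1/2). P y = p y"
    using half[OF pP] by eventually_elim simp
  have cW: "continuous_on {-1/2..1/2} W"
    unfolding W_def by (intro continuous_intros continuous_on_subset[OF cV]) auto
  show "periodic_H2_profile (-1/2) (1/2) W P ?q"
    unfolding periodic_H2_profile_def
  proof (intro conjI ballI)
    fix y :: real assume y: "y \<in> {-1/2..1/2}"
    show "(W has_real_derivative P y) (at y within {-1/2..1/2})"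
      unfolding W_def using has_field_derivative_subset[OF dV2[of y], of "{-1/2..1/2}"] y
      by (auto intro!: derivative_eq_intros)
    have "AE y in Leb (-1/2) (1/2). 0 \<le> W y" using uW ur by eventually_elim simp
    from continuous_AE_nonneg_imp_nonneg[OF cW _ this y] show "0 \<le> W y" by simp
    show "P y = P (-1/2) + (LINT s|lborel. indicator {-1/2..y} s * ?q s)"
      using primitive_split[OF iq, of "-2" "-1/2" y] y by (simp add: P_def)
  next
    show "continuous_on {-1/2..1/2} P" by (rule continuous_on_subset[OF cP]) auto
    show "W (-1/2) = W (1/2)" using perV[of "-1/2"] by (simp add: W_def)
    show "P (-1/2) = P (1/2)" using perP by simp
    show "integrable (Leb (-1/2) (1/2)) (\<lambda>y. (?q y)\<^sup>2)"
      using iq2 by (subst Bochner_Integration.integrable_cong[OF refl, where g = "\<lambda>y. (q y)\<^sup>2"])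
        (auto simp: space_restrict_space indicator_def)
  qed (use iq in auto)
qed

lemma periodic_slice_mean_zero:
  fixes v g :: "real \<Rightarrow> real"
  assumes per: "\<And>y. v (y + L) = v y" and L: "0 \<le> L"
    and ig: "integrable lborel (\<lambda>y. indicator {-M..M} y * g y)"
    and v: "AE y in lborel. y \<in> {-M<..<M} \<longrightarrow> v y = c + (LINT s|lborel. indicator {-M..y} s * g s)"
    and x: "- M < x" "x + L < M"
  shows "(LINT y|Leb x (x + L). g y) = 0"
proof -
  let ?g = "\<lambda>y. indicator {-M..M} y * g y"
  have v': "AE y in lborel. y \<in> {-M<..<M} \<longrightarrow> v y = c + (LINT s|lborel. indicator {-M..y} s * ?g s)"
    using v by eventually_elim (auto simp: indicator_sub_window)
  have "(LINT s|lborel. indicator {x..x + L} s * ?g s) = 0"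
    using periodic_primitive[OF ig L per v' x] primitive_split[OF ig, of "-M" x "x + L"] x L by simp
  moreover have "(\<lambda>s. indicator {x..x + L} s * ?g s) = (\<lambda>s. indicator {x..x + L} s * g s)"
    using x by (auto simp: indicator_def)
  ultimately show ?thesis by (simp add: integral_Leb)
qed

text \<open>Either the slope energy \<open>D\<close> of the slice is below \<open>lam\<close>, and then the mean of the axial strain is at
most \<open>- lam/2\<close>, or \<open>D \<ge> lam\<close> and the slice is buckled. The hypothesis on \<open>\<kappa>\<close> isolates what the
interpolation inequalities say about the cost \<open>r A + h\<^sup>2 B\<close> of a buckled slice; a slope bound is
present exactly when \<open>m\<close> is finite.\<close>

lemma slice_energy_lower_bound:
  fixes u uh p q v g :: "real \<Rightarrow> real" and r c d lam h \<kappa> :: real and m :: ereal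
  assumes pos: "0 < r" "0 < h" "0 < lam"
    and per: "\<And>y. u (y + 1) = u y" "\<And>y. v (y + 1) = v y"
    and ip: "integrable lborel (\<lambda>y. indicator {-2..2} y * p y)"
    and iq: "integrable lborel (\<lambda>y. indicator {-2..2} y * q y)"
    and ig: "integrable lborel (\<lambda>y. indicator {-2..2} y * g y)"
    and iq2: "integrable (Leb (-1/2) (1/2)) (\<lambda>y. (q y)\<^sup>2)"
    and ie2: "integrable (Leb (-1/2) (1/2)) (\<lambda>y. (g y - lam + (p y)\<^sup>2 / 2)\<^sup>2)"
    and muh: "uh \<in> borel_measurable borel" and uh: "AE y in lborel. u y = uh y"
    and u: "AE y in lborel. y \<in> {-2<..<2} \<longrightarrow> u y = c + (LINT s|lborel. indicator {-2..y} s * p s)"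
    and p: "AE y in lborel. y \<in> {-2<..<2} \<longrightarrow> p y = d + (LINT s|lborel. indicator {-2..y} s * q s)"
    and v: "AE y in lborel. y \<in> {-2<..<2} \<longrightarrow> v y = c' + (LINT s|lborel. indicator {-2..y} s * g s)"
    and ur: "AE y in Leb (-1/2) (1/2). r \<le> u y"
    and m: "AE y in Leb (-1/2) (1/2). ereal \<bar>p y\<bar> \<le> m"
    and \<kappa>: "\<And>A B D. 0 \<le> A \<Longrightarrow> 0 \<le> B \<Longrightarrow> lam \<le> D \<Longrightarrow> D ^ 5 \<le> 4 * A ^ 4 * B ^ 3 \<Longrightarrow>
       (\<And>m' \<tau>. m = ereal m' \<Longrightarrow> 0 < \<tau> \<Longrightarrow> D \<le> 2 * \<tau> * sqrt (B * A) + m'\<^sup>2 * A / \<tau>\<^sup>2) \<Longrightarrow> \<kappa> \<le> r * A + h\<^sup>2 * B"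
  shows "min (lam\<^sup>2 / 4) \<kappa> \<le> (LINT y|Leb (-1/2) (1/2). 2 * r * (uh y - r) + (g y - lam + (p y)\<^sup>2 / 2)\<^sup>2 + h\<^sup>2 * (q y)\<^sup>2)"
proof -
  let ?L = "Leb (-1/2) (1/2)" and ?q = "\<lambda>y. indicator {-2..2} y * q y"
  obtain W P where W: "periodic_H2_profile (-1/2) (1/2) W P ?q"
    and Wu: "AE y in ?L. W y = u y - r" and Pp: "AE y in ?L. P y = p y"
    using slice_profile[OF per(1) ip iq iq2 u p ur] by blast
  note pr = profile[OF W]
  have spc: "space ?L = {-1/2..1/2}" by (simp add: space_restrict_space)
  have cW: "continuous_on {-1/2..1/2} W" by (rule profile_W_continuous[OF W])
  note mW = profile_measurable[OF W]
  have win: "indicator {-1/2..1/2} y * (indicator {-2..2} y * f y) = indicator {-1/2..1/2} y * f y" for y :: real and f :: "real \<Rightarrow> real"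
    by (auto simp: indicator_def)
  have ipL: "integrable ?L p" and igL: "integrable ?L g" and iqL: "integrable ?L q"
    using integrable_Leb_lborel[OF ip, of "-1/2" "1/2"] integrable_Leb_lborel[OF ig, of "-1/2" "1/2"]
      integrable_Leb_lborel[OF iq, of "-1/2" "1/2"]
    by (simp_all only: integrable_Leb win)
  define A B D where "A = (LINT y|?L. W y)" and "B = (LINT y|?L. (q y)\<^sup>2)" and "D = (LINT y|?L. (P y)\<^sup>2)"
  have B': "B = (LINT y|?L. (?q y)\<^sup>2)"
    unfolding B_def by (rule Bochner_Integration.integral_cong) (auto simp: spc indicator_def)
  have iW: "integrable ?L W" by (rule integrable_Leb_continuous[OF cW])
  have iP2: "integrable ?L (\<lambda>y. (P y)\<^sup>2)" by (intro integrable_Leb_continuous continuous_intros pr(5))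
  have A0: "0 \<le> A" and B0: "0 \<le> B"
    using pr(3) by (auto simp: A_def B_def spc intro!: integral_nonneg_AE AE_I2)
  let ?e = "\<lambda>y. g y - lam + (p y)\<^sup>2 / 2"
  have mL: "p \<in> borel_measurable ?L" "g \<in> borel_measurable ?L" "q \<in> borel_measurable ?L"
    using ipL igL iqL by (auto dest: borel_measurable_integrable)
  have muhL: "uh \<in> borel_measurable ?L" using muh by (simp add: measurable_restrict_space1)
  have uhW: "AE y in ?L. uh y - r = W y"
    using Wu uh unfolding AE_Leb by eventually_elim auto
  have iuh: "integrable ?L (\<lambda>y. uh y - r)"
    by (rule integrable_cong_AE_imp[OF iW]) (use muhL uhW in \<open>auto elim: eventually_mono\<close>)
  have Auh: "(LINT y|?L. uh y - r) = A"
    unfolding A_def by (rule integral_cong_AE) (use muhL uhW mW in auto)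
  have N: "(LINT y|?L. 2 * r * (uh y - r) + (?e y)\<^sup>2 + h\<^sup>2 * (q y)\<^sup>2) = 2 * r * A + (LINT y|?L. (?e y)\<^sup>2) + h\<^sup>2 * B"
  proof -
    have i1: "integrable ?L (\<lambda>y. 2 * r * (uh y - r))" by (rule integrable_mult_right[OF iuh])
    have i3: "integrable ?L (\<lambda>y. h\<^sup>2 * (q y)\<^sup>2)" by (rule integrable_mult_right[OF iq2])
    have "(LINT y|?L. 2 * r * (uh y - r)) = 2 * r * A"
      unfolding Auh[symmetric] by (rule integral_mult_right_zero)
    moreover have "(LINT y|?L. h\<^sup>2 * (q y)\<^sup>2) = h\<^sup>2 * B"
      unfolding B_def by (rule integral_mult_right_zero)
    ultimately show ?thesis
      using Bochner_Integration.integral_add[OF Bochner_Integration.integrable_add[OF i1 ie2] i3]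
        Bochner_Integration.integral_add[OF i1 ie2] by linarith
  qed
  have e0: "0 \<le> (LINT y|?L. (?e y)\<^sup>2)" by simp
  show ?thesis
  proof (cases "D < lam")
    case True
    have ip2: "integrable ?L (\<lambda>y. (p y)\<^sup>2)"
      by (rule integrable_cong_AE_imp[OF iP2]) (use mL Pp in \<open>auto elim: eventually_mono\<close>)
    have pD: "(LINT y|?L. (p y)\<^sup>2) = D"
      unfolding D_def by (rule integral_cong_AE) (use mL mW Pp in \<open>auto elim: eventually_mono\<close>)
    have g0: "(LINT y|?L. g y) = 0"
      using periodic_slice_mean_zero[of v 1 2 g c' "-1/2"] per(2) ig v by simp
    have one: "integrable ?L (\<lambda>y. k)" for k :: real by (intro integrable_Leb_continuous continuous_intros)
    have "(LINT y|?L. 1 * ?e y) = (LINT y|?L. g y) - lam + D / 2"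
      using igL one[of lam] ip2 pD measure_Leb[of "-1/2" "1/2"] by simp
    also have "\<dots> \<le> - (lam / 2)" using True g0 by simp
    finally have "lam / 2 \<le> - (LINT y|?L. 1 * ?e y)" by simp
    then have "(lam / 2)\<^sup>2 \<le> (LINT y|?L. 1 * ?e y)\<^sup>2"
      using pos power_mono[of "lam / 2" "- (LINT y|?L. 1 * ?e y)" 2] by simp
    also have "\<dots> \<le> (LINT y|?L. 1\<^sup>2) * (LINT y|?L. (?e y)\<^sup>2)"
      by (rule Cauchy_Schwarz_integral) (use mL one[of 1] ie2 in auto)
    also have "(LINT y|?L. 1\<^sup>2) = (1::real)" using measure_Leb[of "-1/2" "1/2"] by simp
    finally have "lam\<^sup>2 / 4 \<le> (LINT y|?L. (?e y)\<^sup>2)" by (simp add: power_divide)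
    moreover have "0 \<le> 2 * r * A" "0 \<le> h\<^sup>2 * B" using A0 B0 pos by simp_all
    ultimately show ?thesis unfolding N by linarith
  next
    case False
    have "\<kappa> \<le> r * A + h\<^sup>2 * B"
    proof (rule \<kappa>[OF A0 B0])
      show "lam \<le> D" using False by simp
      show "D ^ 5 \<le> 4 * A ^ 4 * B ^ 3"
        using profile_interpolation[OF W] by (simp add: A_def B' D_def)
      fix m' \<tau> :: real assume m': "m = ereal m'" and \<tau>: "0 < \<tau>"
      have bd: "AE y in ?L. 0 \<le> m' - \<bar>P y\<bar>"
        using m Pp by eventually_elim (simp add: m')
      have "\<bar>P y\<bar> \<le> m'" if "y \<in> {-1/2..1/2}" for y
      proof -
        have "continuous_on {-1/2..1/2} (\<lambda>y. m' - \<bar>P y\<bar>)" by (intro continuous_intros pr(5))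
        from continuous_AE_nonneg_imp_nonneg[OF this _ bd that] show ?thesis by simp
      qed
      from profile_interpolation_bounded_slope[OF W this \<tau>]
      show "D \<le> 2 * \<tau> * sqrt (B * A) + m'\<^sup>2 * A / \<tau>\<^sup>2"
        by (simp add: A_def B' D_def)
    qed
    moreover have "0 \<le> r * A" using A0 pos by simp
    ultimately show ?thesis unfolding N using e0 by linarith
  qed
qed

section \<open>The lower bound on the cylinder\<close>

lemma periodic_extension_periodic:
  "periodic_extension f (x, y + 1) = periodic_extension f (x, y)"
  "periodic_extension f (x + 2 * pi, y) = periodic_extension f (x, y)"
proof -
  have "y + 1 + 1/2 = (y + 1/2) + of_int 1" by simp
  then have "\<lfloor>y + 1 + 1/2\<rfloor> = \<lfloor>y + 1/2\<rfloor> + 1" by (simp only: floor_add_int[symmetric])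
  then show "periodic_extension f (x, y + 1) = periodic_extension f (x, y)"
    by (simp add: periodic_extension_def)
  have "(x + 2 * pi) / (2 * pi) = x / (2 * pi) + of_int 1" by (simp add: field_simps)
  then have "\<lfloor>(x + 2 * pi) / (2 * pi)\<rfloor> = \<lfloor>x / (2 * pi)\<rfloor> + 1" by (simp only: floor_add_int[symmetric])
  then show "periodic_extension f (x + 2 * pi, y) = periodic_extension f (x, y)"
    by (simp add: periodic_extension_def algebra_simps)
qed

lemma periodic_extension_interior:
  assumes "x \<in> interior Omega" shows "periodic_extension f x = f x"
proof -
  obtain a b where x: "x = (a, b)" by (cases x)
  have ab: "0 < a" "a < 2 * pi" "-1/2 < b" "b < 1/2" using assms by (auto simp: x interior_Omega)
  have "\<lfloor>a / (2 * pi)\<rfloor> = 0" using ab by (simp add: floor_eq_iff)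
  moreover have "\<lfloor>b + 1/2\<rfloor> = 0" using ab by (simp add: floor_eq_iff)
  ultimately show ?thesis by (simp add: periodic_extension_def x)
qed

lemma basis_dirs: "e\<theta> \<in> Basis" "ez \<in> Basis"
  by (auto simp: prod_Basis)

text \<open>The derivatives are taken on the whole plane, because the slice arguments use windows longer than one
period; on \<open>Omega\<close> they agree with the ones that the energy is built from.\<close>

lemma admissible_weak_derivatives:
  assumes "\<phi> \<in> A_vKD lam rho m"
  obtains p q p\<theta> t g where
    "has_weak_pderiv UNIV ez (periodic_extension (comp_\<rho> \<phi>)) p"
    "has_weak_pderiv UNIV ez p q" "locally_L2 UNIV q"
    "locally_integrable UNIV p\<theta>" "locally_L2 UNIV p\<theta>"
    "has_weak_pderiv UNIV e\<theta> (periodic_extension (comp_\<theta> \<phi>)) t"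
    "has_weak_pderiv UNIV ez (periodic_extension (\<lambda>x. comp_z \<phi> x + lam * snd x)) g"
    "AE x in lebesgue. x \<in> Omega \<longrightarrow> pd e\<theta> (comp_\<theta> \<phi>) x = t x \<and> pd e\<theta> (comp_\<rho> \<phi>) x = p\<theta> x \<and>
       comp_\<rho> \<phi> x = periodic_extension (comp_\<rho> \<phi>) x \<and> pd ez (comp_z \<phi>) x = g x - lam \<and>
       pd ez (comp_\<rho> \<phi>) x = p x \<and> pd ez (pd ez (comp_\<rho> \<phi>)) x = q x"
proof -
  let ?F = "periodic_extension (comp_\<rho> \<phi>)" and ?T = "periodic_extension (comp_\<theta> \<phi>)"
    and ?U = "periodic_extension (\<lambda>x. comp_z \<phi> x + lam * snd x)" and ?i = "interior Omega"
  have H: "H_loc 2 UNIV ?F" "H_loc 1 UNIV ?T" "H_loc 1 UNIV ?U"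
    using assms by (auto simp: A_vKD_def H_per_def)
  have "\<exists>p. has_weak_pderiv UNIV ez ?F p \<and> H_loc 1 UNIV p"
    using H(1) basis_dirs unfolding numeral_2_eq_2 by (auto simp only: H_loc.simps One_nat_def)
  then obtain p where p: "has_weak_pderiv UNIV ez ?F p" "H_loc 1 UNIV p" by blast
  have "\<exists>p. has_weak_pderiv UNIV e\<theta> ?F p \<and> H_loc 1 UNIV p"
    using H(1) basis_dirs unfolding numeral_2_eq_2 by (auto simp only: H_loc.simps One_nat_def)
  then obtain p\<theta> where p\<theta>: "has_weak_pderiv UNIV e\<theta> ?F p\<theta>" "H_loc 1 UNIV p\<theta>" by blast
  have "\<exists>q. has_weak_pderiv UNIV ez p q \<and> locally_L2 UNIV q"
    using p(2) basis_dirs by (auto simp only: H_loc.simps One_nat_def)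
  then obtain q where q: "has_weak_pderiv UNIV ez p q" "locally_L2 UNIV q" by blast
  have "\<exists>t. has_weak_pderiv UNIV e\<theta> ?T t"
    using H(2) basis_dirs by (auto simp only: H_loc.simps One_nat_def)
  then obtain t where t: "has_weak_pderiv UNIV e\<theta> ?T t" by blast
  have "\<exists>g. has_weak_pderiv UNIV ez ?U g"
    using H(3) basis_dirs by (auto simp only: H_loc.simps One_nat_def)
  then obtain g where g: "has_weak_pderiv UNIV ez ?U g" by blast
  have wp: "has_weak_pderiv ?i ez (comp_\<rho> \<phi>) p"
    by (rule has_weak_pderiv_restrict[OF p(1)]) (simp_all add: periodic_extension_interior)
  have w\<theta>: "has_weak_pderiv ?i e\<theta> (comp_\<rho> \<phi>) p\<theta>"
    by (rule has_weak_pderiv_restrict[OF p\<theta>(1)]) (simp_all add: periodic_extension_interior)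
  have wt: "has_weak_pderiv ?i e\<theta> (comp_\<theta> \<phi>) t"
    by (rule has_weak_pderiv_restrict[OF t]) (simp_all add: periodic_extension_interior)
  have wg1: "has_weak_pderiv ?i ez (\<lambda>x. comp_z \<phi> x + lam * snd x) g"
    by (rule has_weak_pderiv_restrict[OF g]) (simp_all add: periodic_extension_interior)
  have wl: "has_weak_pderiv ?i ez (\<lambda>x. lam * snd x) (\<lambda>x. lam)"
    by (rule has_weak_pderiv_axial(1)[of "\<lambda>z. lam * z" "\<lambda>z. lam"]) (auto intro!: derivative_eq_intros)
  have wg: "has_weak_pderiv ?i ez (comp_z \<phi>) (\<lambda>x. g x - lam)"
    using has_weak_pderiv_diff[OF wg1 wl basis_dirs(2)] by simp
  have wq1: "has_weak_pderiv ?i ez p q"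
    by (rule has_weak_pderiv_restrict[OF q(1)]) simp_all
  have wq: "has_weak_pderiv ?i ez (pd ez (comp_\<rho> \<phi>)) q"
  proof (rule has_weak_pderiv_cong_AE[OF wq1 _ _ basis_dirs(2)])
    show "AE x in lebesgue. x \<in> ?i \<longrightarrow> p x = pd ez (comp_\<rho> \<phi>) x"
      using pd_AE_eq(1)[OF wp] by eventually_elim (use interior_subset in auto)
    show "locally_integrable ?i (pd ez (comp_\<rho> \<phi>))"
      using pd_AE_eq(2)[OF wp] by (simp add: has_weak_pderiv_def)
  qed
  have ae: "AE x in lebesgue. x \<in> Omega \<longrightarrow> pd e\<theta> (comp_\<theta> \<phi>) x = t x \<and> pd e\<theta> (comp_\<rho> \<phi>) x = p\<theta> x \<and>
       comp_\<rho> \<phi> x = ?F x \<and> pd ez (comp_z \<phi>) x = g x - lam \<and>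
       pd ez (comp_\<rho> \<phi>) x = p x \<and> pd ez (pd ez (comp_\<rho> \<phi>)) x = q x"
    using pd_AE_eq(1)[OF wt] pd_AE_eq(1)[OF w\<theta>] pd_AE_eq(1)[OF wg] pd_AE_eq(1)[OF wp] pd_AE_eq(1)[OF wq] AE_Omega_interior
    by eventually_elim (simp add: periodic_extension_interior)
  have "locally_integrable UNIV p\<theta>" using p\<theta>(1) by (simp add: has_weak_pderiv_def)
  moreover have "locally_L2 UNIV p\<theta>" using p\<theta>(2) by (simp only: H_loc.simps One_nat_def)
  ultimately show ?thesis using that p(1) q t g ae by blast
qed

lemma locally_L2_square_integrable:
  fixes F F' :: "real \<times> real \<Rightarrow> real"
  assumes li: "locally_L2 UNIV F"
    and F': "F' \<in> borel_measurable borel" "AE x in lebesgue. F x = F' x" and K: "compact K"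
  shows "integrable lborel (\<lambda>x. indicator K x * (F' x)\<^sup>2)"
proof -
  have i: "integrable lebesgue (\<lambda>x. indicator K x * (F x)\<^sup>2)"
    using li K by (simp add: locally_L2_def set_integrable_def)
  have m: "(\<lambda>x. indicator K x * (F' x)\<^sup>2) \<in> borel_measurable borel"
    using F'(1) K by (intro borel_measurable_times borel_measurable_indicator borel_measurable_power) (auto simp: borel_compact)
  have "integrable lebesgue (\<lambda>x. indicator K x * (F' x)\<^sup>2)"
    by (rule integrable_cong_AE_imp[OF i]) (use m F'(2) in \<open>auto simp: measurable_completion elim: eventually_mono\<close>)
  then show ?thesis using integral_lebesgue_lborel(2)[OF m] by simp
qed

lemma compact_Omega: "compact Omega"
  unfolding Omega_def by (intro compact_Times compact_Icc)

lemma indicator_Omega: "indicator Omega (x, y) = (indicator {0..2*pi} x * indicator {-1/2..1/2} y :: real)"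
  by (simp add: Omega_def indicator_times)

lemma measure_Omega: "measure lebesgue Omega = 2 * pi"
proof -
  have "Omega = cbox (0, -1/2) (2*pi, 1/2)" by (simp add: Omega_def cbox_Pair_eq)
  then have "measure lebesgue Omega = measure lborel (cbox (0::real, -1/2::real) (2*pi, 1/2))"
    by (simp add: measure_completion)
  then show ?thesis by (simp only: content_Pair) simp
qed

lemma pi_window: "2 * pi < 10"
  using pi_less_4 by simp

lemma locally_integrable_measurable:
  fixes f :: "'a::euclidean_space \<Rightarrow> real"
  assumes "locally_integrable UNIV f" shows "f \<in> borel_measurable lebesgue"
proof -
  have "integrable lebesgue (\<lambda>x. indicator (cball 0 (real n)) x * f x)" for n
    using assms by (simp add: locally_integrable_def set_integrable_def)
  then have "(\<lambda>x. indicator (cball 0 (real n)) x * f x) \<in> borel_measurable lebesgue" for n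
    by (rule borel_measurable_integrable)
  moreover have "(\<lambda>n. indicator (cball 0 (real n)) x * f x) \<longlonglongrightarrow> f x" for x
  proof -
    obtain N :: nat where N: "norm x < real N" using reals_Archimedean2 by blast
    have "\<forall>\<^sub>F n in sequentially. f x = indicator (cball 0 (real n)) x * f x"
      using eventually_ge_at_top[of N] by eventually_elim (use N in auto)
    then show ?thesis by (rule Lim_transform_eventually[OF tendsto_const])
  qed
  ultimately show ?thesis by (rule borel_measurable_LIMSEQ_real[rotated])
qed

text \<open>The hoop displacement is periodic in \<open>\<theta>\<close>, so the integral of its derivative vanishes on almost every
circle. The constant \<open>10\<close> is any window containing a full period.\<close>

lemma integral_\<theta>_derivative_zero:
  fixes t th :: "real \<times> real \<Rightarrow> real"
  assumes w: "has_weak_pderiv UNIV e\<theta> (periodic_extension f) t"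
    and th: "th \<in> borel_measurable borel" "AE x in lebesgue. t x = th x"
  shows "(LINT x|lborel. indicator Omega x * th x) = 0"
proof -
  let ?T = "periodic_extension f"
  have li: "locally_integrable UNIV ?T" "locally_integrable UNIV t" using w by (auto simp: has_weak_pderiv_def)
  have "?T \<in> borel_measurable lebesgue" by (rule locally_integrable_measurable[OF li(1)])
  then obtain Th where Th: "Th \<in> borel_measurable borel" "AE x in lebesgue. ?T x = Th x"
    using lborel_representative by blast
  let ?K = "{-10..10::real} \<times> {-1..1::real}"
  have K: "compact ?K" by (intro compact_Times compact_Icc)
  have "AE x in lborel. \<exists>c. AE y in lborel. y \<in> {-10<..<10} \<longrightarrow>
           Th (y, x) = c + (LINT s|lborel. indicator {-10..y} s * th (s, x))"
    using weak_pderiv_\<theta>_slices[OF w Th th, of 10] by simp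
  moreover have "AE x in lborel. integrable lborel (\<lambda>s. indicator ?K (s, x) * th (s, x))"
    using lborel_pair.AE_integrable_snd[of "\<lambda>s x. indicator ?K (s, x) * th (s, x)"] integrable_on_rectangle[OF li(2) th K]
    by (simp add: lborel_prod case_prod_beta')
  moreover have "AE x in lborel. AE s in lborel. ?T (s, x) = Th (s, x)"
  proof -
    have "AE x in lborel. ?T x = Th x" using Th(2) by (simp add: AE_completion_iff)
    then have "AE x in lborel. ?T (snd x, fst x) = Th (snd x, fst x)"
    proof -
      assume a: "AE x in lborel. ?T x = Th x"
      have "lborel \<Otimes>\<^sub>M lborel = distr (lborel \<Otimes>\<^sub>M lborel) (lborel \<Otimes>\<^sub>M lborel) (\<lambda>(x, y). (y, x) :: real \<times> real)"
        by (rule lborel_pair.distr_pair_swap)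
      then have "AE x in distr (lborel \<Otimes>\<^sub>M lborel) (lborel \<Otimes>\<^sub>M lborel) (\<lambda>(x, y). (y, x) :: real \<times> real). ?T x = Th x"
        using a by (metis lborel_prod)
      then have "AE x in lborel \<Otimes>\<^sub>M lborel. ?T ((\<lambda>(x, y). (y, x)) x) = Th ((\<lambda>(x, y). (y, x)) x)"
        by (rule AE_distrD[rotated]) (rule measurable_pair_swap')
      then show ?thesis unfolding lborel_prod by (simp add: case_prod_beta')
    qed
    then show ?thesis
      using lborel_pair.AE_pair[of "\<lambda>x. ?T (snd x, fst x) = Th (snd x, fst x)", unfolded lborel_prod] by simp
  qed
  ultimately have z: "AE x in lborel. x \<in> {-1<..<1} \<longrightarrow> (LINT s|Leb 0 (0 + 2 * pi). th (s, x)) = 0"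
  proof eventually_elim
    case (elim x)
    show ?case
    proof
      assume x: "x \<in> {-1<..<1}"
      then obtain c where c: "AE y in lborel. y \<in> {-10<..<10} \<longrightarrow>
           Th (y, x) = c + (LINT s|lborel. indicator {-10..y} s * th (s, x))" using elim(1) by blast
      have c': "AE y in lborel. y \<in> {-10<..<10} \<longrightarrow>
           ?T (y, x) = c + (LINT s|lborel. indicator {-10..y} s * th (s, x))"
        using c elim(3) by eventually_elim simp
      have "(\<lambda>s. indicator ?K (s, x) * th (s, x)) = (\<lambda>s. indicator {-10..10} s * th (s, x))"
        using x by (simp add: indicator_times)
      then have i: "integrable lborel (\<lambda>s. indicator {-10..10} s * th (s, x))" using elim(2) by simp
      show "(LINT s|Leb 0 (0 + 2 * pi). th (s, x)) = 0"
        by (rule periodic_slice_mean_zero[OF _ _ i c']) (use periodic_extension_periodic(2) pi_window in auto)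
    qed
  qed
  have iO: "integrable lborel (\<lambda>x. indicator Omega x * th x)"
    by (rule integrable_on_rectangle[OF li(2) th compact_Omega])
  have "(LINT x|lborel. indicator Omega x * th x) = (LINT y|lborel. LINT s|lborel. indicator Omega (s, y) * th (s, y))"
    using lborel_pair.integral_snd[of "\<lambda>s y. indicator Omega (s, y) * th (s, y)"] iO
    by (simp add: lborel_prod case_prod_beta')
  also have "\<dots> = (LINT y|(lborel :: real measure). (0 :: real))"
  proof (rule integral_cong_AE)
    show "(\<lambda>y. LINT s|lborel. indicator Omega (s, y) * th (s, y)) \<in> borel_measurable lborel"
      using lborel_pair.integrable_snd[of "\<lambda>s y. indicator Omega (s, y) * th (s, y)"] iO
      by (auto simp: lborel_prod case_prod_beta' dest: borel_measurable_integrable)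
    show "AE y in lborel. (LINT s|lborel. indicator Omega (s, y) * th (s, y)) = 0"
      using z
    proof eventually_elim
      case (elim y)
      have "(LINT s|lborel. indicator Omega (s, y) * th (s, y)) = indicator {-1/2..1/2} y * (LINT s|Leb 0 (0 + 2 * pi). th (s, y))"
        unfolding integral_Leb indicator_Omega integral_mult_right_zero[symmetric] by (simp add: mult_ac)
      then show ?case using elim by (auto simp: indicator_def)
    qed
  qed simp
  finally show ?thesis by simp
qed

lemma norm_matrix2:
  "(norm (vector [vector [a, b], vector [c, d]] :: real^2^2))\<^sup>2 = a\<^sup>2 + b\<^sup>2 + c\<^sup>2 + d\<^sup>2"
proof -
  have "(norm (vector [vector [a, b], vector [c, d]] :: real^2^2))\<^sup>2 =
      (\<Sum>i\<in>UNIV. (norm ((vector [vector [a, b], vector [c, d]] :: real^2^2) $ i))\<^sup>2)"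
    by (simp add: norm_vec_def L2_set_def sum_nonneg)
  also have "\<dots> = a\<^sup>2 + b\<^sup>2 + c\<^sup>2 + d\<^sup>2"
    by (simp add: sum_2 norm_vec_def L2_set_def)
  finally show ?thesis .
qed

text \<open>The square of the hoop strain is bounded below by its tangent at the bulk value \<open>r\<close>. In the
integral of the tangent the derivative of \<open>\<phi>\<^sub>\<theta>\<close> disappears, the square of the circumferential slope
is dropped, and \<open>2 r w\<close> remains; the rest is the integral over \<open>\<theta>\<close> of the slice estimate.\<close>

lemma energy_lower_bound:
  fixes h lam rho \<kappa> :: real
  assumes \<phi>: "\<phi> \<in> A_vKD lam rho m" and pos: "0 < h" "0 < lam" "1 < rho"
    and \<kappa>: "\<And>A B D. 0 \<le> A \<Longrightarrow> 0 \<le> B \<Longrightarrow> lam \<le> D \<Longrightarrow> D ^ 5 \<le> 4 * A ^ 4 * B ^ 3 \<Longrightarrow>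
       (\<And>m' \<tau>. m = ereal m' \<Longrightarrow> 0 < \<tau> \<Longrightarrow> D \<le> 2 * \<tau> * sqrt (B * A) + m'\<^sup>2 * A / \<tau>\<^sup>2) \<Longrightarrow>
       \<kappa> \<le> (rho - 1) * A + h\<^sup>2 * B"
  shows "ereal (E_bulk rho + 2 * pi * min (lam\<^sup>2 / 4) \<kappa>) \<le> E_vKD h \<phi>"
proof (cases "E_vKD h \<phi> = \<infinity>")
  case finite: False
  define r where "r = rho - 1"
  have r: "0 < r" using pos by (simp add: r_def)
  obtain p q p\<theta> t g where
    wp: "has_weak_pderiv UNIV ez (periodic_extension (comp_\<rho> \<phi>)) p" and
    wq: "has_weak_pderiv UNIV ez p q" and qL2: "locally_L2 UNIV q" and
    p\<theta>: "locally_integrable UNIV p\<theta>" "locally_L2 UNIV p\<theta>" and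
    wt: "has_weak_pderiv UNIV e\<theta> (periodic_extension (comp_\<theta> \<phi>)) t" and
    wg: "has_weak_pderiv UNIV ez (periodic_extension (\<lambda>x. comp_z \<phi> x + lam * snd x)) g" and
    ae: "AE x in lebesgue. x \<in> Omega \<longrightarrow> pd e\<theta> (comp_\<theta> \<phi>) x = t x \<and> pd e\<theta> (comp_\<rho> \<phi>) x = p\<theta> x \<and>
       comp_\<rho> \<phi> x = periodic_extension (comp_\<rho> \<phi>) x \<and> pd ez (comp_z \<phi>) x = g x - lam \<and>
       pd ez (comp_\<rho> \<phi>) x = p x \<and> pd ez (pd ez (comp_\<rho> \<phi>)) x = q x"
    by (rule admissible_weak_derivatives[OF \<phi>])
  let ?F = "periodic_extension (comp_\<rho> \<phi>)" and ?U = "periodic_extension (\<lambda>x. comp_z \<phi> x + lam * snd x)"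
  have li: "locally_integrable UNIV ?F" "locally_integrable UNIV p" "locally_integrable UNIV q"
    "locally_integrable UNIV t" "locally_integrable UNIV ?U" "locally_integrable UNIV g"
    using wp wq wt wg by (auto simp: has_weak_pderiv_def)
  note rep = lborel_representative[OF locally_integrable_measurable]
  obtain Fh where Fh: "Fh \<in> borel_measurable borel" "AE x in lebesgue. ?F x = Fh x" using rep[OF li(1)] by blast
  obtain ph where ph: "ph \<in> borel_measurable borel" "AE x in lebesgue. p x = ph x" using rep[OF li(2)] by blast
  obtain qh where qh: "qh \<in> borel_measurable borel" "AE x in lebesgue. q x = qh x" using rep[OF li(3)] by blast
  obtain th where th: "th \<in> borel_measurable borel" "AE x in lebesgue. t x = th x" using rep[OF li(4)] by blast
  obtain Uh where Uh: "Uh \<in> borel_measurable borel" "AE x in lebesgue. ?U x = Uh x" using rep[OF li(5)] by blast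
  obtain gh where gh: "gh \<in> borel_measurable borel" "AE x in lebesgue. g x = gh x" using rep[OF li(6)] by blast
  obtain sh where sh: "sh \<in> borel_measurable borel" "AE x in lebesgue. p\<theta> x = sh x" using rep[OF p\<theta>(1)] by blast
  note [measurable] = Fh(1) ph(1) qh(1) th(1) Uh(1) gh(1) sh(1)
  let ?\<Omega> = "indicator Omega :: real \<times> real \<Rightarrow> real"
  define a1 where "a1 x = th x + (sh x)\<^sup>2 / 2 + Fh x" for x
  define a2 where "a2 x = gh x - lam + (ph x)\<^sup>2 / 2" for x
  have ma[measurable]: "a1 \<in> borel_measurable borel" "a2 \<in> borel_measurable borel"
    unfolding a1_def a2_def by measurable
  define G where "G x = ?\<Omega> x * ((a1 x)\<^sup>2 + (a2 x)\<^sup>2 + h\<^sup>2 * (qh x)\<^sup>2)" for x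
  have mO[measurable]: "?\<Omega> \<in> borel_measurable borel" by (rule borel_measurable_indicator) simp
  have mG: "G \<in> borel_measurable borel" unfolding G_def by measurable
  have G0: "0 \<le> G x" for x by (auto simp: G_def)
  have GE: "enn2ereal (\<integral>\<^sup>+ x. ennreal (G x) \<partial>lborel) \<le> E_vKD h \<phi>"
  proof -
    have "(\<integral>\<^sup>+ x. ennreal (G x) \<partial>lborel) = (\<integral>\<^sup>+ x. ennreal (G x) \<partial>lebesgue)"
      using mG by (subst nn_integral_completion) auto
    also have "\<dots> \<le> (\<integral>\<^sup>+ x. ennreal ((norm (strain \<phi> x))\<^sup>2 + h\<^sup>2 * (norm (hessian (comp_\<rho> \<phi>) x))\<^sup>2) * indicator Omega x \<partial>lebesgue)"
    proof (rule nn_integral_mono_AE)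
      show "AE x in lebesgue. ennreal (G x) \<le> ennreal ((norm (strain \<phi> x))\<^sup>2 + h\<^sup>2 * (norm (hessian (comp_\<rho> \<phi>) x))\<^sup>2) * indicator Omega x"
        using ae Fh(2) ph(2) qh(2) th(2) gh(2) sh(2)
      proof eventually_elim
        case (elim x)
        show ?case
        proof (cases "x \<in> Omega")
          case True
          have "(a1 x)\<^sup>2 + (a2 x)\<^sup>2 \<le> (norm (strain \<phi> x))\<^sup>2"
            using elim True by (simp add: strain_def Let_def norm_matrix2 a1_def a2_def)
          moreover have "(qh x)\<^sup>2 \<le> (norm (hessian (comp_\<rho> \<phi>) x))\<^sup>2"
            using elim True by (simp add: hessian_def norm_matrix2)
          then have "h\<^sup>2 * (qh x)\<^sup>2 \<le> h\<^sup>2 * (norm (hessian (comp_\<rho> \<phi>) x))\<^sup>2" by (rule mult_left_mono) simp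
          ultimately have "(a1 x)\<^sup>2 + (a2 x)\<^sup>2 + h\<^sup>2 * (qh x)\<^sup>2 \<le>
            (norm (strain \<phi> x))\<^sup>2 + h\<^sup>2 * (norm (hessian (comp_\<rho> \<phi>) x))\<^sup>2" by (rule add_mono)
          moreover have "G x = (a1 x)\<^sup>2 + (a2 x)\<^sup>2 + h\<^sup>2 * (qh x)\<^sup>2" using True by (simp add: G_def)
          ultimately have "ennreal (G x) \<le> ennreal ((norm (strain \<phi> x))\<^sup>2 + h\<^sup>2 * (norm (hessian (comp_\<rho> \<phi>) x))\<^sup>2)"
            by (simp only: ennreal_leI)
          then show ?thesis using True by (simp only: indicator_simps mult_1_right)
        qed (simp add: G_def)
      qed
    qed
    also have "\<dots> = (\<integral>\<^sup>+ x. ennreal ((norm (strain \<phi> x))\<^sup>2 + h\<^sup>2 * (norm (hessian (comp_\<rho> \<phi>) x))\<^sup>2) \<partial>lebesgue_on Omega)"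
      by (subst nn_integral_restrict_space) auto
    finally show ?thesis unfolding E_vKD_def by (simp add: less_eq_ennreal.rep_eq)
  qed
  then have "(\<integral>\<^sup>+ x. ennreal (G x) \<partial>lborel) < \<infinity>" using finite by (auto simp: less_top[symmetric])
  then have iG: "integrable lborel G" using mG G0 by (intro integrableI_nonneg) auto
  have "(\<integral>\<^sup>+ x. ennreal (G x) \<partial>lborel) = ennreal (LINT x|lborel. G x)"
    by (rule nn_integral_eq_integral[OF iG]) (simp add: G0)
  then have E: "ereal (LINT x|lborel. G x) \<le> E_vKD h \<phi>"
    using GE by (simp add: G0)
  \<comment> \<open>Linearising the square of the hoop strain at its bulk value leaves an excess density whose
    slices in the axial direction can be bounded one at a time.\<close>
  define N where "N x = ?\<Omega> x * (2 * r * (Fh x - r) + (a2 x)\<^sup>2 + h\<^sup>2 * (qh x)\<^sup>2)" for x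
  have Gbound: "norm (?\<Omega> x * f x) \<le> norm (G x)" if "0 \<le> f x" "f x \<le> (a1 x)\<^sup>2 + (a2 x)\<^sup>2 + h\<^sup>2 * (qh x)\<^sup>2" for f x
    using that by (auto simp: G_def indicator_def)
  have ia2: "integrable lborel (\<lambda>x. ?\<Omega> x * (a2 x)\<^sup>2)"
  proof (rule Bochner_Integration.integrable_bound[OF iG])
    show "AE x in lborel. norm (?\<Omega> x * (a2 x)\<^sup>2) \<le> norm (G x)"
    proof (rule AE_I2)
      fix x show "norm (?\<Omega> x * (a2 x)\<^sup>2) \<le> norm (G x)" by (rule Gbound) simp_all
    qed
  qed measurable
  have iq2: "integrable lborel (\<lambda>x. ?\<Omega> x * (qh x)\<^sup>2)"
    by (rule locally_L2_square_integrable[OF qL2 qh compact_Omega])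
  have is2: "integrable lborel (\<lambda>x. ?\<Omega> x * (sh x)\<^sup>2)"
    by (rule locally_L2_square_integrable[OF p\<theta>(2) sh compact_Omega])
  have iF: "integrable lborel (\<lambda>x. ?\<Omega> x * Fh x)" by (rule integrable_on_rectangle[OF li(1) Fh compact_Omega])
  have it: "integrable lborel (\<lambda>x. ?\<Omega> x * th x)" by (rule integrable_on_rectangle[OF li(4) th compact_Omega])
  have i1: "integrable lborel ?\<Omega>"
    using emeasure_bounded_finite[OF compact_imp_bounded[OF compact_Omega]]
    by (intro integrable_real_indicator) (auto simp: less_top)
  have N_eq: "N x = 2 * r * (?\<Omega> x * Fh x) - 2 * r\<^sup>2 * ?\<Omega> x + ?\<Omega> x * (a2 x)\<^sup>2 + h\<^sup>2 * (?\<Omega> x * (qh x)\<^sup>2)" for x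
    by (simp add: N_def algebra_simps power2_eq_square)
  have iN: "integrable lborel N"
    unfolding N_eq[abs_def] using iF i1 ia2 iq2 by auto
  have mOm: "(LINT x|lborel. ?\<Omega> x) = 2 * pi"
    using measure_Omega by (simp add: measure_completion)
  have "(LINT x|lborel. 2 * r * (?\<Omega> x * th x) + r\<^sup>2 * ?\<Omega> x + N x) \<le> (LINT x|lborel. G x)"
  proof (rule integral_mono[OF _ iG])
    show "integrable lborel (\<lambda>x. 2 * r * (?\<Omega> x * th x) + r\<^sup>2 * ?\<Omega> x + N x)"
      using it i1 iN by auto
    fix x
    have "2 * r * a1 x - r\<^sup>2 \<le> (a1 x)\<^sup>2"
      using zero_le_power2[of "a1 x - r"] by (simp add: power2_eq_square algebra_simps)
    moreover have "2 * r * (th x + Fh x) \<le> 2 * r * a1 x"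
      using r by (intro mult_left_mono) (auto simp: a1_def)
    moreover have "2 * r * (th x + Fh x) = 2 * r * th x + 2 * r * (Fh x - r) + 2 * r\<^sup>2"
      by (simp add: algebra_simps power2_eq_square)
    ultimately have "2 * r * th x + r\<^sup>2 + 2 * r * (Fh x - r) \<le> (a1 x)\<^sup>2" by linarith
    then show "2 * r * (?\<Omega> x * th x) + r\<^sup>2 * ?\<Omega> x + N x \<le> G x"
      by (cases "x \<in> Omega") (simp_all add: N_def G_def)
  qed
  then have GN: "2 * pi * r\<^sup>2 + (LINT x|lborel. N x) \<le> (LINT x|lborel. G x)"
    using it i1 iN integral_\<theta>_derivative_zero[OF wt th] mOm by (simp add: mult.commute)
  let ?K = "{-10..10::real} \<times> {-2..2::real}"
  have K: "compact ?K" by (intro compact_Times compact_Icc)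
  have slices: "AE x in lborel. integrable lborel (\<lambda>y. f (x, y))" if "integrable lborel f" for f :: "real \<times> real \<Rightarrow> real"
    using lborel_pair.AE_integrable_fst'[of f] that by (simp add: lborel_prod)
  have AEs: "AE x in lborel. AE y in lborel. Q (x, y)" if "AE x in lebesgue. Q x" for Q :: "real \<times> real \<Rightarrow> bool"
    using that lborel_pair.AE_pair[of Q] unfolding AE_completion_iff by (simp only: lborel_prod)
  have rho_ge: "AE x in lebesgue. x \<in> Omega \<longrightarrow> rho - 1 \<le> comp_\<rho> \<phi> x"
    using \<phi> by (auto simp: A_vKD_def AE_restrict_space_iff)
  have slope: "AE x in lebesgue. x \<in> Omega \<longrightarrow> ereal \<bar>pd ez (comp_\<rho> \<phi>) x\<bar> \<le> m"
  proof -
    have "Linf_norm (pd ez (comp_\<rho> \<phi>)) \<le> m" using \<phi> by (auto simp: A_vKD_def)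
    then have "AE x in lebesgue_on Omega. ereal \<bar>pd ez (comp_\<rho> \<phi>) x\<bar> \<le> m"
      using esssup_AE[of "\<lambda>x. ereal \<bar>pd ez (comp_\<rho> \<phi>) x\<bar>" "lebesgue_on Omega"]
      unfolding Linf_norm_def by (auto elim!: eventually_mono)
    then show ?thesis by (simp add: AE_restrict_space_iff)
  qed
  have pointwise: "AE x in lebesgue. (x \<in> Omega \<longrightarrow> r \<le> ?F x \<and> ereal \<bar>ph x\<bar> \<le> m) \<and> ?F x = Fh x"
    using ae rho_ge slope Fh(2) ph(2) by eventually_elim (auto simp: r_def)
  have "AE x in lborel. x \<in> {0..2*pi} \<longrightarrow> min (lam\<^sup>2 / 4) \<kappa> \<le> (LINT y|lborel. N (x, y))"
    using AEs[OF pointwise] AEs[OF Uh(2)]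
      slices[OF integrable_on_rectangle[OF li(2) ph K]] slices[OF integrable_on_rectangle[OF li(3) qh K]]
      slices[OF integrable_on_rectangle[OF li(6) gh K]] slices[OF ia2] slices[OF iq2]
      weak_pderiv_z_slices[OF wp Fh ph, of 2, simplified] weak_pderiv_z_slices[OF wq ph qh, of 2, simplified]
      weak_pderiv_z_slices[OF wg Uh gh, of 2, simplified]
  proof eventually_elim
    case (elim x)
    show ?case
    proof
      assume x: "x \<in> {0..2*pi}"
      then have x10: "x \<in> {-10..10}" using pi_window by auto
      have win: "(\<lambda>y. indicator ?K (x, y) * f y) = (\<lambda>y. indicator {-2..2} y * f y)" for f :: "real \<Rightarrow> real"
        using x10 by (simp add: indicator_times)
      have Om: "?\<Omega> (x, y) = indicator {-1/2..1/2} y" for y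
        using x by (simp add: indicator_Omega)
      obtain c where c: "AE y in lborel. y \<in> {-2<..<2} \<longrightarrow> Fh (x, y) = c + (LINT s|lborel. indicator {-2..y} s * ph (x, s))"
        using elim(8) by auto
      obtain d where d: "AE y in lborel. y \<in> {-2<..<2} \<longrightarrow> ph (x, y) = d + (LINT s|lborel. indicator {-2..y} s * qh (x, s))"
        using elim(9) by auto
      obtain c' where c': "AE y in lborel. y \<in> {-2<..<2} \<longrightarrow> Uh (x, y) = c' + (LINT s|lborel. indicator {-2..y} s * gh (x, s))"
        using elim(10) by auto
      have "min (lam\<^sup>2 / 4) \<kappa> \<le> (LINT y|Leb (-1/2) (1/2). 2 * r * (Fh (x, y) - r)
           + (gh (x, y) - lam + (ph (x, y))\<^sup>2 / 2)\<^sup>2 + h\<^sup>2 * (qh (x, y))\<^sup>2)"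
      proof (rule slice_energy_lower_bound[where u = "\<lambda>y. ?F (x, y)" and v = "\<lambda>y. ?U (x, y)" and m = m
            and c = c and d = d and c' = c'])
        show "integrable lborel (\<lambda>y. indicator {-2..2} y * ph (x, y))" using elim(3) by (simp only: win)
        show "integrable lborel (\<lambda>y. indicator {-2..2} y * qh (x, y))" using elim(4) by (simp only: win)
        show "integrable lborel (\<lambda>y. indicator {-2..2} y * gh (x, y))" using elim(5) by (simp only: win)
        show "integrable (Leb (-1/2) (1/2)) (\<lambda>y. (qh (x, y))\<^sup>2)"
          using elim(7) by (simp only: integrable_Leb Om)
        show "integrable (Leb (-1/2) (1/2)) (\<lambda>y. (gh (x, y) - lam + (ph (x, y))\<^sup>2 / 2)\<^sup>2)"
          using elim(6) by (simp only: integrable_Leb Om a2_def)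
        show "(\<lambda>y. Fh (x, y)) \<in> borel_measurable borel" by measurable
        show "AE y in lborel. ?F (x, y) = Fh (x, y)" using elim(1) by eventually_elim simp
        show "AE y in lborel. y \<in> {-2<..<2} \<longrightarrow> ?F (x, y) = c + (LINT s|lborel. indicator {-2..y} s * ph (x, s))"
          using c elim(1) by eventually_elim simp
        show "AE y in lborel. y \<in> {-2<..<2} \<longrightarrow> ?U (x, y) = c' + (LINT s|lborel. indicator {-2..y} s * gh (x, s))"
          using c' elim(2) by eventually_elim simp
        show "AE y in Leb (-1/2) (1/2). r \<le> ?F (x, y)" "AE y in Leb (-1/2) (1/2). ereal \<bar>ph (x, y)\<bar> \<le> m"
          unfolding AE_Leb using elim(1) by (eventually_elim, use x in \<open>auto simp: Omega_def\<close>)+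
        show "\<And>A B D. 0 \<le> A \<Longrightarrow> 0 \<le> B \<Longrightarrow> lam \<le> D \<Longrightarrow> D ^ 5 \<le> 4 * A ^ 4 * B ^ 3 \<Longrightarrow>
          (\<And>m' \<tau>. m = ereal m' \<Longrightarrow> 0 < \<tau> \<Longrightarrow> D \<le> 2 * \<tau> * sqrt (B * A) + m'\<^sup>2 * A / \<tau>\<^sup>2) \<Longrightarrow> \<kappa> \<le> r * A + h\<^sup>2 * B"
          unfolding r_def by (rule \<kappa>)
      qed (use r pos d periodic_extension_periodic(1) in auto)
      also have "\<dots> = (LINT y|lborel. N (x, y))"
        unfolding integral_Leb N_def Om a2_def by simp
      finally show "min (lam\<^sup>2 / 4) \<kappa> \<le> (LINT y|lborel. N (x, y))" .
    qed
  qed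
  then have "AE x in lborel. indicator {0..2*pi} x * min (lam\<^sup>2 / 4) \<kappa> \<le> (LINT y|lborel. N (x, y))"
  proof eventually_elim
    case (elim x)
    then show ?case
      by (cases "x \<in> {0..2*pi}") (simp_all add: N_def indicator_Omega)
  qed
  then have "(LINT x|lborel. indicator {0..2*pi} x * min (lam\<^sup>2 / 4) \<kappa>) \<le> (LINT x|lborel. LINT y|lborel. N (x, y))"
    using lborel_pair.integrable_fst'[of N] iN
    by (intro integral_mono_AE) (auto simp: lborel_prod emeasure_lborel_Icc_eq intro!: integrable_mult_left integrable_real_indicator)
  also have "\<dots> = (LINT x|lborel. N x)"
    using lborel_pair.integral_fst'[of N] iN by (simp add: lborel_prod)
  finally have "2 * pi * min (lam\<^sup>2 / 4) \<kappa> \<le> (LINT x|lborel. N x)" by simp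
  with GN have "E_bulk rho + 2 * pi * min (lam\<^sup>2 / 4) \<kappa> \<le> (LINT x|lborel. G x)"
    by (simp add: E_bulk_def measure_Omega r_def)
  then show ?thesis using E by (meson ereal_less_eq(3) order_trans)
qed simp

section \<open>Axisymmetric displacements\<close>

lemma continuous_imp_locally_L2:
  fixes f :: "'a::euclidean_space \<Rightarrow> real"
  assumes "continuous_on UNIV f" shows "locally_L2 U f"
  unfolding locally_L2_def
proof (intro allI impI conjI)
  fix K assume K: "compact K \<and> K \<subseteq> U"
  have "set_integrable lebesgue K f"
    using continuous_imp_locally_integrable[OF assms, of UNIV] K by (simp add: locally_integrable_def)
  then show "set_borel_measurable lebesgue K f"
    by (auto simp: set_integrable_def set_borel_measurable_def dest: borel_measurable_integrable)
  have "continuous_on UNIV (\<lambda>x. (f x)\<^sup>2)" by (intro continuous_intros assms)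
  then show "set_integrable lebesgue K (\<lambda>x. (f x)\<^sup>2)"
    using continuous_imp_locally_integrable[of "\<lambda>x. (f x)\<^sup>2" UNIV] K by (simp add: locally_integrable_def)
qed

lemma continuous_on_axial:
  "continuous_on UNIV f \<Longrightarrow> continuous_on UNIV (\<lambda>x :: real \<times> real. (f :: real \<Rightarrow> real) (snd x))"
  by (rule continuous_on_compose2[of UNIV f]) (auto intro!: continuous_intros)

lemma DERIV_imp_continuous_on:
  "(\<And>z. (f has_real_derivative f' z) (at z)) \<Longrightarrow> continuous_on UNIV f"
  by (meson DERIV_isCont continuous_at_imp_continuous_on)

lemma H_loc_1_axial:
  assumes f: "\<And>z. (f has_real_derivative f' z) (at z)" and f': "continuous_on UNIV f'"
  shows "H_loc (Suc 0) UNIV (\<lambda>x :: real \<times> real. f (snd x))"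
proof -
  have "locally_L2 UNIV (\<lambda>x::real \<times> real. f (snd x))" "locally_L2 UNIV (\<lambda>x::real \<times> real. f' (snd x))"
    by (intro continuous_imp_locally_L2 continuous_on_axial f' DERIV_imp_continuous_on[OF f])+
  moreover have "locally_L2 UNIV (\<lambda>x::real \<times> real. 0)" by (intro continuous_imp_locally_L2 continuous_intros)
  ultimately show ?thesis
    using has_weak_pderiv_axial[OF f f', of UNIV] by (auto simp: prod_Basis)
qed

lemma H_loc_2_axial:
  assumes f: "\<And>z. (f has_real_derivative f' z) (at z)" "\<And>z. (f' has_real_derivative f'' z) (at z)"
    and f'': "continuous_on UNIV f''"
  shows "H_loc (Suc (Suc 0)) UNIV (\<lambda>x :: real \<times> real. f (snd x))"
proof -
  have c: "continuous_on UNIV f'" by (rule DERIV_imp_continuous_on[OF f(2)])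
  have "locally_L2 UNIV (\<lambda>x::real \<times> real. f (snd x))"
    by (intro continuous_imp_locally_L2 continuous_on_axial DERIV_imp_continuous_on[OF f(1)])
  moreover have "H_loc (Suc 0) UNIV (\<lambda>x :: real \<times> real. f' (snd x))" by (rule H_loc_1_axial[OF f(2) f''])
  moreover have "H_loc (Suc 0) UNIV (\<lambda>x::real \<times> real. 0)"
    using H_loc_1_axial[of "\<lambda>_. 0" "\<lambda>_. 0"] by simp
  ultimately show ?thesis
    using has_weak_pderiv_axial[OF f(1) c, of UNIV]
    by (subst H_loc.simps) (auto simp: prod_Basis simp del: H_loc.simps)
qed

lemma periodic_of_int:
  fixes f :: "real \<Rightarrow> 'a"
  assumes per: "\<And>z. f (z + 1) = f z"
  shows "f (z - of_int k) = f z"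
proof (induction k arbitrary: z rule: int_induct[of _ 0])
  case (step1 i)
  then show ?case using per[of "z - of_int (i + 1)"] by (simp add: algebra_simps)
next
  case (step2 i)
  then show ?case using per[of "z - of_int i"] by (simp add: algebra_simps)
qed simp

lemma periodic_extension_axial:
  assumes "\<And>z. f (z + 1) = f z"
  shows "periodic_extension (\<lambda>x. f (snd x)) = (\<lambda>x. f (snd x))"
  using periodic_of_int[of f, OF assms] by (auto simp: periodic_extension_def)

lemma Linf_norm_le:
  assumes ae: "AE x in lebesgue. x \<in> Omega \<longrightarrow> f x = g x" and g: "g \<in> borel_measurable borel"
    and le: "\<And>x. ereal \<bar>g x\<bar> \<le> m"
  shows "Linf_norm f \<le> m"
  unfolding Linf_norm_def
proof (rule esssup_I)
  let ?f = "\<lambda>x. if x \<in> Omega then f x else g x"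
  have "?f \<in> borel_measurable lebesgue"
  proof (rule borel_measurable_AE)
    show "g \<in> borel_measurable lebesgue" using g by (simp add: measurable_completion)
    show "AE x in lebesgue. g x = ?f x" using ae by eventually_elim auto
  qed
  then have "?f \<in> borel_measurable (lebesgue_on Omega)" by (rule measurable_restrict_space1)
  then have "f \<in> borel_measurable (lebesgue_on Omega)"
    by (rule measurable_cong[THEN iffD1, rotated]) (auto simp: space_restrict_space)
  then show "(\<lambda>x. ereal \<bar>f x\<bar>) \<in> borel_measurable (lebesgue_on Omega)" by measurable
  have "AE x in lebesgue. x \<in> Omega \<longrightarrow> ereal \<bar>f x\<bar> \<le> m"
    using ae by eventually_elim (use le in auto)
  then show "AE x in lebesgue_on Omega. ereal \<bar>f x\<bar> \<le> m"
    by (simp add: AE_restrict_space_iff)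
qed

text \<open>The hypothesis holds only almost everywhere so that the lemma can be iterated: it applies again to the
weak derivative that it has just identified.\<close>

lemma pd_axial:
  assumes f: "\<And>z. (f has_real_derivative f' z) (at z)" and f': "continuous_on UNIV f'"
    and h: "AE x in lebesgue. x \<in> Omega \<longrightarrow> F x = f (snd x)"
    and li: "locally_integrable (interior Omega) F"
  shows "AE x in lebesgue. x \<in> Omega \<longrightarrow> pd ez F x = f' (snd x)"
    and "AE x in lebesgue. x \<in> Omega \<longrightarrow> pd e\<theta> F x = 0"
    and "locally_integrable (interior Omega) (pd ez F)"
    and "locally_integrable (interior Omega) (pd e\<theta> F)"
proof -
  have ae: "AE x in lebesgue. x \<in> interior Omega \<longrightarrow> f (snd x) = F x"
    using h by eventually_elim (use interior_subset in auto)
  note w = has_weak_pderiv_cong_AE[OF has_weak_pderiv_axial(1)[OF f f'] ae li basis_dirs(2)]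
    has_weak_pderiv_cong_AE[OF has_weak_pderiv_axial(2)[OF f f'] ae li basis_dirs(1)]
  show "AE x in lebesgue. x \<in> Omega \<longrightarrow> pd ez F x = f' (snd x)"
    and "AE x in lebesgue. x \<in> Omega \<longrightarrow> pd e\<theta> F x = 0"
    by (rule pd_AE_eq(1)[OF w(1)], rule pd_AE_eq(1)[OF w(2)])
  show "locally_integrable (interior Omega) (pd ez F)" "locally_integrable (interior Omega) (pd e\<theta> F)"
    using pd_AE_eq(2)[OF w(1)] pd_AE_eq(2)[OF w(2)] by (simp_all add: has_weak_pderiv_def)
qed

text \<open>The competitor is \<open>\<phi> = (r + w, 0, V - lam z)\<close>. All shear terms and all \<open>\<theta>\<close>-derivatives vanish, and
the hoop strain is \<open>r + w\<close>; the profile \<open>V\<close> is kept general because the unbuckled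
configuration does not make the axial strain vanish.\<close>

lemma axisymmetric_upper_bound:
  fixes w w' w'' V V' :: "real \<Rightarrow> real" and h lam rho X :: real
  assumes w: "\<And>z. (w has_real_derivative w' z) (at z)" "\<And>z. (w' has_real_derivative w'' z) (at z)"
      "continuous_on UNIV w''" "\<And>z. w (z + 1) = w z" "\<And>z. 0 \<le> w z"
    and V: "\<And>z. (V has_real_derivative V' z) (at z)" "continuous_on UNIV V'" "\<And>z. V (z + 1) = V z"
    and m: "\<And>z. ereal \<bar>w' z\<bar> \<le> m" "\<And>z. ereal \<bar>V' z - lam\<bar> \<le> m"
    and X: "(LINT z|Leb (-1/2) (1/2). 2 * (rho - 1) * w z + (w z)\<^sup>2 + (V' z - lam + (w' z)\<^sup>2 / 2)\<^sup>2
       + h\<^sup>2 * (w'' z)\<^sup>2) \<le> X"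
  shows "excess_energy h lam rho m \<le> ereal (2 * pi * X)"
proof -
  define r where "r = rho - 1"
  define \<phi> :: displacement where "\<phi> x = (r + w (snd x), 0, V (snd x) - lam * snd x)" for x
  have comps: "comp_\<rho> \<phi> = (\<lambda>x. r + w (snd x))" "comp_\<theta> \<phi> = (\<lambda>x. 0)"
    "comp_z \<phi> = (\<lambda>x. V (snd x) - lam * snd x)"
    by (auto simp: comp_\<rho>_def comp_\<theta>_def comp_z_def \<phi>_def)
  have m0: "0 \<le> m" using m(1)[of 0] by (metis abs_ge_zero ereal_less_eq(5) order_trans)
  have cw: "continuous_on UNIV w" "continuous_on UNIV w'" using w(1,2) by (auto intro: DERIV_imp_continuous_on)

  have d\<rho>: "((\<lambda>z. r + w z) has_real_derivative w' z) (at z)" for z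
    using w(1) by (auto intro!: derivative_eq_intros)
  have dz: "((\<lambda>z. V z - lam * z) has_real_derivative V' z - lam) (at z)" for z
    using V(1) by (auto intro!: derivative_eq_intros)
  have d0: "((\<lambda>z. 0) has_real_derivative 0) (at z)" for z :: real by simp
  have cz: "continuous_on UNIV (\<lambda>z. V' z - lam)" by (intro continuous_intros V(2))
  have c0: "continuous_on UNIV (\<lambda>z::real. 0::real)" by simp
  have li: "locally_integrable (interior Omega) (\<lambda>x :: real \<times> real. f (snd x))" if "continuous_on UNIV f" for f :: "real \<Rightarrow> real"
    by (intro continuous_imp_locally_integrable continuous_on_axial that)
  have li0: "locally_integrable (interior Omega) (comp_\<rho> \<phi>)" "locally_integrable (interior Omega) (comp_\<theta> \<phi>)"
    "locally_integrable (interior Omega) (comp_z \<phi>)"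
    unfolding comps using li[OF DERIV_imp_continuous_on[OF d\<rho>]] li[OF c0] li[OF DERIV_imp_continuous_on[OF dz]] by simp_all
  note p\<rho> = pd_axial[of "\<lambda>z. r + w z" w' "comp_\<rho> \<phi>", OF d\<rho> cw(2) _ li0(1)]
  note p\<theta> = pd_axial[of "\<lambda>z. 0" "\<lambda>z. 0" "comp_\<theta> \<phi>", OF d0 c0 _ li0(2)]
  note pz = pd_axial[of "\<lambda>z. V z - lam * z" "\<lambda>z. V' z - lam" "comp_z \<phi>", OF dz cz _ li0(3)]
  have a: "AE x in lebesgue. x \<in> Omega \<longrightarrow> comp_\<rho> \<phi> x = r + w (snd x)"
    "AE x in lebesgue. x \<in> Omega \<longrightarrow> comp_\<theta> \<phi> x = 0"
    "AE x in lebesgue. x \<in> Omega \<longrightarrow> comp_z \<phi> x = V (snd x) - lam * snd x"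
    by (simp_all add: comps)
  note p\<rho> = p\<rho>[OF a(1)] and p\<theta> = p\<theta>[OF a(2)] and pz = pz[OF a(3)]
  note p2 = pd_axial[of w' w'' "pd ez (comp_\<rho> \<phi>)", OF w(2,3) p\<rho>(1,3)]
  note p2' = pd_axial[of "\<lambda>z. 0" "\<lambda>z. 0" "pd e\<theta> (comp_\<rho> \<phi>)", OF d0 c0 p\<rho>(2,4)]
  have A: "\<phi> \<in> A_vKD lam rho m"
    unfolding A_vKD_def
  proof (intro CollectI conjI)
    show "comp_\<rho> \<phi> \<in> H_per 2"
      unfolding H_per_def comps numeral_2_eq_2
      using periodic_extension_axial[of "\<lambda>z. r + w z"] w(4) H_loc_2_axial[OF d\<rho> w(2,3)] by simp
    show "comp_\<theta> \<phi> \<in> H_per 1"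
      unfolding H_per_def comps One_nat_def
      using periodic_extension_axial[of "\<lambda>z. 0"] H_loc_1_axial[OF d0 c0] by simp
    show "(\<lambda>x. comp_z \<phi> x + lam * snd x) \<in> H_per 1"
      unfolding H_per_def comps One_nat_def
      using periodic_extension_axial[of V] V(3) H_loc_1_axial[OF V(1,2)] by simp
    show "AE x in lebesgue_on Omega. rho - 1 \<le> comp_\<rho> \<phi> x"
      using w(5) by (simp add: comps r_def)
    have mw: "(\<lambda>x::real \<times> real. w' (snd x)) \<in> borel_measurable borel"
      "(\<lambda>x::real \<times> real. V' (snd x) - lam) \<in> borel_measurable borel"
      using borel_measurable_continuous_onI[OF continuous_on_axial[OF cw(2)]]
        borel_measurable_continuous_onI[OF continuous_on_axial[OF cz]] by simp_all
    show "\<forall>e\<in>{e\<theta>, ez}. \<forall>f\<in>{comp_\<rho> \<phi>, comp_\<theta> \<phi>, comp_z \<phi>}. Linf_norm (pd e f) \<le> m"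
    proof (intro ballI)
      fix e f assume ef: "e \<in> {e\<theta>, ez}" "f \<in> {comp_\<rho> \<phi>, comp_\<theta> \<phi>, comp_z \<phi>}"
      have zero: "Linf_norm F \<le> m" if "AE x in lebesgue. x \<in> Omega \<longrightarrow> F x = 0" for F
        by (rule Linf_norm_le[OF that]) (use m0 in \<open>auto simp: zero_ereal_def[symmetric]\<close>)
      have "Linf_norm (pd ez (comp_\<rho> \<phi>)) \<le> m" by (rule Linf_norm_le[OF p\<rho>(1) mw(1)]) (rule m(1))
      moreover have "Linf_norm (pd ez (comp_z \<phi>)) \<le> m" by (rule Linf_norm_le[OF pz(1) mw(2)]) (rule m(2))
      ultimately show "Linf_norm (pd e f) \<le> m"
        using ef zero[OF p\<rho>(2)] zero[OF p\<theta>(1)] zero[OF p\<theta>(2)] zero[OF pz(2)] by auto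
    qed
  qed
  let ?\<Omega> = "indicator Omega :: real \<times> real \<Rightarrow> real" and ?I = "indicator {-1/2..1/2} :: real \<Rightarrow> real"
  define G where "G z = (r + w z)\<^sup>2 + (V' z - lam + (w' z)\<^sup>2 / 2)\<^sup>2 + h\<^sup>2 * (w'' z)\<^sup>2" for z
  have cG: "continuous_on UNIV G" unfolding G_def by (intro continuous_intros cw w(3) V(2)) auto
  have mG: "(\<lambda>x::real \<times> real. G (snd x)) \<in> borel_measurable borel"
    by (rule borel_measurable_continuous_onI[OF continuous_on_axial[OF cG]])
  have iI: "integrable lborel (\<lambda>z. ?I z * G z)"
    by (rule integrable_indicator_continuous) (rule continuous_on_subset[OF cG], simp)
  have i\<theta>: "integrable lborel (indicator {0..2*pi} :: real \<Rightarrow> real)"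
    by (rule integrable_real_indicator) (simp_all add: emeasure_lborel_Icc_eq)
  have OG: "?\<Omega> x * G (snd x) = indicator {0..2*pi} (fst x) * (?I (snd x) * G (snd x))" for x
    by (cases x) (simp add: indicator_Omega)
  have iOG: "integrable lborel (\<lambda>x. ?\<Omega> x * G (snd x))"
    unfolding OG by (rule integrable_tensor[OF i\<theta> iI])
  have G0: "0 \<le> ?\<Omega> x * G (snd x)" for x by (simp add: G_def)
  have "E_vKD h \<phi> = enn2ereal (\<integral>\<^sup>+ x. ennreal (G (snd x)) \<partial>lebesgue_on Omega)"
    unfolding E_vKD_def
  proof (intro arg_cong[where f = enn2ereal] nn_integral_cong_AE)
    have "AE x in lebesgue. x \<in> Omega \<longrightarrow> (norm (strain \<phi> x))\<^sup>2 + h\<^sup>2 * (norm (hessian (comp_\<rho> \<phi>) x))\<^sup>2 = G (snd x)"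
      using p\<rho>(1,2) p\<theta>(1,2) pz(1,2) p2(1,2) p2'(1,2)
      by eventually_elim (auto simp: strain_def Let_def hessian_def norm_matrix2 G_def comps)
    then show "AE x in lebesgue_on Omega. ennreal ((norm (strain \<phi> x))\<^sup>2 + h\<^sup>2 * (norm (hessian (comp_\<rho> \<phi>) x))\<^sup>2) = ennreal (G (snd x))"
      unfolding AE_restrict_space_iff[of Omega lebesgue, simplified] by eventually_elim metis
  qed
  also have "(\<integral>\<^sup>+ x. ennreal (G (snd x)) \<partial>lebesgue_on Omega) = (\<integral>\<^sup>+ x. ennreal (?\<Omega> x * G (snd x)) \<partial>lebesgue)"
    by (subst nn_integral_restrict_space) (auto intro!: nn_integral_cong simp: indicator_def)
  also have "\<dots> = (\<integral>\<^sup>+ x. ennreal (?\<Omega> x * G (snd x)) \<partial>lborel)"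
    using borel_measurable_integrable[OF iOG] by (subst nn_integral_completion) auto
  also have "\<dots> = ennreal (LINT x|lborel. ?\<Omega> x * G (snd x))"
    by (rule nn_integral_eq_integral[OF iOG]) (simp add: G0)
  also have "(LINT x|lborel. ?\<Omega> x * G (snd x)) = 2 * pi * (LINT z|Leb (-1/2) (1/2). G z)"
    unfolding OG integral_tensor[OF i\<theta> iI] integral_Leb by simp
  finally have E: "E_vKD h \<phi> = ereal (2 * pi * (LINT z|Leb (-1/2) (1/2). G z))"
    by (simp add: G_def)
  let ?X = "\<lambda>z. 2 * r * w z + (w z)\<^sup>2 + (V' z - lam + (w' z)\<^sup>2 / 2)\<^sup>2 + h\<^sup>2 * (w'' z)\<^sup>2"
  have "continuous_on UNIV ?X" by (intro continuous_intros cw w(3) V(2)) auto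
  then have iL: "integrable (Leb (-1/2) (1/2)) ?X" "integrable (Leb (-1/2) (1/2)) (\<lambda>z. r\<^sup>2)"
    by (auto intro!: integrable_Leb_continuous intro: continuous_on_subset)
  have "(LINT z|Leb (-1/2) (1/2). G z) = (LINT z|Leb (-1/2) (1/2). r\<^sup>2 + ?X z)"
    by (intro Bochner_Integration.integral_cong refl) (simp add: G_def power2_eq_square algebra_simps)
  also have "\<dots> = r\<^sup>2 + (LINT z|Leb (-1/2) (1/2). ?X z)"
    using Bochner_Integration.integral_add[OF iL(2) iL(1)] measure_Leb[of "-1/2" "1/2"] by simp
  also have "\<dots> \<le> r\<^sup>2 + X" using X by (simp add: r_def)
  finally have "2 * pi * (LINT z|Leb (-1/2) (1/2). G z) \<le> E_bulk rho + 2 * pi * X"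
    using mult_left_mono[of _ "r\<^sup>2 + X" "2 * pi"] by (simp add: E_bulk_def measure_Omega r_def distrib_left)
  then have "min_E_vKD h lam rho m \<le> ereal (E_bulk rho + 2 * pi * X)"
    unfolding min_E_vKD_def using INF_lower[OF A, of "E_vKD h"] E by (metis ereal_less_eq(3) order_trans)
  then have "excess_energy h lam rho m \<le> ereal (E_bulk rho + 2 * pi * X) - ereal (E_bulk rho)"
    unfolding excess_energy_def by (rule ereal_minus_mono) simp
  then show ?thesis by simp
qed

section \<open>Axial profiles\<close>

lemma integral_Leb_const: "(LINT z|Leb (-1/2) (1/2). S) = (S :: real)"
proof -
  have "measure (Leb (-1/2) (1/2)) (space (Leb (-1/2) (1/2))) = 1"
    using measure_Leb[of "-1/2" "1/2"] by linarith
  then show ?thesis by (simp only: lebesgue_integral_const scaleR_one)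
qed

text \<open>The uniformly compressed cylinder stores the axial strain \<open>- lam\<close>.\<close>

lemma unbuckled_upper_bound:
  assumes "0 < lam" "ereal lam \<le> m"
  shows "excess_energy h lam rho m \<le> ereal (2 * pi * lam\<^sup>2)"
proof (rule axisymmetric_upper_bound[where w = "\<lambda>_. 0" and w' = "\<lambda>_. 0" and w'' = "\<lambda>_. 0" and V = "\<lambda>_. 0" and V' = "\<lambda>_. 0"])
  show "ereal \<bar>0\<bar> \<le> m" using assms by (metis abs_zero ereal_less_eq(3) less_imp_le order_trans)
  show "ereal \<bar>0 - lam\<bar> \<le> m" using assms by simp
  show "(LINT z|Leb (-1/2) (1/2). 2 * (rho - 1) * 0 + 0\<^sup>2 + (0 - lam + 0\<^sup>2 / 2)\<^sup>2 + h\<^sup>2 * 0\<^sup>2) \<le> lam\<^sup>2"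
    unfolding integral_Leb_const by simp
qed auto

lemma integral_Leb_le_const:
  fixes f :: "real \<Rightarrow> real"
  assumes c: "continuous_on UNIV f" and le: "\<And>z. z \<in> {-1/2..1/2} \<Longrightarrow> f z \<le> S"
  shows "(LINT z|Leb (-1/2) (1/2). f z) \<le> S"
proof -
  have "(LINT z|Leb (-1/2) (1/2). f z) \<le> (LINT z|Leb (-1/2) (1/2). S)"
  proof (rule integral_mono)
    show "integrable (Leb (-1/2) (1/2)) f"
      by (rule integrable_Leb_continuous) (rule continuous_on_subset[OF c], simp)
    show "integrable (Leb (-1/2) (1/2)) (\<lambda>_. S)" by (intro integrable_Leb_continuous continuous_intros)
  qed (use le in \<open>auto simp: space_restrict_space\<close>)
  also have "\<dots> = S" by (rule integral_Leb_const)
  finally show ?thesis .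
qed

text \<open>Folds that fill the whole period. They serve the compressions \<open>lam\<close> of order one under a slope bound:
the mean square of a sinusoidal slope is half of its maximum, so \<open>\<integral> w'\<^sup>2 = 2 lam\<close> only forces
\<open>w'\<^sup>2 \<le> 4 lam \<le> 2\<close>.\<close>

lemma sinusoidal_upper_bound:
  fixes n :: nat
  assumes lam: "0 < lam" "lam \<le> 1/2" and n: "1 \<le> n" and m: "ereal 2 \<le> m" and rho: "1 \<le> rho"
  shows "excess_energy h lam rho m \<le>
     ereal (2048 * ((rho - 1) * sqrt lam / n + lam / n\<^sup>2 + h\<^sup>2 * lam * n\<^sup>2))"
proof -
  define k where "k = 2 * pi * real n"
  have k: "0 < k" using n by (simp add: k_def)
  define A where "A = 2 * sqrt lam / k"
  have A0: "0 \<le> A" using k lam by (simp add: A_def)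
  have Ak: "A * k = 2 * sqrt lam" using k by (simp add: A_def)
  have Ak2: "(A * k)\<^sup>2 = 4 * lam" unfolding Ak using lam by (simp add: power_mult_distrib)
  define w where "w z = A * (1 + cos (k * z))" for z
  define w' where "w' z = - (A * k) * sin (k * z)" for z
  define w'' where "w'' z = - (A * k) * k * cos (k * z)" for z
  define V where "V z = lam * sin (2 * k * z) / (2 * k)" for z
  define V' where "V' z = lam * cos (2 * k * z)" for z
  have arg: "cos (k * (z + 1)) = cos (k * z)" "sin (2 * k * (z + 1)) = sin (2 * k * z)" for z
  proof -
    have "k * (z + 1) = k * z + 2 * pi * of_int (int n)" "2 * k * (z + 1) = 2 * k * z + 2 * pi * of_int (int (2 * n))"
      by (simp_all add: k_def algebra_simps)
    then show "cos (k * (z + 1)) = cos (k * z)" "sin (2 * k * (z + 1)) = sin (2 * k * z)"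
      by (simp_all only: cos_add sin_add cos_int_2pin sin_int_2pin mult_1_right mult_zero_right diff_zero add_0_right)
  qed
  have w'2: "(w' z)\<^sup>2 = 4 * lam * (sin (k * z))\<^sup>2" for z
    using Ak2 by (simp add: w'_def power_mult_distrib)
  have V'_lam: "V' z - lam = - ((w' z)\<^sup>2 / 2)" for z
  proof -
    have c: "cos (2 * k * z) = 1 - 2 * (sin (k * z))\<^sup>2" using cos_double_sin[of "k * z"] by (simp add: mult.assoc)
    show ?thesis unfolding w'2 V'_def c by (simp add: right_diff_distrib)
  qed
  have sinle: "(sin (k * z))\<^sup>2 \<le> 1" "(cos (k * z))\<^sup>2 \<le> 1" for z by (simp_all add: abs_square_le_1)
  have w'le: "(w' z)\<^sup>2 \<le> 2" for z
    unfolding w'2 using mult_mono[of "4 * lam" 2 "(sin (k * z))\<^sup>2" 1] lam sinle by simp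
  have slope: "\<bar>w' z\<bar> \<le> 2" for z
    using w'le[of z] abs_le_square_iff[of "w' z" 2] by simp
  define B where "B = 2 * (rho - 1) * (2 * A) + (2 * A)\<^sup>2 + h\<^sup>2 * (4 * lam * k\<^sup>2)"
  have "excess_energy h lam rho m \<le> ereal (2 * pi * B)"
  proof (rule axisymmetric_upper_bound[where w = w and w' = w' and w'' = w'' and V = V and V' = V'])
    show "(w has_real_derivative w' z) (at z)" for z
      unfolding w_def w'_def by (auto intro!: derivative_eq_intros)
    show "(w' has_real_derivative w'' z) (at z)" for z
      unfolding w'_def w''_def by (auto intro!: derivative_eq_intros)
    show "(V has_real_derivative V' z) (at z)" for z
      unfolding V_def V'_def using k by (auto intro!: derivative_eq_intros)
    show cw'': "continuous_on UNIV w''" unfolding w''_def by (intro continuous_intros)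
    show cV': "continuous_on UNIV V'" unfolding V'_def by (intro continuous_intros)
    show "w (z + 1) = w z" "V (z + 1) = V z" for z
      unfolding w_def V_def arg by simp_all
    show w0: "0 \<le> w z" for z
    proof -
      have "0 \<le> 1 + cos (k * z)" using cos_ge_minus_one[of "k * z"] by linarith
      then show ?thesis using A0 by (simp only: w_def mult_nonneg_nonneg)
    qed
    show "ereal \<bar>w' z\<bar> \<le> m" for z using slope m by (metis ereal_less_eq(3) order_trans)
    show "ereal \<bar>V' z - lam\<bar> \<le> m" for z
    proof -
      have "\<bar>V' z - lam\<bar> \<le> 2" unfolding V'_lam using w'le[of z] by simp
      then show ?thesis using m by (metis ereal_less_eq(3) order_trans)
    qed
    have cw: "continuous_on UNIV w" unfolding w_def by (intro continuous_intros)
    have cw': "continuous_on UNIV w'" unfolding w'_def by (intro continuous_intros)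
    show "(LINT z|Leb (-1/2) (1/2). 2 * (rho - 1) * w z + (w z)\<^sup>2 + (V' z - lam + (w' z)\<^sup>2 / 2)\<^sup>2 + h\<^sup>2 * (w'' z)\<^sup>2) \<le> B"
    proof (rule integral_Leb_le_const)
      show "continuous_on UNIV (\<lambda>z. 2 * (rho - 1) * w z + (w z)\<^sup>2 + (V' z - lam + (w' z)\<^sup>2 / 2)\<^sup>2 + h\<^sup>2 * (w'' z)\<^sup>2)"
        by (intro continuous_intros cw cw' cw'' cV') auto
      fix z :: real
      have wA: "w z \<le> 2 * A" using A0 mult_left_mono[OF cos_le_one[of "k * z"], of A] by (simp add: w_def algebra_simps)
      have "(w'' z)\<^sup>2 = 4 * lam * k\<^sup>2 * (cos (k * z))\<^sup>2"
        using Ak2 by (simp add: w''_def power_mult_distrib)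
      also have "\<dots> \<le> 4 * lam * k\<^sup>2 * 1" using lam sinle by (intro mult_left_mono) auto
      finally have "h\<^sup>2 * (w'' z)\<^sup>2 \<le> h\<^sup>2 * (4 * lam * k\<^sup>2)" by (intro mult_left_mono) auto
      moreover have "2 * (rho - 1) * w z \<le> 2 * (rho - 1) * (2 * A)" using wA rho by (intro mult_left_mono) auto
      moreover have "(w z)\<^sup>2 \<le> (2 * A)\<^sup>2" using wA w0 by (intro power_mono) auto
      ultimately show "2 * (rho - 1) * w z + (w z)\<^sup>2 + (V' z - lam + (w' z)\<^sup>2 / 2)\<^sup>2 + h\<^sup>2 * (w'' z)\<^sup>2 \<le> B"
        by (simp add: V'_lam B_def)
    qed
  qed
  also have "2 * pi * B \<le> 2048 * ((rho - 1) * sqrt lam / n + lam / n\<^sup>2 + h\<^sup>2 * lam * n\<^sup>2)"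
  proof -
    have n0: "0 < real n" using n by simp
    have "2 * pi * A = 2 * sqrt lam / n" using n0 by (simp add: A_def k_def field_simps)
    then have e1: "2 * pi * (2 * (rho - 1) * (2 * A)) = 8 * ((rho - 1) * sqrt lam / n)"
    proof -
      have "2 * pi * (2 * (rho - 1) * (2 * A)) = 4 * (rho - 1) * (2 * pi * A)" by (simp add: algebra_simps)
      then show ?thesis unfolding \<open>2 * pi * A = 2 * sqrt lam / n\<close> by simp
    qed
    have "pi * (2 * A)\<^sup>2 = 4 * lam / (pi * n\<^sup>2)"
      using n0 lam by (simp add: A_def k_def power_divide power_mult_distrib power2_eq_square field_simps)
    also have "\<dots> \<le> 4 * (lam / n\<^sup>2)"
      using n0 lam pi_gt3 by (simp add: field_simps)
    finally have e2: "2 * pi * (2 * A)\<^sup>2 \<le> 8 * (lam / n\<^sup>2)" by simp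
    have "pi ^ 3 \<le> 4 ^ 3" using pi_less_4 by (intro power_mono) auto
    then have "pi ^ 3 * (h\<^sup>2 * lam * n\<^sup>2) \<le> 64 * (h\<^sup>2 * lam * n\<^sup>2)" using lam by (intro mult_right_mono) auto
    then have e3: "2 * pi * (h\<^sup>2 * (4 * lam * k\<^sup>2)) \<le> 2048 * (h\<^sup>2 * lam * n\<^sup>2)"
      by (simp add: k_def power_mult_distrib power2_eq_square power3_eq_cube mult_ac)
    have nn: "0 \<le> (rho - 1) * sqrt lam / n" "0 \<le> lam / n\<^sup>2" using rho lam by auto
    show ?thesis unfolding B_def distrib_left using e1 e2 e3 nn by linarith
  qed
  then have "ereal (2 * pi * B) \<le> ereal (2048 * ((rho - 1) * sqrt lam / n + lam / n\<^sup>2 + h\<^sup>2 * lam * n\<^sup>2))" by simp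
  finally show ?thesis .
qed

lemma DERIV_max_0_power:
  "((\<lambda>t. max 0 t ^ Suc (Suc k)) has_real_derivative real (Suc (Suc k)) * max 0 t ^ Suc k) (at t)"
proof -
  consider "t > 0" | "t < 0" | "t = 0" by linarith
  then show ?thesis
  proof cases
    case 1
    have "((\<lambda>t. t ^ Suc (Suc k)) has_real_derivative real (Suc (Suc k)) * t ^ Suc k) (at t)"
      by (rule DERIV_pow[of "Suc (Suc k)" t, simplified diff_Suc_Suc diff_zero Suc_eq_plus1[symmetric] diff_Suc_1, THEN has_field_derivative_at_within])
    then have "((\<lambda>t. max 0 t ^ Suc (Suc k)) has_real_derivative real (Suc (Suc k)) * t ^ Suc k) (at t)"
      by (rule has_field_derivative_transform_within_open[where S = "{0<..}"]) (use 1 in auto)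
    then show ?thesis using 1 by simp
  next
    case 2
    have "((\<lambda>t. 0) has_real_derivative 0) (at t)" by simp
    then have "((\<lambda>t. max 0 t ^ Suc (Suc k)) has_real_derivative 0) (at t)"
      by (rule has_field_derivative_transform_within_open[where S = "{..<0}"]) (use 2 in auto)
    then show ?thesis using 2 by simp
  next
    case 3
    have "((\<lambda>h::real. max 0 h ^ Suc k) \<longlongrightarrow> max 0 0 ^ Suc k) (at 0)"
      by (intro tendsto_intros)
    then have "((\<lambda>h::real. max 0 h ^ Suc k) \<longlongrightarrow> 0) (at 0)" by simp
    moreover have "\<forall>\<^sub>F h in at 0. max 0 h ^ Suc k = max 0 h ^ Suc (Suc k) / (h::real)"
      by (auto simp: eventually_at_filter max_def)
    ultimately have "((\<lambda>h::real. max 0 h ^ Suc (Suc k) / h) \<longlongrightarrow> 0) (at 0)"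
      by (rule Lim_transform_eventually)
    then show ?thesis using 3 unfolding DERIV_def by simp
  qed
qed

lemma sin_ge_half:
  assumes "0 \<le> x" "x \<le> pi / 2" shows "x / 2 \<le> sin x"
proof -
  have "x / 2 * cos (x / 2) \<le> sin (x / 2)"
  proof -
    have "sin 0 - 0 * cos 0 \<le> sin (x / 2) - x / 2 * cos (x / 2)"
    proof (rule DERIV_nonneg_imp_nondecreasing[where f = "\<lambda>u. sin u - u * cos u"])
      fix u assume u: "0 \<le> u" "u \<le> x / 2"
      have "((\<lambda>u. sin u - u * cos u) has_real_derivative u * sin u) (at u)"
        by (auto intro!: derivative_eq_intros)
      moreover have "0 \<le> u * sin u" using u assms by (intro mult_nonneg_nonneg sin_ge_zero) auto
      ultimately show "\<exists>y. ((\<lambda>u. sin u - u * cos u) has_real_derivative y) (at u) \<and> 0 \<le> y" by blast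
    qed (use assms in auto)
    then show ?thesis by simp
  qed
  moreover have "0 \<le> cos (x / 2)" using assms by (intro cos_ge_zero) auto
  ultimately have "x / 2 * cos (x / 2) * cos (x / 2) \<le> sin (x / 2) * cos (x / 2)" by (rule mult_right_mono)
  moreover have "x * (2 * (cos (x / 2))\<^sup>2) = 4 * (x / 2 * cos (x / 2) * cos (x / 2))" by (simp add: power2_eq_square)
  ultimately have "x * (2 * (cos (x / 2))\<^sup>2) \<le> 2 * (2 * sin (x / 2) * cos (x / 2))" by linarith
  also have "2 * sin (x / 2) * cos (x / 2) = sin x" using sin_double[of "x / 2"] by simp
  also have "2 * (cos (x / 2))\<^sup>2 = 1 + cos x" using cos_double_cos[of "x / 2"] by simp
  finally have "x * (1 + cos x) \<le> 2 * sin x" .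
  moreover have "x * 1 \<le> x * (1 + cos x)" using assms by (intro mult_left_mono) (auto intro: cos_ge_zero)
  ultimately show ?thesis by linarith
qed

lemma integral_Leb_FTC:
  fixes g G :: "real \<Rightarrow> real"
  assumes "\<And>y. (G has_real_derivative g y) (at y)" "continuous_on UNIV g" "a \<le> b"
  shows "(LINT y|Leb a b. g y) = G b - G a"
  unfolding integral_Leb using integral_FTC_Icc[of a b G g] assms
  by (auto simp: has_real_derivative_iff_has_vector_derivative[symmetric]
      intro: has_field_derivative_at_within continuous_on_subset)

lemma antiderivative_shift:
  fixes f F :: "real \<Rightarrow> real"
  assumes F: "\<And>y. (F has_real_derivative f y) (at y)" and c: "continuous_on UNIV f" and per: "\<And>y. f (y + 1) = f y"
  shows "F (y + 1) = F y + (LINT y|Leb (-1/2) (1/2). f y)"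
proof -
  have "((\<lambda>y. F (y + 1) - F y) has_real_derivative 0) (at y)" for y
  proof -
    have "((\<lambda>y. F (y + 1)) has_real_derivative f (y + 1)) (at y)"
      using DERIV_shift[of F "f (y + 1)" y 1] F by (simp add: add.commute)
    then show ?thesis using DERIV_diff[OF _ F[of y], of "\<lambda>y. F (y + 1)" "f (y + 1)"] per by simp
  qed
  then have "F (y + 1) - F y = F (-1/2 + 1) - F (-1/2)"
    by (intro DERIV_isconst_all[of "\<lambda>y. F (y + 1) - F y"]) blast
  then show ?thesis using integral_Leb_FTC[OF F c, of "-1/2" "1/2"] by simp
qed

text \<open>An antiderivative of \<open>f\<close> grows by the same amount over every period.\<close>

lemma integral_scaled_periodic:
  fixes f :: "real \<Rightarrow> real" and n :: nat
  assumes c: "continuous_on UNIV f" and per: "\<And>y. f (y + 1) = f y" and n: "1 \<le> n"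
  shows "(LINT z|Leb (-1/2) (1/2). f (n * z)) = (LINT y|Leb (-1/2) (1/2). f y)"
proof -
  obtain F where F: "\<And>y. (F has_real_derivative f y) (at y)" using antiderivative_exists[OF c] by blast
  define I where "I = (LINT y|Leb (-1/2) (1/2). f y)"
  have steps: "F (y + real k) = F y + real k * I" for y k
  proof (induction k)
    case (Suc k)
    then show ?case using antiderivative_shift[OF F c per, of "y + real k"] by (simp add: I_def algebra_simps)
  qed simp
  have n0: "0 < real n" using n by simp
  have dn: "((\<lambda>z. F (real n * z) / real n) has_real_derivative f (real n * z)) (at z)" for z
  proof -
    have "((\<lambda>z. F (real n * z)) has_real_derivative f (real n * z) * real n) (at z)"
      using DERIV_chain2[OF F, of "\<lambda>z. real n * z" "real n" z UNIV] by (auto intro!: derivative_eq_intros)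
    then have "((\<lambda>z. F (real n * z) / real n) has_real_derivative f (real n * z) * real n / real n) (at z)"
      by (rule DERIV_cdivide)
    then show ?thesis using n0 by simp
  qed
  have cn: "continuous_on UNIV (\<lambda>z. f (real n * z))"
    by (rule continuous_on_compose2[OF c]) (auto intro!: continuous_intros)
  have "(LINT z|Leb (-1/2) (1/2). f (n * z)) = F (n * (1/2)) / n - F (n * (-1/2)) / n"
    by (rule integral_Leb_FTC[OF dn cn]) simp
  also have "\<dots> = I"
    using steps[of "- real n / 2" n] n0 by (simp add: field_simps)
  finally show ?thesis by (simp add: I_def)
qed

lemma integral_Leb_le_support:
  fixes f :: "real \<Rightarrow> real"
  assumes c: "continuous_on UNIV f" and s: "0 < s" "s \<le> 1" and S: "0 \<le> S"
    and le: "\<And>y. y \<in> {-1/2..1/2} \<Longrightarrow> f y \<le> S" and zero: "\<And>y. y \<in> {-1/2..1/2} \<Longrightarrow> s / 2 < \<bar>y\<bar> \<Longrightarrow> f y = 0"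
  shows "(LINT y|Leb (-1/2) (1/2). f y) \<le> S * s"
proof -
  have "(LINT y|lborel. indicator {-1/2..1/2} y * f y) \<le> (LINT y|lborel. S * indicator {-s/2..s/2} y)"
  proof (rule integral_mono)
    show "integrable lborel (\<lambda>y. indicator {-1/2..1/2} y * f y)"
      by (rule integrable_indicator_continuous) (rule continuous_on_subset[OF c], simp)
    show "integrable lborel (\<lambda>y. S * indicator {-s/2..s/2} y)"
      by (intro integrable_mult_right integrable_real_indicator) (auto simp: emeasure_lborel_Icc_eq)
    fix y :: real
    show "indicator {-1/2..1/2} y * f y \<le> S * indicator {-s/2..s/2} y"
    proof (cases "y \<in> {-s/2..s/2}")
      case True
      then have "y \<in> {-1/2..1/2}" using s by auto
      then show ?thesis using True le[of y] by simp
    next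
      case False
      then have "s / 2 < \<bar>y\<bar>" by auto
      then show ?thesis using False zero[of y] by (cases "y \<in> {-1/2..1/2}") auto
    qed
  qed
  also have "(LINT y|lborel. S * indicator {-s/2..s/2} y) = S * s" using s by simp
  finally show ?thesis by (simp add: integral_Leb)
qed

lemma DERIV_max_0_square_cube:
  "((\<lambda>t::real. max 0 t ^ 3) has_real_derivative 3 * (max 0 t)\<^sup>2) (at t)"
  "((\<lambda>t::real. (max 0 t)\<^sup>2) has_real_derivative 2 * max 0 t) (at t)"
  using DERIV_max_0_power[of 1 t] DERIV_max_0_power[of 0 t] by (simp_all add: eval_nat_numeral)

text \<open>A single fold of length of order \<open>s\<close> per period: the positive part of \<open>cos (2 pi y) - 1 + s\<^sup>2\<close>, cubed.
The cosine makes it periodic without any gluing, and the third power of the positive part is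
twice continuously differentiable. Below, \<open>M\<close> is the positive part, \<open>g\<close> the fold, and
\<open>g'\<close>, \<open>g''\<close> are its derivatives.\<close>

locale truncated_cosine =
  fixes s :: real
  assumes s: "0 < s" "s \<le> 1"
begin

definition M :: "real \<Rightarrow> real" where "M y = max 0 (cos (2 * pi * y) - 1 + s\<^sup>2)"
definition g :: "real \<Rightarrow> real" where "g y = M y ^ 3"
definition g' :: "real \<Rightarrow> real" where "g' y = - (6 * pi * (M y)\<^sup>2 * sin (2 * pi * y))"
definition g'' :: "real \<Rightarrow> real" where
  "g'' y = 24 * pi\<^sup>2 * (M y * (sin (2 * pi * y))\<^sup>2) - 12 * pi\<^sup>2 * ((M y)\<^sup>2 * cos (2 * pi * y))"

lemma DERIV_g: "(g has_real_derivative g' y) (at y)"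
proof -
  have "((\<lambda>y. cos (2 * pi * y) - 1 + s\<^sup>2) has_real_derivative - (2 * pi * sin (2 * pi * y))) (at y)"
    by (auto intro!: derivative_eq_intros)
  from DERIV_chain2[OF DERIV_max_0_square_cube(1) this]
  have "((\<lambda>y. M y ^ 3) has_real_derivative 3 * (M y)\<^sup>2 * - (2 * pi * sin (2 * pi * y))) (at y)"
    by (simp only: M_def)
  then show ?thesis unfolding g_def[abs_def] g'_def by (simp add: mult_ac)
qed

lemma DERIV_g': "(g' has_real_derivative g'' y) (at y)"
proof -
  have "((\<lambda>y. cos (2 * pi * y) - 1 + s\<^sup>2) has_real_derivative - (2 * pi * sin (2 * pi * y))) (at y)"
    by (auto intro!: derivative_eq_intros)
  from DERIV_chain2[OF DERIV_max_0_square_cube(2) this]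
  have D2: "((\<lambda>y. (M y)\<^sup>2) has_real_derivative 2 * M y * - (2 * pi * sin (2 * pi * y))) (at y)"
    by (simp only: M_def)
  have "((\<lambda>y. sin (2 * pi * y)) has_real_derivative 2 * pi * cos (2 * pi * y)) (at y)"
    by (auto intro!: derivative_eq_intros)
  from DERIV_cmult[OF DERIV_mult[OF D2 this], of "- (6 * pi)"] show ?thesis
    unfolding g'_def[abs_def] g''_def by (simp add: power2_eq_square algebra_simps)
qed

lemma continuous_M: "continuous_on UNIV M" unfolding M_def by (intro continuous_intros)
lemma continuous_g: "continuous_on UNIV g" unfolding g_def by (intro continuous_intros continuous_M)
lemma continuous_g': "continuous_on UNIV g'" unfolding g'_def by (intro continuous_intros continuous_M)
lemma continuous_g'': "continuous_on UNIV g''" unfolding g''_def by (intro continuous_intros continuous_M)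

lemma M_bounds: "0 \<le> M y" "M y \<le> s\<^sup>2"
  using cos_le_one[of "2 * pi * y"] by (auto simp: M_def)

lemma periodic_M: "M (y + 1) = M y" and periodic_sin: "sin (2 * pi * (y + 1)) = sin (2 * pi * y)"
  by (simp_all add: M_def distrib_left sin_add cos_add)

lemma periodic_g: "g (y + 1) = g y" "g' (y + 1) = g' y" "g'' (y + 1) = g'' y"
  by (simp_all add: g_def g'_def g''_def periodic_M periodic_sin distrib_left cos_add)

text \<open>On the support of the fold \<open>1 - cos\<close> is less than \<open>s\<^sup>2\<close>, so the sine is of order \<open>s\<close>.\<close>

lemma M_sin: "M y * (sin (2 * pi * y))\<^sup>2 \<le> 2 * s\<^sup>2 * M y"
proof (cases "M y = 0")
  case False
  then have c: "1 - cos (2 * pi * y) < s\<^sup>2" by (auto simp: M_def max_def split: if_splits)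
  have "(sin (2 * pi * y))\<^sup>2 = (1 - cos (2 * pi * y)) * (1 + cos (2 * pi * y))"
    by (simp add: sin_squared_eq power2_eq_square algebra_simps)
  also have "\<dots> \<le> s\<^sup>2 * 2"
    using c cos_le_one[of "2 * pi * y"] cos_ge_minus_one[of "2 * pi * y"] by (intro mult_mono) linarith+
  finally have "M y * (sin (2 * pi * y))\<^sup>2 \<le> M y * (s\<^sup>2 * 2)" by (rule mult_left_mono) (rule M_bounds)
  then show ?thesis by (simp only: mult_ac)
qed simp

text \<open>If \<open>\<bar>y\<bar> > s/2\<close>, then \<open>1 - cos (2 pi y) = 2 sin\<^sup>2 (pi y) \<ge> 2 (pi y / 2)\<^sup>2 > s\<^sup>2\<close>.\<close>

lemma M_support:
  assumes "y \<in> {-1/2..1/2}" "s / 2 < \<bar>y\<bar>" shows "M y = 0"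
proof -
  have y: "\<bar>y\<bar> \<le> 1/2" using assms by auto
  have "pi * \<bar>y\<bar> \<le> pi * (1/2)" using y by (intro mult_left_mono) auto
  then have "pi * \<bar>y\<bar> / 2 \<le> sin (pi * \<bar>y\<bar>)" by (intro sin_ge_half) auto
  moreover have "3 * \<bar>y\<bar> \<le> pi * \<bar>y\<bar>" using pi_gt3 by (intro mult_right_mono) auto
  ultimately have "3 / 4 * s \<le> sin (pi * \<bar>y\<bar>)" using assms(2) by linarith
  then have "(3 / 4 * s)\<^sup>2 \<le> (sin (pi * \<bar>y\<bar>))\<^sup>2" using s by (intro power_mono) auto
  moreover have "cos (2 * pi * y) = 1 - 2 * (sin (pi * \<bar>y\<bar>))\<^sup>2"
    using cos_double_sin[of "pi * y"] by (simp add: mult.assoc abs_if)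
  ultimately have "cos (2 * pi * y) - 1 + s\<^sup>2 \<le> - (1/8) * s\<^sup>2" by (simp add: power2_eq_square)
  also have "\<dots> \<le> 0" by simp
  finally show ?thesis by (simp add: M_def)
qed

lemma g_nonneg: "0 \<le> g y" using M_bounds by (simp add: g_def)

lemma integral_g: "(LINT y|Leb (-1/2) (1/2). g y) \<le> s ^ 7"
proof -
  have "(LINT y|Leb (-1/2) (1/2). g y) \<le> s ^ 6 * s"
  proof (rule integral_Leb_le_support[OF continuous_g s])
    show "g y \<le> s ^ 6" for y
      using power_mono[OF M_bounds(2)[of y] M_bounds(1)[of y], of 3] by (simp add: g_def flip: power_mult)
  qed (use s in \<open>auto simp: g_def M_support\<close>)
  then show ?thesis by (simp add: eval_nat_numeral mult_ac)
qed

lemma integral_g_square: "(LINT y|Leb (-1/2) (1/2). (g y)\<^sup>2) \<le> s ^ 13"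
proof -
  have "(LINT y|Leb (-1/2) (1/2). (g y)\<^sup>2) \<le> s ^ 12 * s"
  proof (rule integral_Leb_le_support[OF _ s])
    show "(g y)\<^sup>2 \<le> s ^ 12" for y
      using power_mono[OF M_bounds(2)[of y] M_bounds(1)[of y], of 6] by (simp add: g_def flip: power_mult)
    show "continuous_on UNIV (\<lambda>y. (g y)\<^sup>2)" by (intro continuous_intros continuous_g)
  qed (use s in \<open>auto simp: g_def M_support\<close>)
  then show ?thesis by (simp add: eval_nat_numeral mult_ac)
qed

lemma g'_square_le: "(g' y)\<^sup>2 \<le> 1152 * s ^ 10"
proof -
  have "(g' y)\<^sup>2 = 36 * pi\<^sup>2 * (M y ^ 3 * (M y * (sin (2 * pi * y))\<^sup>2))"
    by (simp add: g'_def power_mult_distrib eval_nat_numeral mult_ac)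
  also have "\<dots> \<le> 36 * 4\<^sup>2 * ((s\<^sup>2) ^ 3 * (2 * s\<^sup>2 * s\<^sup>2))"
  proof (rule mult_mono[OF _ mult_mono])
    have "pi\<^sup>2 \<le> 4\<^sup>2" using pi_less_4 by (intro power_mono) auto
    then show "36 * pi\<^sup>2 \<le> 36 * 4\<^sup>2" by simp
    show "M y ^ 3 \<le> (s\<^sup>2) ^ 3" using M_bounds by (intro power_mono)
    have "2 * s\<^sup>2 * M y \<le> 2 * s\<^sup>2 * s\<^sup>2" using M_bounds by (intro mult_left_mono) auto
    then show "M y * (sin (2 * pi * y))\<^sup>2 \<le> 2 * s\<^sup>2 * s\<^sup>2" using M_sin[of y] by linarith
  qed (use M_bounds in auto)
  also have "\<dots> = 1152 * s ^ 10" by (simp add: eval_nat_numeral mult_ac)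
  finally show ?thesis .
qed

lemma integral_g''_square: "(LINT y|Leb (-1/2) (1/2). (g'' y)\<^sup>2) \<le> 921600 * s ^ 9"
proof -
  have "(LINT y|Leb (-1/2) (1/2). (g'' y)\<^sup>2) \<le> 921600 * s ^ 8 * s"
  proof (rule integral_Leb_le_support[OF _ s])
    show "continuous_on UNIV (\<lambda>y. (g'' y)\<^sup>2)" by (intro continuous_intros continuous_g'')
    fix y
    have a: "0 \<le> M y * (sin (2 * pi * y))\<^sup>2" "M y * (sin (2 * pi * y))\<^sup>2 \<le> 2 * s ^ 4"
    proof -
      show "0 \<le> M y * (sin (2 * pi * y))\<^sup>2" using M_bounds by simp
      have "2 * s\<^sup>2 * M y \<le> 2 * s\<^sup>2 * s\<^sup>2" using M_bounds by (intro mult_left_mono) auto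
      then show "M y * (sin (2 * pi * y))\<^sup>2 \<le> 2 * s ^ 4" using M_sin[of y] by (simp add: eval_nat_numeral mult_ac)
    qed
    have b: "\<bar>(M y)\<^sup>2 * cos (2 * pi * y)\<bar> \<le> s ^ 4"
    proof -
      have "(M y)\<^sup>2 * \<bar>cos (2 * pi * y)\<bar> \<le> (s\<^sup>2)\<^sup>2 * 1"
        using M_bounds by (intro mult_mono power_mono abs_cos_le_one) auto
      then show ?thesis by (simp add: abs_mult flip: power_mult)
    qed
    have "\<bar>g'' y\<bar> \<le> \<bar>24 * pi\<^sup>2 * (M y * (sin (2 * pi * y))\<^sup>2)\<bar> + \<bar>12 * pi\<^sup>2 * ((M y)\<^sup>2 * cos (2 * pi * y))\<bar>"
      unfolding g''_def by (rule abs_triangle_ineq4)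
    also have "\<dots> = pi\<^sup>2 * (24 * (M y * (sin (2 * pi * y))\<^sup>2) + 12 * \<bar>(M y)\<^sup>2 * cos (2 * pi * y)\<bar>)"
    proof -
      have "\<bar>24 * pi\<^sup>2 * (M y * (sin (2 * pi * y))\<^sup>2)\<bar> = pi\<^sup>2 * (24 * (M y * (sin (2 * pi * y))\<^sup>2))"
        unfolding abs_mult[of "24 * pi\<^sup>2"] abs_of_nonneg[OF a(1)] by simp
      moreover have "\<bar>12 * pi\<^sup>2 * ((M y)\<^sup>2 * cos (2 * pi * y))\<bar> = pi\<^sup>2 * (12 * \<bar>(M y)\<^sup>2 * cos (2 * pi * y)\<bar>)"
        unfolding abs_mult[of "12 * pi\<^sup>2"] by simp
      ultimately show ?thesis unfolding distrib_left by linarith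
    qed
    also have "\<dots> \<le> 4\<^sup>2 * (60 * s ^ 4)"
      using a b pi_less_4 by (intro mult_mono power_mono) auto
    finally have "\<bar>g'' y\<bar> \<le> 960 * s ^ 4" by simp
    from power_mono[OF this, of 2] show "(g'' y)\<^sup>2 \<le> 921600 * s ^ 8"
      by (simp add: power_mult_distrib flip: power_mult)
  qed (use s in \<open>auto simp: g''_def M_support\<close>)
  then show ?thesis by (simp add: eval_nat_numeral mult_ac)
qed

text \<open>The slope is of its maximal order \<open>s\<^sup>5\<close> for \<open>s/16 \<le> y \<le> s/8\<close>.\<close>

lemma integral_g'_square: "s ^ 11 / 64 \<le> (LINT y|Leb (-1/2) (1/2). (g' y)\<^sup>2)"
proof -
  have low: "s ^ 10 / 4 \<le> (g' y)\<^sup>2" if y: "y \<in> {s/16..s/8}" for y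
  proof -
    have y0: "0 \<le> y" "y \<le> 1/8" using y s by auto
    have py: "0 \<le> pi * y" "pi * y \<le> 4 * (s / 8)"
      using y0 y pi_less_4 mult_mono[of pi 4 y "s / 8"] by auto
    have "\<bar>sin (pi * y)\<bar> \<le> s / 2" using abs_sin_x_le_abs_x[of "pi * y"] py by linarith
    then have "(sin (pi * y))\<^sup>2 \<le> (s / 2)\<^sup>2"
      using power_mono[of "\<bar>sin (pi * y)\<bar>" "s / 2" 2] by simp
    moreover have "cos (2 * pi * y) = 1 - 2 * (sin (pi * y))\<^sup>2"
      using cos_double_sin[of "pi * y"] by (simp add: mult.assoc)
    ultimately have "s\<^sup>2 / 2 \<le> cos (2 * pi * y) - 1 + s\<^sup>2" by (simp add: power2_eq_square)
    then have M: "s\<^sup>2 / 2 \<le> M y" unfolding M_def by (rule max.coboundedI2)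
    have "2 * pi * y / 2 \<le> sin (2 * pi * y)"
    proof (rule sin_ge_half)
      have "2 * pi * y \<le> 2 * pi * (1/8)" using y0 by (intro mult_left_mono) auto
      then show "2 * pi * y \<le> pi / 2" using pi_gt_zero by linarith
    qed (use y0 in auto)
    moreover have "3 * (s / 16) \<le> pi * y" using y pi_gt3 s by (intro mult_mono) auto
    ultimately have S: "3 * s / 16 \<le> sin (2 * pi * y)" by simp
    have "(s\<^sup>2 / 2)\<^sup>2 \<le> (M y)\<^sup>2" using M by (intro power_mono) auto
    then have "6 * 3 * (s\<^sup>2 / 2)\<^sup>2 * (3 * s / 16) \<le> 6 * pi * (M y)\<^sup>2 * sin (2 * pi * y)"
      using S pi_gt3 s by (intro mult_mono) auto
    moreover have "s ^ 5 / 2 \<le> 6 * 3 * (s\<^sup>2 / 2)\<^sup>2 * (3 * s / 16)"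
      using s by (simp add: power_divide eval_nat_numeral)
    ultimately have "(s ^ 5 / 2)\<^sup>2 \<le> (6 * pi * (M y)\<^sup>2 * sin (2 * pi * y))\<^sup>2"
      using s by (intro power_mono) auto
    then show ?thesis by (simp add: g'_def power_divide flip: power_mult)
  qed
  have "(LINT y|lborel. s ^ 10 / 4 * indicator {s/16..s/8} y) \<le> (LINT y|lborel. indicator {-1/2..1/2} y * (g' y)\<^sup>2)"
  proof (rule integral_mono)
    show "integrable lborel (\<lambda>y. indicator {-1/2..1/2} y * (g' y)\<^sup>2)"
      by (rule integrable_indicator_continuous) (intro continuous_intros continuous_on_subset[OF continuous_g'], simp)
    show "integrable lborel (\<lambda>y. s ^ 10 / 4 * indicator {s/16..s/8} y)"
      by (intro integrable_mult_right integrable_real_indicator) (auto simp: emeasure_lborel_Icc_eq)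
    fix y :: real
    show "s ^ 10 / 4 * indicator {s/16..s/8} y \<le> indicator {-1/2..1/2} y * (g' y)\<^sup>2"
    proof (cases "y \<in> {s/16..s/8}")
      case True
      then have "y \<in> {-1/2..1/2}" using s by auto
      then show ?thesis using True low[OF True] by simp
    qed simp
  qed
  moreover have "(LINT y|lborel. s ^ 10 / 4 * indicator {s/16..s/8} y) = s ^ 11 / 64"
    using s by (simp add: eval_nat_numeral)
  ultimately show ?thesis by (simp add: integral_Leb)
qed

end

section \<open>The upper bounds\<close>

text \<open>The fold is repeated \<open>n\<close> times and its amplitude \<open>A\<close> is fixed by \<open>\<integral> w'\<^sup>2 = 2 lam\<close>, so that an axial
displacement with vanishing axial strain exists and is periodic. Since the slope energy of the
fold is of order \<open>s ^ 11\<close>, this gives \<open>A\<^sup>2\<close> of order \<open>lam / (n\<^sup>2 s ^ 11)\<close> and slopes of order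
\<open>sqrt (lam/s)\<close>. The factor \<open>40000\<close> keeps \<open>w'\<^sup>2\<close> below \<open>4\<close>, and therefore both \<open>\<bar>w'\<bar>\<close> and the
axial derivative \<open>w'\<^sup>2/2\<close> below \<open>2\<close>.\<close>

lemma localized_upper_bound:
  fixes n :: nat and s lam rho h :: real
  assumes s: "0 < s" "s \<le> 1" and lam: "0 < lam" and n: "1 \<le> n" and rho: "1 \<le> rho"
    and m: "m = \<infinity> \<or> 40000 * lam \<le> s \<and> ereal 2 \<le> m"
  shows "excess_energy h lam rho m \<le>
     ereal (10 ^ 9 * ((rho - 1) * sqrt (lam * s ^ 3) / n + lam * s\<^sup>2 / n\<^sup>2 + h\<^sup>2 * lam * n\<^sup>2 / s\<^sup>2))"
proof -
  interpret truncated_cosine s by unfold_locales (use s in auto)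
  let ?L = "Leb (-1/2) (1/2)"
  have n0: "0 < real n" using n by simp
  define J where "J = (LINT y|?L. (g' y)\<^sup>2)"
  have Jlow: "s ^ 11 / 64 \<le> J" unfolding J_def by (rule integral_g'_square)
  have J0: "0 < J" using Jlow s by (smt (verit) zero_less_power divide_pos_pos)
  define A where "A = sqrt (2 * lam / ((real n)\<^sup>2 * J))"
  have A0: "0 \<le> A" using lam J0 by (simp add: A_def)
  have A2: "A\<^sup>2 = 2 * lam / ((real n)\<^sup>2 * J)" using lam J0 by (simp add: A_def)
  have AJ: "A\<^sup>2 * (real n)\<^sup>2 * J = 2 * lam" using J0 n0 by (simp add: A2)
  have A2le: "A\<^sup>2 \<le> 128 * lam / ((real n)\<^sup>2 * s ^ 11)"
  proof -
    have "A\<^sup>2 \<le> 2 * lam / ((real n)\<^sup>2 * (s ^ 11 / 64))"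
      unfolding A2 using lam n0 s Jlow J0 by (intro divide_left_mono mult_left_mono mult_pos_pos) auto
    then show ?thesis by simp
  qed
  define w where "w z = A * g (real n * z)" for z
  define w' where "w' z = A * n * g' (real n * z)" for z
  define w'' where "w'' z = A * n\<^sup>2 * g'' (real n * z)" for z
  define v where "v z = lam - (w' z)\<^sup>2 / 2" for z
  have scale: "continuous_on UNIV (\<lambda>z. f (real n * z))" if "continuous_on UNIV f" for f :: "real \<Rightarrow> real"
    by (rule continuous_on_compose2[OF that]) (auto intro!: continuous_intros)
  have cont: "continuous_on UNIV w" "continuous_on UNIV w'" "continuous_on UNIV w''"
    unfolding w_def w'_def w''_def
    by (intro continuous_intros scale continuous_g continuous_g' continuous_g'')+
  have cv: "continuous_on UNIV v" unfolding v_def by (intro continuous_intros cont) auto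
  have per: "f (real n * (z + 1)) = f (real n * z)" if "\<And>y. f (y + 1) = f y" for f :: "real \<Rightarrow> real" and z :: real
    using periodic_of_int[of f "real n * z" "- int n", OF that] by (simp add: distrib_left add.commute)
  have per': "w (z + 1) = w z" "w' (z + 1) = w' z" for z
    unfolding w_def w'_def using per[of g, OF periodic_g(1)] per[of g', OF periodic_g(2)] by simp_all
  have w'2: "(w' z)\<^sup>2 = A\<^sup>2 * (real n)\<^sup>2 * (g' (real n * z))\<^sup>2" for z by (simp add: w'_def power_mult_distrib)
  have integrable: "integrable ?L f" if "continuous_on UNIV f" for f :: "real \<Rightarrow> real"
    by (rule integrable_Leb_continuous) (rule continuous_on_subset[OF that], simp)
  have int_v: "(LINT z|?L. v z) = 0"
  proof -
    have c: "continuous_on UNIV (\<lambda>y. (g' y)\<^sup>2)" by (intro continuous_intros continuous_g')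
    have "(LINT z|?L. (g' (real n * z))\<^sup>2) = J"
      unfolding J_def by (rule integral_scaled_periodic[OF c _ n]) (simp add: periodic_g)
    then have "(LINT z|?L. A\<^sup>2 * (real n)\<^sup>2 / 2 * (g' (real n * z))\<^sup>2) = lam"
      unfolding integral_mult_right_zero using AJ by simp
    moreover have "(LINT z|?L. v z) = (LINT z|?L. lam) - (LINT z|?L. A\<^sup>2 * (real n)\<^sup>2 / 2 * (g' (real n * z))\<^sup>2)"
    proof -
      have "v = (\<lambda>z. lam - A\<^sup>2 * (real n)\<^sup>2 / 2 * (g' (real n * z))\<^sup>2)" by (simp add: v_def fun_eq_iff w'2)
      moreover have "integrable ?L (\<lambda>z. lam)" "integrable ?L (\<lambda>z. A\<^sup>2 * (real n)\<^sup>2 / 2 * (g' (real n * z))\<^sup>2)"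
        using scale[OF continuous_g'] by (intro integrable continuous_intros; simp)+
      ultimately show ?thesis by (simp only: Bochner_Integration.integral_diff)
    qed
    ultimately show ?thesis by (simp only: integral_Leb_const)
  qed
  obtain V where V: "\<And>z. (V has_real_derivative v z) (at z)" using antiderivative_exists[OF cv] by blast
  have perV: "V (z + 1) = V z" for z
  proof -
    have "v (y + 1) = v y" for y by (simp only: v_def per')
    from antiderivative_shift[OF V cv this, of z] show ?thesis unfolding int_v by simp
  qed
  define B where "B = 2 * (rho - 1) * (A * s ^ 7) + A\<^sup>2 * s ^ 13 + h\<^sup>2 * (A\<^sup>2 * n ^ 4 * (921600 * s ^ 9))"
  have slope: "(w' z)\<^sup>2 \<le> 147456 * (lam / s)" for z
  proof -
    have "(w' z)\<^sup>2 \<le> 128 * lam / ((real n)\<^sup>2 * s ^ 11) * (real n)\<^sup>2 * (1152 * s ^ 10)"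
      unfolding w'2 using A2le g'_square_le s lam by (intro mult_mono mult_nonneg_nonneg) auto
    also have "\<dots> = 147456 * (lam / s)" using s n0 by (simp add: eval_nat_numeral field_simps)
    finally show ?thesis .
  qed
  have small: "(w' z)\<^sup>2 \<le> 4" if "40000 * lam \<le> s" for z
  proof -
    have "lam / s \<le> 1 / 40000" using that s by (simp add: field_simps)
    then show ?thesis using slope[of z] by linarith
  qed
  have "excess_energy h lam rho m \<le> ereal (2 * pi * B)"
  proof (rule axisymmetric_upper_bound[where w = w and w' = w' and w'' = w'' and V = V and V' = v])
    show "(w has_real_derivative w' z) (at z)" for z
    proof -
      have "((\<lambda>z. g (real n * z)) has_real_derivative g' (real n * z) * n) (at z)"
        using DERIV_chain2[OF DERIV_g, of "\<lambda>z. real n * z" "real n" z UNIV] by (auto intro!: derivative_eq_intros)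
      from DERIV_cmult[OF this, of A] show ?thesis unfolding w_def[abs_def] w'_def by (simp add: mult_ac)
    qed
    show "(w' has_real_derivative w'' z) (at z)" for z
    proof -
      have "((\<lambda>z. g' (real n * z)) has_real_derivative g'' (real n * z) * n) (at z)"
        using DERIV_chain2[OF DERIV_g', of "\<lambda>z. real n * z" "real n" z UNIV] by (auto intro!: derivative_eq_intros)
      from DERIV_cmult[OF this, of "A * n"] show ?thesis
        unfolding w'_def[abs_def] w''_def by (simp add: mult_ac power2_eq_square)
    qed
    show "0 \<le> w z" for z unfolding w_def using A0 g_nonneg by simp
    show "ereal \<bar>w' z\<bar> \<le> m" for z
    proof (cases "m = \<infinity>")
      case False
      then have "\<bar>w' z\<bar> \<le> 2" using m small[of z] abs_le_square_iff[of "w' z" 2] by simp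
      then show ?thesis using m False by (metis ereal_less_eq(3) order_trans)
    qed simp
    show "ereal \<bar>v z - lam\<bar> \<le> m" for z
    proof (cases "m = \<infinity>")
      case False
      then have "\<bar>v z - lam\<bar> \<le> 2" using m small[of z] by (simp add: v_def)
      then show ?thesis using m False by (metis ereal_less_eq(3) order_trans)
    qed simp
    have c2: "continuous_on UNIV (\<lambda>y. (g y)\<^sup>2)" "continuous_on UNIV (\<lambda>y. (g'' y)\<^sup>2)"
      by (intro continuous_intros continuous_g continuous_g'')+
    have I1: "(LINT z|?L. g (real n * z)) \<le> s ^ 7"
      using integral_scaled_periodic[OF continuous_g periodic_g(1) n] integral_g by simp
    have I2: "(LINT z|?L. (g (real n * z))\<^sup>2) \<le> s ^ 13"
      using integral_scaled_periodic[OF c2(1) _ n] integral_g_square by (simp add: periodic_g)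
    have I3: "(LINT z|?L. (g'' (real n * z))\<^sup>2) \<le> 921600 * s ^ 9"
      using integral_scaled_periodic[OF c2(2) _ n] integral_g''_square by (simp add: periodic_g)
    have i1: "integrable ?L (\<lambda>z. 2 * (rho - 1) * A * g (real n * z))"
      and i2: "integrable ?L (\<lambda>z. A\<^sup>2 * (g (real n * z))\<^sup>2)"
      and i3: "integrable ?L (\<lambda>z. h\<^sup>2 * A\<^sup>2 * n ^ 4 * (g'' (real n * z))\<^sup>2)"
      using scale[OF continuous_g] scale[OF continuous_g'']
      by (intro integrable continuous_intros; simp)+
    have "(LINT z|?L. 2 * (rho - 1) * w z + (w z)\<^sup>2 + (v z - lam + (w' z)\<^sup>2 / 2)\<^sup>2 + h\<^sup>2 * (w'' z)\<^sup>2)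
      = (LINT z|?L. 2 * (rho - 1) * A * g (real n * z) + A\<^sup>2 * (g (real n * z))\<^sup>2 + h\<^sup>2 * A\<^sup>2 * n ^ 4 * (g'' (real n * z))\<^sup>2)"
      by (intro Bochner_Integration.integral_cong refl) (simp add: v_def w_def w''_def power_mult_distrib flip: power_mult)
    also have "\<dots> = 2 * (rho - 1) * A * (LINT z|?L. g (real n * z)) + A\<^sup>2 * (LINT z|?L. (g (real n * z))\<^sup>2)
        + h\<^sup>2 * A\<^sup>2 * n ^ 4 * (LINT z|?L. (g'' (real n * z))\<^sup>2)"
      unfolding Bochner_Integration.integral_add[OF Bochner_Integration.integrable_add[OF i1 i2] i3]
        Bochner_Integration.integral_add[OF i1 i2] integral_mult_right_zero by simp
    also have "\<dots> \<le> 2 * (rho - 1) * A * s ^ 7 + A\<^sup>2 * s ^ 13 + h\<^sup>2 * A\<^sup>2 * n ^ 4 * (921600 * s ^ 9)"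
      using I1 I2 I3 rho A0 by (intro add_mono mult_left_mono) auto
    also have "\<dots> = B" by (simp add: B_def mult.assoc)
    finally show "(LINT z|?L. 2 * (rho - 1) * w z + (w z)\<^sup>2 + (v z - lam + (w' z)\<^sup>2 / 2)\<^sup>2 + h\<^sup>2 * (w'' z)\<^sup>2) \<le> B" .
  qed (use V cv perV per' cont in auto)
  also have "2 * pi * B \<le> 10 ^ 9 * ((rho - 1) * sqrt (lam * s ^ 3) / n + lam * s\<^sup>2 / n\<^sup>2 + h\<^sup>2 * lam * n\<^sup>2 / s\<^sup>2)"
  proof -
    have t2: "A\<^sup>2 * s ^ 13 \<le> 128 * (lam * s\<^sup>2 / n\<^sup>2)"
    proof -
      have "A\<^sup>2 * s ^ 13 \<le> 128 * lam / ((real n)\<^sup>2 * s ^ 11) * s ^ 13"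
        using A2le s by (intro mult_right_mono) auto
      also have "\<dots> = 128 * (lam * s\<^sup>2 / n\<^sup>2)" using s n0 by (simp add: eval_nat_numeral field_simps)
      finally show ?thesis .
    qed
    have t3: "h\<^sup>2 * (A\<^sup>2 * n ^ 4 * (921600 * s ^ 9)) \<le> 117964800 * (h\<^sup>2 * lam * n\<^sup>2 / s\<^sup>2)"
    proof -
      have "A\<^sup>2 * n ^ 4 * (921600 * s ^ 9) \<le> 128 * lam / ((real n)\<^sup>2 * s ^ 11) * n ^ 4 * (921600 * s ^ 9)"
        using A2le s by (intro mult_right_mono) auto
      also have "\<dots> = 117964800 * (lam * n\<^sup>2 / s\<^sup>2)" using s n0 by (simp add: eval_nat_numeral field_simps)
      finally have "h\<^sup>2 * (A\<^sup>2 * n ^ 4 * (921600 * s ^ 9)) \<le> h\<^sup>2 * (117964800 * (lam * n\<^sup>2 / s\<^sup>2))"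
        by (rule mult_left_mono) simp
      then show ?thesis by (simp add: mult_ac)
    qed
    have "A * s ^ 7 \<le> 12 * sqrt (lam * s ^ 3) / n"
    proof (rule power2_le_imp_le)
      have "(A * s ^ 7)\<^sup>2 = A\<^sup>2 * s ^ 14" by (simp add: power_mult_distrib flip: power_mult)
      also have "\<dots> \<le> 128 * lam / ((real n)\<^sup>2 * s ^ 11) * s ^ 14"
        using A2le s by (intro mult_right_mono) auto
      also have "\<dots> = 128 * (lam * s ^ 3 / n\<^sup>2)" using s n0 by (simp add: eval_nat_numeral field_simps)
      also have "\<dots> \<le> 144 * (lam * s ^ 3 / n\<^sup>2)" using s lam by (intro mult_right_mono) auto
      also have "\<dots> = (12 * sqrt (lam * s ^ 3) / n)\<^sup>2"
        using s lam by (simp add: power_divide power_mult_distrib)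
      finally show "(A * s ^ 7)\<^sup>2 \<le> (12 * sqrt (lam * s ^ 3) / n)\<^sup>2" .
    qed (use s lam in auto)
    then have "2 * (rho - 1) * (A * s ^ 7) \<le> 2 * (rho - 1) * (12 * sqrt (lam * s ^ 3) / n)"
      using rho by (intro mult_left_mono) auto
    moreover have "2 * (rho - 1) * (12 * sqrt (lam * s ^ 3) / n) = 24 * ((rho - 1) * sqrt (lam * s ^ 3) / n)"
      by (simp add: field_simps)
    ultimately have t1: "2 * (rho - 1) * (A * s ^ 7) \<le> 24 * ((rho - 1) * sqrt (lam * s ^ 3) / n)" by linarith
    have nn: "0 \<le> (rho - 1) * sqrt (lam * s ^ 3) / n" "0 \<le> lam * s\<^sup>2 / n\<^sup>2" "0 \<le> h\<^sup>2 * lam * n\<^sup>2 / s\<^sup>2"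
      using rho lam s by auto
    have B0: "0 \<le> B" unfolding B_def using rho A0 s by (intro add_nonneg_nonneg mult_nonneg_nonneg) auto
    have "2 * pi * B \<le> 8 * B" using pi_less_4 B0 by (intro mult_right_mono) auto
    moreover have "B \<le> 24 * ((rho - 1) * sqrt (lam * s ^ 3) / n) + 128 * (lam * s\<^sup>2 / n\<^sup>2)
        + 117964800 * (h\<^sup>2 * lam * n\<^sup>2 / s\<^sup>2)"
      unfolding B_def using t1 t2 t3 by linarith
    moreover have "x \<le> 10 ^ 9 * (a + b + c)"
      if "x \<le> 8 * B" "B \<le> 24 * a + 128 * b + 117964800 * c" "0 \<le> a" "0 \<le> b" "0 \<le> c" for x a b c :: real
      using that by simp
    ultimately show ?thesis using nn by blast
  qed
  then have "ereal (2 * pi * B) \<le> ereal (10 ^ 9 * ((rho - 1) * sqrt (lam * s ^ 3) / n + lam * s\<^sup>2 / n\<^sup>2 + h\<^sup>2 * lam * n\<^sup>2 / s\<^sup>2))"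
    by simp
  finally show ?thesis .
qed

lemma powr_frac_power:
  assumes "0 < (x::real)" "a * real n = real k" shows "(x powr a) ^ n = x ^ k"
proof -
  have "(x powr a) ^ n = x powr (a * real n)" using assms(1) by (simp add: powr_power mult.commute)
  then show ?thesis unfolding assms(2) using assms(1) by (simp add: powr_realpow)
qed

text \<open>Integer powers free the two scaling laws from fractional exponents; the arithmetic below uses them in
this form only.\<close>

lemma scaling_powers:
  fixes r h lam :: real
  assumes "0 < r" "0 < h" "0 < lam"
  shows "(r powr (4/7) * h powr (6/7) * lam powr (5/7)) ^ 7 = r ^ 4 * h ^ 6 * lam ^ 5"
    and "(r powr (2/3) * h powr (2/3) * lam) ^ 3 = r\<^sup>2 * h\<^sup>2 * lam ^ 3"
  using assms powr_frac_power[of r "4/7" 7 4] powr_frac_power[of h "6/7" 7 6] powr_frac_power[of lam "5/7" 7 5]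
    powr_frac_power[of r "2/3" 3 2] powr_frac_power[of h "2/3" 3 2]
  by (simp_all add: power_mult_distrib)

lemma pow_le_cancel: "(a::real) ^ n \<le> b ^ n \<Longrightarrow> 0 \<le> b \<Longrightarrow> 0 < n \<Longrightarrow> a \<le> b"
  by (cases n) (auto intro: power_le_imp_le_base)

text \<open>With \<open>S = r A + h\<^sup>2 B\<close>, the seventh power of the scaling law is at most
\<open>4 (r A)\<^sup>4 (h\<^sup>2 B)\<^sup>3 \<le> 4 S\<^sup>7\<close>.\<close>

lemma slice_bound_one_fold:
  fixes r h lam A B D X :: real
  assumes pos: "0 < r" "0 < h" "0 < lam" "0 \<le> A" "0 \<le> B" "lam \<le> D" and D: "D ^ 5 \<le> 4 * A ^ 4 * B ^ 3"
    and X: "X ^ 7 = r ^ 4 * h ^ 6 * lam ^ 5"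
  shows "X / 2 \<le> r * A + h\<^sup>2 * B"
proof -
  define S where "S = r * A + h\<^sup>2 * B"
  have S: "r * A \<le> S" "h\<^sup>2 * B \<le> S" "0 \<le> r * A" "0 \<le> h\<^sup>2 * B" using pos by (auto simp: S_def)
  have "lam ^ 5 \<le> D ^ 5" using pos by (intro power_mono) auto
  then have "lam ^ 5 \<le> 4 * A ^ 4 * B ^ 3" using D by (rule order_trans)
  then have "X ^ 7 \<le> r ^ 4 * h ^ 6 * (4 * A ^ 4 * B ^ 3)"
    unfolding X using pos by (intro mult_left_mono) auto
  also have "\<dots> = 4 * ((r * A) ^ 4 * (h\<^sup>2 * B) ^ 3)" by (simp add: power_mult_distrib flip: power_mult)
  also have "\<dots> \<le> 4 * (S ^ 4 * S ^ 3)" using S by (intro mult_left_mono mult_mono power_mono) auto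
  also have "\<dots> = 4 * S ^ 7" by (simp flip: power_add)
  also have "\<dots> \<le> 128 * S ^ 7" using S by (intro mult_right_mono) auto
  also have "\<dots> = (2 * S) ^ 7" by (simp add: power_mult_distrib)
  finally have "X \<le> 2 * S" using S by (intro pow_le_cancel[of X 7]) auto
  then show ?thesis by (simp add: S_def)
qed

text \<open>The choice \<open>\<tau>\<^sup>2 = Y / r\<close> with \<open>Y\<^sup>3 = (r h)\<^sup>2\<close> balances the two terms: both are then at most a multiple
of \<open>S / Y\<close>, where \<open>S = r A + h\<^sup>2 B\<close>.\<close>

lemma slice_bound_many_folds:
  fixes r h lam A B D X m :: real
  assumes pos: "0 < r" "0 < h" "0 < lam" "0 \<le> A" "0 \<le> B" "lam \<le> D" "0 < X"
    and D: "\<And>\<tau>. 0 < \<tau> \<Longrightarrow> D \<le> 2 * \<tau> * sqrt (B * A) + m\<^sup>2 * A / \<tau>\<^sup>2"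
    and X: "X ^ 3 = r\<^sup>2 * h\<^sup>2 * lam ^ 3"
  shows "X / (1 + m\<^sup>2) \<le> r * A + h\<^sup>2 * B"
proof -
  define S where "S = r * A + h\<^sup>2 * B"
  have S: "r * A \<le> S" "0 \<le> r * A" "0 \<le> S" using pos by (auto simp: S_def)
  define Y where "Y = X / lam"
  have Y: "0 < Y" "Y ^ 3 = r\<^sup>2 * h\<^sup>2" using pos X by (auto simp: Y_def power_divide)
  define \<tau> where "\<tau> = sqrt (Y / r)"
  have \<tau>: "0 < \<tau>" "\<tau>\<^sup>2 = Y / r" using Y pos by (auto simp: \<tau>_def)
  have "2 * \<tau> * sqrt (B * A) \<le> S / Y"
  proof (rule power2_le_imp_le)
    have "(2 * \<tau> * sqrt (B * A))\<^sup>2 = 4 * (Y / r) * (B * A)" using pos \<tau> by (simp add: power_mult_distrib)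
    also have "\<dots> = Y / (r\<^sup>2 * h\<^sup>2) * (4 * (r * A) * (h\<^sup>2 * B))" using pos by (simp add: field_simps power2_eq_square)
    also have "\<dots> \<le> Y / (r\<^sup>2 * h\<^sup>2) * S\<^sup>2"
    proof (rule mult_left_mono)
      show "4 * (r * A) * (h\<^sup>2 * B) \<le> S\<^sup>2"
        using zero_le_power2[of "r * A - h\<^sup>2 * B"] by (simp add: S_def power2_eq_square algebra_simps)
    qed (use Y in auto)
    also have "\<dots> = (S / Y)\<^sup>2"
      unfolding Y(2)[symmetric] using Y(1) by (simp add: power_divide power2_eq_square power3_eq_cube)
    finally show "(2 * \<tau> * sqrt (B * A))\<^sup>2 \<le> (S / Y)\<^sup>2" .
  qed (use S Y in auto)
  moreover have "m\<^sup>2 * A / \<tau>\<^sup>2 \<le> m\<^sup>2 * (S / Y)"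
  proof -
    have "m\<^sup>2 * A / \<tau>\<^sup>2 = m\<^sup>2 * (r * A / Y)" using pos Y by (simp add: \<tau>(2))
    also have "\<dots> \<le> m\<^sup>2 * (S / Y)" using S Y by (intro mult_left_mono divide_right_mono) auto
    finally show ?thesis .
  qed
  ultimately have "lam \<le> (1 + m\<^sup>2) * (S / Y)" using D[OF \<tau>(1)] pos(6) by (simp add: algebra_simps)
  then have "lam * Y \<le> (1 + m\<^sup>2) * S" using Y by (simp add: field_simps)
  then have "X \<le> S * (1 + m\<^sup>2)" using pos by (simp add: Y_def mult.commute)
  moreover have "0 < 1 + m\<^sup>2" by (smt (verit) zero_le_power2)
  ultimately show ?thesis by (simp add: S_def divide_le_eq)
qed

lemma excess_lower_bound:
  fixes h lam rho \<kappa> :: real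
  assumes pos: "0 < h" "0 < lam" "1 < rho"
    and \<kappa>: "\<And>A B D. 0 \<le> A \<Longrightarrow> 0 \<le> B \<Longrightarrow> lam \<le> D \<Longrightarrow> D ^ 5 \<le> 4 * A ^ 4 * B ^ 3 \<Longrightarrow>
       (\<And>m' \<tau>. m = ereal m' \<Longrightarrow> 0 < \<tau> \<Longrightarrow> D \<le> 2 * \<tau> * sqrt (B * A) + m'\<^sup>2 * A / \<tau>\<^sup>2) \<Longrightarrow>
       \<kappa> \<le> (rho - 1) * A + h\<^sup>2 * B"
    and R: "0 \<le> R" "R \<le> C * min (lam\<^sup>2 / 4) \<kappa>" "0 < C"
  shows "ereal R \<le> ereal C * excess_energy h lam rho m"
proof -
  have "ereal (E_bulk rho + 2 * pi * min (lam\<^sup>2 / 4) \<kappa>) \<le> min_E_vKD h lam rho m"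
    unfolding min_E_vKD_def by (rule INF_greatest) (rule energy_lower_bound[OF _ pos \<kappa>])
  then have "ereal (E_bulk rho + 2 * pi * min (lam\<^sup>2 / 4) \<kappa>) - ereal (E_bulk rho) \<le> excess_energy h lam rho m"
    unfolding excess_energy_def by (rule ereal_minus_mono) simp
  then have e: "ereal (2 * pi * min (lam\<^sup>2 / 4) \<kappa>) \<le> excess_energy h lam rho m" by simp
  have "0 \<le> C * min (lam\<^sup>2 / 4) \<kappa>" using R by linarith
  then have k0: "0 \<le> min (lam\<^sup>2 / 4) \<kappa>" using R(3) by (simp add: zero_le_mult_iff)
  have "R \<le> C * (1 * min (lam\<^sup>2 / 4) \<kappa>)" using R by simp
  also have "\<dots> \<le> C * (2 * pi * min (lam\<^sup>2 / 4) \<kappa>)"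
    using k0 R(3) pi_gt3 by (intro mult_left_mono mult_right_mono) auto
  finally have "ereal R \<le> ereal C * ereal (2 * pi * min (lam\<^sup>2 / 4) \<kappa>)" by simp
  also have "\<dots> \<le> ereal C * excess_energy h lam rho m"
    using e R(3) by (intro ereal_mult_left_mono) auto
  finally show ?thesis .
qed

text \<open>The threshold on \<open>r\<close> in terms of the optimal fold length \<open>l = h sqrt (lam/X)\<close>: it says \<open>l\<^sup>2 \<le> h\<close>,
which makes the term \<open>lam l\<^sup>2\<close> at most the bending term \<open>h\<^sup>2 lam / l\<^sup>2\<close>.\<close>

lemma one_fold_scale:
  fixes r h lam X :: real
  assumes pos: "0 < h" "0 < lam" "0 < X" and X: "X ^ 7 = r ^ 4 * h ^ 6 * lam ^ 5" and c0: "lam\<^sup>2 * h \<le> r ^ 4"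
  shows "h * lam \<le> X"
proof (rule pow_le_cancel[of _ 7])
  have "(h * lam) ^ 7 = (lam\<^sup>2 * h) * (h ^ 6 * lam ^ 5)" by (simp add: eval_nat_numeral)
  also have "\<dots> \<le> r ^ 4 * (h ^ 6 * lam ^ 5)" using c0 pos by (intro mult_right_mono) auto
  finally show "(h * lam) ^ 7 \<le> X ^ 7" by (simp add: X mult.assoc)
qed (use pos in auto)

text \<open>One fold per period, of length \<open>K l\<close>, where \<open>l = h sqrt (lam/X)\<close> is the length at which the mandrel term
\<open>r sqrt (lam l\<^sup>3)\<close> and the bending term \<open>h\<^sup>2 lam / l\<^sup>2\<close> both equal \<open>X\<close>. The factor \<open>K\<close> leaves
room to lower the slope.\<close>

lemma one_fold_upper_bound:
  fixes h lam rho X K :: real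
  assumes pos: "0 < h" "0 < lam" "1 < rho" "0 < X" "1 \<le> K"
    and X: "X ^ 7 = (rho - 1) ^ 4 * h ^ 6 * lam ^ 5"
    and c0: "lam\<^sup>2 * h \<le> (rho - 1) ^ 4"
    and K: "K * (h * sqrt (lam / X)) \<le> 1"
    and m: "m = \<infinity> \<or> 40000 * lam \<le> K * (h * sqrt (lam / X)) \<and> ereal 2 \<le> m"
  shows "excess_energy h lam rho m \<le> ereal (3 * 10 ^ 9 * K\<^sup>2 * X)"
proof -
  define r l where "r = rho - 1" and "l = h * sqrt (lam / X)"
  have r: "0 < r" using pos by (simp add: r_def)
  have l0: "0 < l" using pos by (simp add: l_def)
  have l2: "l\<^sup>2 = h\<^sup>2 * lam / X" using pos by (simp add: l_def power_mult_distrib)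
  have hX: "h * lam \<le> X" by (rule one_fold_scale[OF pos(1,2,4) X c0])
  have e3: "h\<^sup>2 * lam / l\<^sup>2 = X" using pos by (simp add: l2)
  have e2: "lam * l\<^sup>2 \<le> X"
  proof -
    have "lam * l\<^sup>2 = (h * lam)\<^sup>2 / X" unfolding l2 by (simp add: power_mult_distrib power2_eq_square)
    also have "\<dots> \<le> X\<^sup>2 / X" using hX pos by (intro divide_right_mono power_mono) auto
    finally show ?thesis using pos by (simp add: power2_eq_square)
  qed
  have e1: "r * sqrt (lam * l ^ 3) = X"
  proof -
    have "(r\<^sup>2 * lam * l ^ 3)\<^sup>2 = r ^ 4 * lam\<^sup>2 * (l\<^sup>2) ^ 3" by (simp add: power_mult_distrib flip: power_mult)
    also have "\<dots> = (r ^ 4 * h ^ 6 * lam ^ 5) / X ^ 3" unfolding l2 by (simp add: power_divide power_mult_distrib eval_nat_numeral)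
    also have "\<dots> = X ^ 7 / X ^ 3" by (simp add: X r_def)
    also have "\<dots> = (X\<^sup>2)\<^sup>2" using pos by (simp add: eval_nat_numeral)
    finally have "r\<^sup>2 * lam * l ^ 3 = X\<^sup>2" by (rule power2_eq_imp_eq) (use r l0 pos in auto)
    then have "(r * sqrt (lam * l ^ 3))\<^sup>2 = X\<^sup>2" using l0 pos by (simp add: power_mult_distrib mult.assoc)
    then show ?thesis by (rule power2_eq_imp_eq) (use r l0 pos in auto)
  qed
  have b1: "r * sqrt (lam * (K * l) ^ 3) \<le> K\<^sup>2 * X"
  proof -
    have "sqrt (K ^ 3) \<le> K\<^sup>2"
    proof (rule real_le_lsqrt)
      have "K ^ 3 \<le> K ^ 4" using pos by (intro power_increasing) auto
      then show "K ^ 3 \<le> (K\<^sup>2)\<^sup>2" by (simp flip: power_mult)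
    qed simp
    then have "sqrt (K ^ 3) * (r * sqrt (lam * l ^ 3)) \<le> K\<^sup>2 * (r * sqrt (lam * l ^ 3))"
      using r l0 pos by (intro mult_right_mono) auto
    then show ?thesis unfolding e1 by (simp add: power_mult_distrib real_sqrt_mult mult_ac flip: e1)
  qed
  have b2: "lam * (K * l)\<^sup>2 \<le> K\<^sup>2 * X"
    using mult_left_mono[OF e2, of "K\<^sup>2"] by (simp add: power_mult_distrib mult_ac)
  have b3: "h\<^sup>2 * lam / (K * l)\<^sup>2 \<le> K\<^sup>2 * X"
  proof -
    have K1: "1 \<le> K\<^sup>2" using pos by (simp add: one_le_power)
    have "h\<^sup>2 * lam / (K * l)\<^sup>2 = h\<^sup>2 * lam / l\<^sup>2 / K\<^sup>2" by (simp add: power_mult_distrib mult.commute)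
    then have "h\<^sup>2 * lam / (K * l)\<^sup>2 = X / K\<^sup>2" unfolding e3 .
    also have "\<dots> \<le> X / 1" using K1 pos by (intro divide_left_mono) auto
    also have "\<dots> \<le> K\<^sup>2 * X" using K1 pos by simp
    finally show ?thesis .
  qed
  have "excess_energy h lam rho m \<le> ereal (10 ^ 9 * ((rho - 1) * sqrt (lam * (K * l) ^ 3) / real 1
      + lam * (K * l)\<^sup>2 / real (1\<^sup>2) + h\<^sup>2 * lam * real (1\<^sup>2) / (K * l)\<^sup>2))"
    by (rule localized_upper_bound) (use pos K l0 m in \<open>simp_all add: l_def\<close>)
  also have "\<dots> \<le> ereal (3 * 10 ^ 9 * K\<^sup>2 * X)"
    using b1 b2 b3 by (simp add: r_def)
  finally show ?thesis .
qed

text \<open>The optimal length of a fold of slope of order one is \<open>l\<close> with \<open>r l\<^sup>3 = h\<^sup>2\<close>, and then the mandrel term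
\<open>r lam l\<close> and the bending term \<open>h\<^sup>2 lam / l\<^sup>2\<close> agree. The number of folds is the least that is
compatible with the slope bound. If the folds would overfill the period, \<open>lam\<close> is bounded
below, and the sinusoidal profile with folds of length about \<open>l\<close> does as well.\<close>

lemma many_folds_upper_bound:
  fixes h lam rho X m :: real
  assumes pos: "0 < h" "0 < lam" "lam \<le> 1/2" "1 < rho" "0 < X" "2 \<le> m"
    and X: "X ^ 3 = (rho - 1)\<^sup>2 * h\<^sup>2 * lam ^ 3"
    and c0: "h \<le> (rho - 1)\<^sup>2" and loc: "h\<^sup>2 < (rho - 1) * lam ^ 3"
  shows "excess_energy h lam rho (ereal m) \<le> ereal (10 ^ 14 * X)"
proof -
  define r l K where "r = rho - 1" and "l = X / (r * lam)" and "K = (40000 :: real)"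
  have r: "0 < r" using pos by (simp add: r_def)
  have l0: "0 < l" using pos r by (simp add: l_def)
  have Xl: "X = r * lam * l" using pos r by (simp add: l_def)
  have l3: "r * l ^ 3 = h\<^sup>2"
  proof -
    have "r ^ 3 * lam ^ 3 * l ^ 3 = r\<^sup>2 * h\<^sup>2 * lam ^ 3" using X unfolding Xl by (simp add: power_mult_distrib r_def)
    then have "(r\<^sup>2 * lam ^ 3) * (r * l ^ 3) = (r\<^sup>2 * lam ^ 3) * h\<^sup>2" by (simp add: eval_nat_numeral mult_ac)
    then show ?thesis using r pos by simp
  qed
  have ll: "l < lam"
  proof -
    have "r * l ^ 3 < r * lam ^ 3" using loc l3 by (simp add: r_def)
    then have "l ^ 3 < lam ^ 3" using r by simp
    then show ?thesis by (rule power_less_imp_less_base) (use pos in auto)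
  qed
  have e3: "h\<^sup>2 * lam / l\<^sup>2 = X"
    unfolding Xl l3[symmetric] using l0 by (simp add: field_simps eval_nat_numeral)
  have lh: "l\<^sup>2 \<le> h"
  proof (rule pow_le_cancel[of _ 3])
    have "r\<^sup>2 * (l\<^sup>2) ^ 3 = (r * l ^ 3)\<^sup>2" by (simp add: power_mult_distrib flip: power_mult)
    also have "\<dots> = h * h ^ 3" unfolding l3 by (simp add: eval_nat_numeral)
    also have "\<dots> \<le> r\<^sup>2 * h ^ 3" using c0 pos by (intro mult_right_mono) (auto simp: r_def)
    finally show "(l\<^sup>2) ^ 3 \<le> h ^ 3" using r by simp
  qed (use pos in auto)
  have e2: "lam * l\<^sup>2 \<le> X"
  proof -
    have "l\<^sup>2 * l\<^sup>2 \<le> h * h" using lh by (intro mult_mono) (use pos in auto)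
    then have "lam * (l\<^sup>2 * l\<^sup>2) \<le> lam * h\<^sup>2" using pos by (simp add: power2_eq_square)
    then have "lam * l\<^sup>2 \<le> h\<^sup>2 * lam / l\<^sup>2" using l0 by (simp add: field_simps)
    then show ?thesis using e3 by simp
  qed
  have total: "10 ^ 9 * (a + b + c) \<le> 10 ^ 14 * X" if "a \<le> (K + 1) * X" "b \<le> X" "c \<le> 4 * X" for a b c :: real
    using that pos(5) by (simp add: K_def)
  show ?thesis
  proof (cases "(K + 1) * lam \<le> 1")
    case True
    define n where "n = nat \<lceil>K * lam / l\<rceil>"
    have q: "0 < K * lam / l" using pos l0 by (simp add: K_def)
    have n1: "K * lam / l \<le> real n" unfolding n_def by (rule real_nat_ceiling_ge)
    have n2: "real n < K * lam / l + 1" unfolding n_def using q by linarith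
    have n: "1 \<le> n" using n1 q by (cases n) auto
    define s where "s = n * l"
    have s1: "K * lam \<le> s" using n1 l0 by (simp add: s_def field_simps)
    have "s \<le> K * lam + l" using n2 l0 by (simp add: s_def field_simps)
    then have s2: "s \<le> (K + 1) * lam" using ll by (simp add: algebra_simps)
    have s0: "0 < s" using n l0 by (simp add: s_def)
    have sn: "s / n = l" using n by (simp add: s_def)
    have "excess_energy h lam rho (ereal m) \<le> ereal (10 ^ 9 * (r * sqrt (lam * s ^ 3) / n + lam * s\<^sup>2 / n\<^sup>2 + h\<^sup>2 * lam * n\<^sup>2 / s\<^sup>2))"
      unfolding r_def using s0 s1 s2 True pos n by (intro localized_upper_bound) (auto simp: K_def)
    also have "\<dots> \<le> ereal (10 ^ 14 * X)"
    proof -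
      have "sqrt (lam * s) \<le> (K + 1) * lam"
      proof (rule real_le_lsqrt)
        have "lam * s \<le> lam * ((K + 1) * lam)" using s2 pos by (intro mult_left_mono) auto
        also have "\<dots> \<le> (K + 1) * (lam * ((K + 1) * lam))"
          using pos by (simp add: K_def)
        finally show "lam * s \<le> ((K + 1) * lam)\<^sup>2" by (simp add: power2_eq_square mult_ac)
      qed (use pos in \<open>simp add: K_def\<close>)
      then have "r * (sqrt (lam * s) * l) \<le> r * ((K + 1) * lam * l)"
        using r l0 by (intro mult_left_mono mult_right_mono) auto
      moreover have "sqrt (lam * s ^ 3) / n = sqrt (lam * s) * l"
      proof -
        have "sqrt (lam * s ^ 3) = sqrt (lam * s * s\<^sup>2)" by (simp add: eval_nat_numeral mult_ac)
        also have "\<dots> = sqrt (lam * s) * s" using s0 by (simp only: real_sqrt_mult real_sqrt_abs abs_of_pos)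
        finally have "sqrt (lam * s ^ 3) / n = sqrt (lam * s) * (s / n)" by simp
        then show ?thesis unfolding sn .
      qed
      ultimately have t1: "r * sqrt (lam * s ^ 3) / n \<le> (K + 1) * X"
        by (simp add: Xl mult_ac flip: times_divide_eq_right)
      have t2: "lam * s\<^sup>2 / real (n\<^sup>2) \<le> X"
        using e2 sn by (simp add: power_divide[symmetric] flip: times_divide_eq_right)
      have "h\<^sup>2 * lam * n\<^sup>2 / s\<^sup>2 = h\<^sup>2 * lam / l\<^sup>2" using n l0 by (simp add: s_def power_mult_distrib field_simps)
      then have t3: "h\<^sup>2 * lam * n\<^sup>2 / s\<^sup>2 \<le> 4 * X" using e3 pos(5) by simp
      show ?thesis using total[OF t1 t2 t3] by simp
    qed
    finally show ?thesis .
  next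
    case False
    define n where "n = nat \<lceil>1 / l\<rceil>"
    have l1: "l \<le> 1/2" using ll pos by linarith
    have q: "2 \<le> 1 / l" using l1 l0 by (simp add: field_simps)
    have n1: "1 / l \<le> real n" unfolding n_def by (rule real_nat_ceiling_ge)
    have "real n < 1 / l + 1" unfolding n_def using q by linarith
    then have n2: "real n \<le> 2 / l" using q by simp
    have n: "1 \<le> n" using n1 q by linarith
    have n0: "0 < real n" using n by simp
    have nl: "1 / n \<le> l" using n1 l0 n0 by (simp add: field_simps)
    have "excess_energy h lam rho (ereal m) \<le> ereal (2048 * (r * sqrt lam / n + lam / n\<^sup>2 + h\<^sup>2 * lam * n\<^sup>2))"
      unfolding r_def using pos n by (intro sinusoidal_upper_bound) auto
    also have "\<dots> \<le> ereal (10 ^ 14 * X)"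
    proof -
      have "sqrt lam \<le> (K + 1) * lam"
      proof (rule real_le_lsqrt)
        have "1 * 1 \<le> (K + 1) * ((K + 1) * lam)" using False by (intro mult_mono) (auto simp: K_def)
        then have "lam * 1 \<le> lam * ((K + 1) * ((K + 1) * lam))" using pos by (intro mult_left_mono) auto
        then show "lam \<le> ((K + 1) * lam)\<^sup>2" by (simp add: power2_eq_square mult_ac)
      qed (use pos in \<open>simp add: K_def\<close>)
      then have "r * (sqrt lam * (1 / n)) \<le> r * ((K + 1) * lam * l)"
        using r nl pos by (intro mult_left_mono mult_mono) (auto simp: K_def)
      then have t1: "r * sqrt lam / n \<le> (K + 1) * X" by (simp add: Xl mult_ac)
      have "lam * (1 / n)\<^sup>2 \<le> lam * l\<^sup>2" using nl pos by (intro mult_left_mono power_mono) auto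
      then have t2: "lam / n\<^sup>2 \<le> X" using e2 by (simp add: power_divide)
      have "(real n)\<^sup>2 \<le> (2 / l)\<^sup>2" using n2 by (rule power_mono) simp
      then have "h\<^sup>2 * lam * n\<^sup>2 \<le> h\<^sup>2 * lam * (2 / l)\<^sup>2" using pos by (intro mult_left_mono) auto
      also have "\<dots> = 4 * (h\<^sup>2 * lam / l\<^sup>2)" by (simp add: power_divide)
      finally have t3: "h\<^sup>2 * lam * n\<^sup>2 \<le> 4 * X" using e3 by simp
      have "2048 * (a + b + c) \<le> 10 ^ 14 * X" if "a \<le> (K + 1) * X" "b \<le> X" "c \<le> 4 * X" for a b c :: real
        using that pos(5) by (simp add: K_def)
      from this[OF t1 t2 t3] show ?thesis by simp
    qed
    finally show ?thesis .
  qed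
qed


text \<open>If \<open>max X1 X2\<close> is not much smaller than \<open>lam\<^sup>2\<close>, the unbuckled cylinder suffices. Otherwise the sign of
\<open>r lam\<^sup>3 - h\<^sup>2\<close> decides between one fold and many, and in each case either part of the threshold
implies the one that is needed.\<close>

lemma bounded_slope_upper_bound:
  fixes h lam rho m X1 X2 :: real
  assumes pos: "0 < h" "0 < lam" "lam \<le> 1/2" "1 < rho" "2 \<le> m" "0 < X1" "0 < X2"
    and X1: "X1 ^ 7 = (rho - 1) ^ 4 * h ^ 6 * lam ^ 5" and X2: "X2 ^ 3 = (rho - 1)\<^sup>2 * h\<^sup>2 * lam ^ 3"
    and c0: "lam\<^sup>2 * h \<le> (rho - 1) ^ 4 \<or> h \<le> (rho - 1)\<^sup>2"
  shows "excess_energy h lam rho (ereal m) \<le> ereal (10 ^ 20 * min (lam\<^sup>2) (max X1 X2))"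
proof -
  define r K where "r = rho - 1" and "K = (40000 :: real)"
  have r: "0 < r" using pos by (simp add: r_def)
  let ?X = "max X1 X2"
  show ?thesis
  proof (cases "lam\<^sup>2 \<le> K\<^sup>2 * ?X")
    case True
    have "lam\<^sup>2 \<le> K\<^sup>2 * lam\<^sup>2" by (simp add: K_def)
    with True have "lam\<^sup>2 \<le> K\<^sup>2 * min (lam\<^sup>2) ?X" by (auto simp: min_def)
    moreover have "2 * pi * lam\<^sup>2 \<le> 8 * lam\<^sup>2" using pi_less_4 by (intro mult_right_mono) auto
    moreover have "0 \<le> min (lam\<^sup>2) ?X" using pos by (auto simp: le_max_iff_disj)
    ultimately have "2 * pi * lam\<^sup>2 \<le> 10 ^ 20 * min (lam\<^sup>2) ?X" by (simp add: K_def)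
    moreover have "excess_energy h lam rho (ereal m) \<le> ereal (2 * pi * lam\<^sup>2)"
      by (rule unbuckled_upper_bound) (use pos in auto)
    ultimately show ?thesis by (meson ereal_less_eq(3) order_trans)
  next
    case False
    then have small: "K\<^sup>2 * ?X < lam\<^sup>2" by simp
    have "1 * ?X \<le> K\<^sup>2 * ?X" using pos by (intro mult_right_mono) (auto simp: K_def le_max_iff_disj)
    then have R: "min (lam\<^sup>2) ?X = ?X" using small by simp
    show ?thesis
    proof (cases "r * lam ^ 3 \<le> h\<^sup>2")
      case True
      have c0': "lam\<^sup>2 * h \<le> r ^ 4"
        using c0
      proof
        assume "h \<le> (rho - 1)\<^sup>2"
        then have hr: "h \<le> r\<^sup>2" by (simp add: r_def)
        have "h * (lam\<^sup>2) ^ 3 \<le> r\<^sup>2 * (lam\<^sup>2) ^ 3" using hr by (intro mult_right_mono) auto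
        also have "\<dots> = (r * lam ^ 3)\<^sup>2" by (simp add: power_mult_distrib flip: power_mult)
        also have "\<dots> \<le> (h\<^sup>2)\<^sup>2" using True r pos by (intro power_mono) auto
        also have "\<dots> = h * h ^ 3" by (simp add: eval_nat_numeral)
        finally have "(lam\<^sup>2) ^ 3 \<le> h ^ 3" using pos by simp
        then have "lam\<^sup>2 \<le> h" by (rule pow_le_cancel) (use pos in auto)
        then have "lam\<^sup>2 * h \<le> r\<^sup>2 * r\<^sup>2" using hr pos by (intro mult_mono) auto
        then show ?thesis by (simp flip: power_add)
      qed (simp add: r_def)
      define l where "l = h * sqrt (lam / X1)"
      have l0: "0 < l" using pos by (simp add: l_def)
      have l2: "l\<^sup>2 = h\<^sup>2 * lam / X1" using pos by (simp add: l_def power_mult_distrib)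
      have hX: "h * lam \<le> X1" by (rule one_fold_scale[OF pos(1,2,6) X1 c0'[unfolded r_def]])
      have "K * l \<le> 1"
      proof (rule power2_le_imp_le)
        have "(K * l)\<^sup>2 * (X1 * lam) = K\<^sup>2 * (h * lam)\<^sup>2"
          unfolding power_mult_distrib l2 using pos by (simp add: power2_eq_square)
        also have "\<dots> \<le> K\<^sup>2 * X1\<^sup>2" using hX pos by (intro mult_left_mono power_mono) auto
        also have "\<dots> = K\<^sup>2 * X1 * X1" by (simp add: power2_eq_square)
        also have "\<dots> \<le> lam\<^sup>2 * X1"
          using small pos mult_left_mono[of X1 ?X "K\<^sup>2"] by (intro mult_right_mono) auto
        also have "\<dots> \<le> 1\<^sup>2 * (X1 * lam)"
          using pos by (simp add: power2_eq_square)
        finally show "(K * l)\<^sup>2 \<le> 1\<^sup>2" by (rule mult_right_le_imp_le) (use pos in simp)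
      qed simp
      moreover have "lam \<le> l"
      proof (rule power2_le_imp_le)
        have "lam * X1 \<le> h\<^sup>2"
        proof (rule pow_le_cancel[of _ 7])
          have "(lam * X1) ^ 7 = (r * lam ^ 3) ^ 4 * h ^ 6"
            by (simp add: power_mult_distrib X1 r_def flip: power_mult)
          also have "\<dots> \<le> (h\<^sup>2) ^ 4 * h ^ 6" using True r pos by (intro mult_right_mono power_mono) auto
          finally show "(lam * X1) ^ 7 \<le> (h\<^sup>2) ^ 7" by (simp flip: power_mult power_add)
        qed (use pos in auto)
        then have "lam * (lam * X1) \<le> lam * h\<^sup>2" using pos by (intro mult_left_mono) auto
        then show "lam\<^sup>2 \<le> l\<^sup>2" unfolding l2 using pos by (simp add: power2_eq_square le_divide_eq mult_ac)
      qed (use l0 in simp)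
      ultimately have "excess_energy h lam rho (ereal m) \<le> ereal (3 * 10 ^ 9 * K\<^sup>2 * X1)"
        using pos c0' by (intro one_fold_upper_bound X1) (auto simp: K_def l_def r_def)
      also have "\<dots> \<le> ereal (10 ^ 20 * ?X)" using pos by (simp add: K_def le_max_iff_disj)
      finally show ?thesis unfolding R .
    next
      case False
      have c0': "h \<le> r\<^sup>2"
        using c0
      proof
        assume "lam\<^sup>2 * h \<le> (rho - 1) ^ 4"
        then have lr: "lam\<^sup>2 * h \<le> r ^ 4" by (simp add: r_def)
        show ?thesis
        proof (cases "h \<le> lam\<^sup>2")
          case True
          then have "h * h \<le> lam\<^sup>2 * h" using pos by (intro mult_right_mono) auto
          then have "h\<^sup>2 \<le> (r\<^sup>2)\<^sup>2" using lr by (simp add: power2_eq_square eval_nat_numeral)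
          then show ?thesis by (rule power2_le_imp_le) simp
        next
          case hl: False
          have "h * h ^ 3 = (h\<^sup>2)\<^sup>2" by (simp add: eval_nat_numeral)
          also have "\<dots> \<le> (r * lam ^ 3)\<^sup>2" using False pos by (intro power_mono) auto
          also have "\<dots> = r\<^sup>2 * (lam\<^sup>2) ^ 3" by (simp add: power_mult_distrib flip: power_mult)
          also have "\<dots> \<le> r\<^sup>2 * h ^ 3" using hl by (intro mult_left_mono power_mono) auto
          finally show ?thesis using pos by simp
        qed
      qed (simp add: r_def)
      have "excess_energy h lam rho (ereal m) \<le> ereal (10 ^ 14 * X2)"
        using pos c0' False by (intro many_folds_upper_bound X2) (auto simp: r_def)
      also have "\<dots> \<le> ereal (10 ^ 20 * ?X)" using pos by (simp add: max_def)
      finally show ?thesis unfolding R .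
    qed
  qed
qed

lemma unbounded_slope_upper_bound:
  fixes h lam rho X :: real
  assumes pos: "0 < h" "h \<le> 1/2" "0 < lam" "lam \<le> 1/2" "1 < rho" "0 < X"
    and X: "X ^ 7 = (rho - 1) ^ 4 * h ^ 6 * lam ^ 5" and c0: "lam\<^sup>2 * h \<le> (rho - 1) ^ 4"
  shows "excess_energy h lam rho \<infinity> \<le> ereal (10 ^ 20 * min (lam\<^sup>2) X)"
proof -
  have hX: "h * lam \<le> X" by (rule one_fold_scale[OF pos(1,3,6) X c0])
  have "h * sqrt (lam / X) \<le> 1"
  proof (rule power2_le_imp_le)
    have "h * lam * h \<le> X * 1" using hX pos by (intro mult_mono) auto
    then show "(h * sqrt (lam / X))\<^sup>2 \<le> 1\<^sup>2" using pos by (simp add: power_mult_distrib power2_eq_square mult_ac)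
  qed simp
  then have "excess_energy h lam rho \<infinity> \<le> ereal (3 * 10 ^ 9 * 1\<^sup>2 * X)"
    using pos by (intro one_fold_upper_bound X c0) auto
  also have "\<dots> \<le> ereal (10 ^ 20 * X)" using pos by simp
  finally have a: "excess_energy h lam rho \<infinity> \<le> ereal (10 ^ 20 * X)" .
  have "2 * pi * lam\<^sup>2 \<le> 10 ^ 20 * lam\<^sup>2" using pi_less_4 by (intro mult_right_mono) auto
  then have "ereal (2 * pi * lam\<^sup>2) \<le> ereal (10 ^ 20 * lam\<^sup>2)" by simp
  with unbuckled_upper_bound[of lam \<infinity> h rho] pos
  have b: "excess_energy h lam rho \<infinity> \<le> ereal (10 ^ 20 * lam\<^sup>2)" by (auto intro: order_trans)
  show ?thesis using a b unfolding min_def by (cases "lam\<^sup>2 \<le> X") simp_all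
qed

lemma scaling_positive:
  fixes r h lam :: real
  assumes "0 < r" "0 < h" "0 < lam"
  shows "0 < r powr (4/7) * h powr (6/7) * lam powr (5/7)" "0 < r powr (2/3) * h powr (2/3) * lam"
  using assms by auto

lemma threshold_powers:
  fixes r h lam m :: real
  assumes "0 < h" "0 < lam" "2 \<le> m"
  shows "lam powr (1/2) * h powr (1/4) \<le> r \<Longrightarrow> lam\<^sup>2 * h \<le> r ^ 4"
    and "m powr (1/2) * h powr (1/2) \<le> r \<Longrightarrow> h \<le> r\<^sup>2"
    and "0 < lam powr (1/2) * h powr (1/4)" "0 < m powr (1/2) * h powr (1/2)"
proof -
  show p: "0 < lam powr (1/2) * h powr (1/4)" "0 < m powr (1/2) * h powr (1/2)" using assms by auto
  show "lam\<^sup>2 * h \<le> r ^ 4" if "lam powr (1/2) * h powr (1/4) \<le> r"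
  proof -
    have "(lam powr (1/2) * h powr (1/4)) ^ 4 = lam\<^sup>2 * h"
      using assms powr_frac_power[of lam "1/2" 4 2] powr_frac_power[of h "1/4" 4 1] by (simp add: power_mult_distrib)
    then show ?thesis using power_mono[OF that, of 4] p(1) by simp
  qed
  show "h \<le> r\<^sup>2" if "m powr (1/2) * h powr (1/2) \<le> r"
  proof -
    have "(m powr (1/2) * h powr (1/2))\<^sup>2 = m * h"
      using assms powr_frac_power[of m "1/2" 2 1] powr_frac_power[of h "1/2" 2 1] by (simp add: power_mult_distrib)
    then have "m * h \<le> r\<^sup>2" using power_mono[OF that, of 2] p(2) by simp
    moreover have "1 * h \<le> m * h" using assms by (intro mult_right_mono) auto
    ultimately show ?thesis by simp
  qed
qed

lemma excess_energy_scaling_bounded_slope: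
  fixes h lam rho m :: real
  assumes hl: "0 < h" "0 < lam" "lam \<le> 1/2" and m: "2 \<le> m"
    and thr: "min (lam powr (1/2) * h powr (1/4)) (m powr (1/2) * h powr (1/2)) \<le> rho - 1"
    and R: "R = min (lam\<^sup>2) (max ((rho - 1) powr (4/7) * h powr (6/7) * lam powr (5/7))
                      ((rho - 1) powr (2/3) * h powr (2/3) * lam))"
  shows "excess_energy h lam rho (ereal m) \<le> ereal (10 ^ 20 * R)"
    and "ereal R \<le> ereal (4 * (1 + m\<^sup>2)) * excess_energy h lam rho (ereal m)"
proof -
  define X1 where "X1 = (rho - 1) powr (4/7) * h powr (6/7) * lam powr (5/7)"
  define X2 where "X2 = (rho - 1) powr (2/3) * h powr (2/3) * lam"
  have R_eq: "R = min (lam\<^sup>2) (max X1 X2)" unfolding R X1_def X2_def ..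
  note th = threshold_powers[OF hl(1,2) m]
  have "0 < min (lam powr (1/2) * h powr (1/4)) (m powr (1/2) * h powr (1/2))" using th(3,4) by simp
  then have rho: "1 < rho" using thr by linarith
  then have r: "0 < rho - 1" by simp
  note Xp = scaling_powers[OF r hl(1,2), folded X1_def X2_def]
  note X0 = scaling_positive[OF r hl(1,2), folded X1_def X2_def]
  have "lam powr (1/2) * h powr (1/4) \<le> rho - 1 \<or> m powr (1/2) * h powr (1/2) \<le> rho - 1"
    using thr by (simp add: min_le_iff_disj)
  then have c0: "lam\<^sup>2 * h \<le> (rho - 1) ^ 4 \<or> h \<le> (rho - 1)\<^sup>2" using th(1,2) by blast
  show "excess_energy h lam rho (ereal m) \<le> ereal (10 ^ 20 * R)"
    unfolding R_eq by (rule bounded_slope_upper_bound[OF hl rho m X0 Xp c0])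
  define \<kappa> where "\<kappa> = max (X1 / 2) (X2 / (1 + m\<^sup>2))"
  show "ereal R \<le> ereal (4 * (1 + m\<^sup>2)) * excess_energy h lam rho (ereal m)"
  proof (rule excess_lower_bound[OF hl(1,2) rho, where \<kappa> = \<kappa>])
    fix A B D :: real
    assume ABD: "0 \<le> A" "0 \<le> B" "lam \<le> D" "D ^ 5 \<le> 4 * A ^ 4 * B ^ 3"
      "\<And>m' \<tau>. ereal m = ereal m' \<Longrightarrow> 0 < \<tau> \<Longrightarrow> D \<le> 2 * \<tau> * sqrt (B * A) + m'\<^sup>2 * A / \<tau>\<^sup>2"
    show "\<kappa> \<le> (rho - 1) * A + h\<^sup>2 * B"
      unfolding \<kappa>_def
      using slice_bound_one_fold[OF r hl(1,2) ABD(1-4) Xp(1)]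
        slice_bound_many_folds[OF r hl(1,2) ABD(1-3) X0(2) ABD(5)[OF refl] Xp(2)] by simp
  next
    show "0 \<le> R" unfolding R_eq using X0 by (auto simp: le_max_iff_disj)
    have m1: "1 \<le> 1 + m\<^sup>2" by simp
    have "lam\<^sup>2 * 1 \<le> lam\<^sup>2 * (1 + m\<^sup>2)" using m1 by (intro mult_left_mono) auto
    moreover have "R \<le> lam\<^sup>2" by (simp add: R_eq)
    moreover have "4 * (1 + m\<^sup>2) * (lam\<^sup>2 / 4) = lam\<^sup>2 * (1 + m\<^sup>2)" by simp
    ultimately have a: "R \<le> 4 * (1 + m\<^sup>2) * (lam\<^sup>2 / 4)" by linarith
    have "X1 = 2 * (X1 / 2)" by simp
    also have "\<dots> \<le> 4 * (1 + m\<^sup>2) * \<kappa>" using X0 m1 by (intro mult_mono) (auto simp: \<kappa>_def)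
    finally have b1: "X1 \<le> 4 * (1 + m\<^sup>2) * \<kappa>" .
    have "1 + m\<^sup>2 \<noteq> 0" using m1 by linarith
    then have "X2 = (1 + m\<^sup>2) * (X2 / (1 + m\<^sup>2))" by simp
    also have "\<dots> \<le> 4 * (1 + m\<^sup>2) * \<kappa>" using X0 m1 by (intro mult_mono) (auto simp: \<kappa>_def)
    finally have "R \<le> 4 * (1 + m\<^sup>2) * \<kappa>" using b1 by (simp add: R_eq min_le_iff_disj)
    with a show "R \<le> 4 * (1 + m\<^sup>2) * min (lam\<^sup>2 / 4) \<kappa>" by (simp add: min_def)
    show "0 < 4 * (1 + m\<^sup>2)" using m1 by (intro mult_pos_pos less_le_trans[OF zero_less_one]) auto
  qed
qed

lemma excess_energy_scaling_unbounded_slope: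
  fixes h lam rho :: real
  assumes hl: "0 < h" "h \<le> 1/2" "0 < lam" "lam \<le> 1/2"
    and thr: "lam powr (1/2) * h powr (1/4) \<le> rho - 1"
    and R: "R = min (lam\<^sup>2) ((rho - 1) powr (4/7) * h powr (6/7) * lam powr (5/7))"
  shows "excess_energy h lam rho \<infinity> \<le> ereal (10 ^ 20 * R)"
    and "ereal R \<le> ereal 4 * excess_energy h lam rho \<infinity>"
proof -
  define X where "X = (rho - 1) powr (4/7) * h powr (6/7) * lam powr (5/7)"
  have R_eq: "R = min (lam\<^sup>2) X" unfolding R X_def ..
  note th = threshold_powers[OF hl(1,3) order_refl]
  have rho: "1 < rho" using thr th(3) by linarith
  then have r: "0 < rho - 1" by simp
  note Xp = scaling_powers(1)[OF r hl(1,3), folded X_def]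
  note X0 = scaling_positive(1)[OF r hl(1,3), folded X_def]
  show "excess_energy h lam rho \<infinity> \<le> ereal (10 ^ 20 * R)"
    unfolding R_eq by (rule unbounded_slope_upper_bound[OF hl rho X0 Xp th(1)[OF thr]])
  show "ereal R \<le> ereal 4 * excess_energy h lam rho \<infinity>"
  proof (rule excess_lower_bound[OF hl(1,3) rho, where \<kappa> = "X / 2"])
    show "X / 2 \<le> (rho - 1) * A + h\<^sup>2 * B"
      if "0 \<le> A" "0 \<le> B" "lam \<le> D" "D ^ 5 \<le> 4 * A ^ 4 * B ^ 3" for A B D
      by (rule slice_bound_one_fold[OF r hl(1,3) that Xp])
    show "0 \<le> R" unfolding R_eq using X0 by simp
    show "R \<le> 4 * min (lam\<^sup>2 / 4) (X / 2)" unfolding R_eq using X0 by (auto simp: min_def)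
  qed simp
qed

theorem theorem1p1:
  shows "(\<forall>m::real. m \<ge> 2 \<longrightarrow>
           (\<exists>C>0. \<exists>C'>0. \<forall>h lam rho :: real.
              0 < h \<and> h \<le> 1/2 \<and> 0 < lam \<and> lam \<le> 1/2 \<and> 1 \<le> rho \<and>
              rho - 1 \<ge> min (lam powr (1/2) * h powr (1/4)) (m powr (1/2) * h powr (1/2)) \<longrightarrow>
              (let R = min (lam\<^sup>2)
                         (max ((rho - 1) powr (4/7) * h powr (6/7) * lam powr (5/7))
                              ((rho - 1) powr (2/3) * h powr (2/3) * lam))
               in excess_energy h lam rho (ereal m) \<le> ereal C * ereal R \<and>
                  ereal R \<le> ereal C' * excess_energy h lam rho (ereal m))))
       \<and> (\<exists>C>0. \<exists>C'>0. \<forall>h lam rho :: real.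
              0 < h \<and> h \<le> 1/2 \<and> 0 < lam \<and> lam \<le> 1/2 \<and> 1 \<le> rho \<and>
              rho - 1 \<ge> lam powr (1/2) * h powr (1/4) \<longrightarrow>
              (let R = min (lam\<^sup>2) ((rho - 1) powr (4/7) * h powr (6/7) * lam powr (5/7))
               in excess_energy h lam rho \<infinity> \<le> ereal C * ereal R \<and>
                  ereal R \<le> ereal C' * excess_energy h lam rho \<infinity>))"
proof (intro conjI allI impI, goal_cases)
  case (1 m)
  have "0 < 1 + m\<^sup>2" by (smt (verit) zero_le_power2)
  then show ?case
    using excess_energy_scaling_bounded_slope[OF _ _ _ 1 _ refl]
    by (intro exI[of _ "10 ^ 20"] exI[of _ "4 * (1 + m\<^sup>2)"] conjI allI impI) (simp_all add: Let_def)
next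
  case 2
  show ?case
    using excess_energy_scaling_unbounded_slope[OF _ _ _ _ _ refl]
    by (intro exI[of _ "10 ^ 20"] exI[of _ 4] conjI allI impI) (simp_all add: Let_def)
qed

end
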